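(* Consider the multi-battlefield R-Lotto game with regulator budget $\rho\in\mathbb R_+$, with $M\ge1$ battlefields, values $v_m>0$ with $\sum_{m=1}^M v_m=1$, follower budgets $a_m\ge b_m>0$ for $m=1,\dots,M$, and weights $w_A,w_B\ge0$ with $w_A+w_B=1$. Then the NSE (Nash--Stackelberg equilibrium) distributions $F_{\mathbf c^*}=(F_{c_1^*},\dots,F_{c_M^*})$ of the regulator's intervention are characterized as follows: (i) If $w_A=w_B$, then $F_{c_m^*}\sim\delta_0$ for all $m=1,\dots,M$. (ii) If $w_A>w_B$, then $F_{c_m^*}\sim\delta_{f_m(\lambda_0)}$, where $\lambda_0>0$ is the unique solution of $\sum_{m=1}^M -f_m(\lambda_0)=\rho$. The strictly increasing function $f_m(\lambda)$ is defined as $$f_m(\lambda)=\begin{cases}0,&\lambda\ge\frac{v_mb_m}{2a_m^2},\\ -\frac{a_m}{2}\left(p_m(\lambda)^2-1\right),&\lambda<\frac{v_mb_m}{2a_m^2},\end{cases}$$ where, for any fixed $\lambda<\frac{v_mb_m}{2a_m^2}$ (with $\lambda>0$), $p_m(\lambda)\ge1$ is the unique solution of $p_m(\lambda)(1+p_m(\lambda))^3=\frac{4v_mb_m}{\lambda a_m^2}$. (iii) If $w_A<w_B$, then $$F_{c_m^*}\sim\begin{cases}\frac{g_m(\eta_0)}{\tau_m}\delta_{\tau_m}+\left(1-\frac{g_m(\eta_0)}{\tau_m}\right)\delta_0,&0\le g_m(\eta_0)<\tau_m,\\ \delta_{g_m(\eta_0)},&g_m(\eta_0)\ge\tau_m,\end{cases}$$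 where $\eta_0>0$ is the unique solution of $\sum_{m=1}^M g_m(\eta_0)=\rho$. The strictly decreasing function $g_m(\eta)$ is defined as $$g_m(\eta)=\begin{cases}0,&\eta>v_mP_m^{+\prime}(\tau_m),\\ [0,\tau_m],&\eta=v_mP_m^{+\prime}(\tau_m),\\ \frac{b_m}{2}\left(q_m(\eta)^2-1\right),&0<\eta<v_mP_m^{+\prime}(\tau_m),\end{cases}$$ where, for any fixed $\eta\in(0,v_mP_m^{+\prime}(\tau_m))$, $q_m(\eta)\ge\sqrt{1+\frac{2\tau_m}{b_m}}$ is the unique solution of $q_m(\eta)(1+q_m(\eta))^3=\frac{4v_ma_m}{\eta b_m^2}$.
   Context: $\delta_z$ denotes the Dirac distribution at $z$ and $U(\ell,r)$ the uniform distribution on $[\ell,r]$. Multi-battlefield R-Lotto game. There are $M$ battlefields with values $v_m$ (battlefields of value $0$ are omitted). Stage 1: Player C (the regulator), with resource budget $\rho$, chooses the distribution $F_{\mathbf c}$ of a random intervention vector $\mathbf C=(C_1,\dots,C_M)\in\mathbb R^M$ subject to $\mathbb E[\sum_{m=1}^M|C_m|]\le\rho$; there is no intervention cost. Stage 2: given the intervention vector $\mathbf c=(c_1,\dots,c_M)$, Player A chooses $F_{\mathbf X}=(F_{x_1},\dots,F_{x_M})$, where $F_{x_m}$ is the distribution of a nonnegative random variable $X_m$ with $\mathbb E[X_m]=a_m$, and Player B chooses $F_{\mathbf Y}=(F_{y_1},\dots,F_{y_M})$, where $F_{y_m}$ is the distribution of a nonnegative random variable $Y_m$ with $\mathbb E[Y_m]=b_m$.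 The payoffs are $\Pi_A(F_{\mathbf X},F_{\mathbf Y};\mathbf c)=\sum_{m=1}^M v_m\mathbb P(X_m\ge Y_m+c_m)$ (with $X_m\sim F_{x_m}$, $Y_m\sim F_{y_m}$ independent) and $\Pi_B=1-\Pi_A$. Player C maximizes $\mathbb E_{\mathbf C\sim F_{\mathbf c}}[w_A\Pi_A+w_B\Pi_B]$. Followers' Nash equilibrium. For each realized $\mathbf c$ and each $m$, the equilibrium marginals on battlefield $m$ are $(\bar F_{x_m}^{c_m},\bar F_{y_m}^{c_m})$, given with $a=a_m$, $b=b_m$, $c=c_m$, $r=a-\frac{b+\sqrt{b^2+8ab}}4$ by: $d=\frac{b+\sqrt{b^2+2cb}}{2}$ if $c\ge r$; $d=a-c$ if $0\le c<r$; $d=\frac{a+\sqrt{a^2-2ca}}{2}$ if $c<0$; and, if $c\ge0$, $\bar F_x^c\sim(1-\frac{a}{c+d})\delta_0+\frac{a}{c+d}U(c,c+2d)$ and $\bar F_y^c\sim(1-\frac bd)\delta_0+\frac bdU(0,2d)$; if $c<0$, $\bar F_x^c\sim(1-\frac ad)\delta_0+\frac adU(0,2d)$ and $\bar F_y^c\sim(1-\frac b{d-c})\delta_0+\frac b{d-c}U(-c,-c+2d)$. Let $P_m(c)=\mathbb P(X_m\ge Y_m+c)$ for $X_m\sim\bar F_{x_m}^c$, $Y_m\sim\bar F_{y_m}^c$ independent. Explicitly, with $r_m=a_m-\frac{b_m+\sqrt{b_m^2+8a_mb_m}}4$, $$P_m(c)=\begin{cases}\frac{a_m}{b_m+c+\sqrt{b_m^2+2b_mc}},&c\ge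 r_m,\\ 1-\frac{b_m}{2(a_m-c)},&0\le c<r_m,\\ 1-\frac{b_m}{a_m-c+\sqrt{a_m^2-2a_mc}},&c<0.\end{cases}$$ When the followers play their equilibrium for each intervention vector, Player C's payoff is $J_M(\mathbf C)=w_B+(w_A-w_B)\sum_{m=1}^M v_m\mathbb E[P_m(C_m)]$. An NSE consists of a feasible intervention distribution $F_{\mathbf c^*}$, with marginals $F_{c_m^*}$, that maximizes $J_M$ over all feasible distributions, together with the followers' Nash equilibrium for every intervention vector. Define $P_m^+(c)=P_m(0)-P_m(c)$ for $c\ge0$, with derivative $P_m^{+\prime}$. $\tau_m\ge r_m$ is the (unique) solution of the tangency equation $P_m^+(\tau_m)=\tau_mP_m^{+\prime}(\tau_m)$. At the breakpoint $\eta=v_mP_m^{+\prime}(\tau_m)$, where $g_m(\eta)=[0,\tau_m]$, battlefield $m$ can receive any allocation in $[0,\tau_m]$, so that the remaining budget is absorbed by such breakpoint battlefields; $g_m(\eta_0)$ then denotes the allocation so chosen.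
   Formalization: Case (i) says only that δ_0 is an NSE (if w_A=w_B every feasible law is optimal); λ_0 and η_0 are claimed unique only for ρ>0; f_m and g_m are claimed strictly monotone only on (0, v_m b_m/(2a_m²)] and (0, v_m P_m^{+'}(τ_m)], since beyond these they vanish. *)

theory Defs
  imports "HOL-Probability.Probability"
begin

text \<open>Battlefields are the elements of a finite type \<open>'m\<close>, so that \<open>M = CARD('m)\<close> and intervention
  vectors have type \<open>real ^ 'm\<close>. The values \<open>v\<close> and the follower budgets \<open>a\<close>, \<open>b\<close> are functions on \<open>'m\<close>;
  definitions that concern a single battlefield take its scalars \<open>v m\<close>, \<open>a m\<close>, \<open>b m\<close> instead.\<close>

subsection \<open>The game\<close>

text \<open>The distribution \<open>p \<mu> + (1 - p) \<nu>\<close> for \<open>p \<in> [0, 1]\<close>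
  (\<open>bernoulli_pmf\<close> truncates \<open>p\<close> to \<open>[0, 1]\<close>).\<close>

definition mixture :: "real \<Rightarrow> real measure \<Rightarrow> real measure \<Rightarrow> real measure" where
  "mixture p \<mu> \<nu> = measure_pmf (bernoulli_pmf p) \<bind> (\<lambda>t. if t then \<mu> else \<nu>)"

abbreviation uniform_dist :: "real \<Rightarrow> real \<Rightarrow> real measure" where
  "uniform_dist l r \<equiv> uniform_measure lborel {l..r}"

abbreviation dirac :: "real \<Rightarrow> real measure" where
  "dirac z \<equiv> return borel z"

definition nonneg_dist_with_mean :: "real \<Rightarrow> real measure \<Rightarrow> bool" where
  "nonneg_dist_with_mean e \<mu> \<longleftrightarrow>
     prob_space \<mu> \<and> sets \<mu> = sets borel \<and> (AE x in \<mu>. 0 \<le> x) \<and>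
     integrable \<mu> (\<lambda>x. x) \<and> (\<integral>x. x \<partial>\<mu>) = e"

text \<open>\<open>P(X \<ge> Y + c)\<close> for independent \<open>X \<sim> \<mu>\<close>, \<open>Y \<sim> \<nu>\<close>.\<close>

definition win_prob :: "real measure \<Rightarrow> real measure \<Rightarrow> real \<Rightarrow> real" where
  "win_prob \<mu> \<nu> c = measure (\<mu> \<Otimes>\<^sub>M \<nu>) {(x, y). x \<ge> y + c}"

definition payoff_A ::
    "('m::finite \<Rightarrow> real) \<Rightarrow> ('m \<Rightarrow> real measure) \<Rightarrow> ('m \<Rightarrow> real measure) \<Rightarrow> real ^ 'm \<Rightarrow> real" where
  "payoff_A v X Y c = (\<Sum>m\<in>UNIV. v m * win_prob (X m) (Y m) (c $ m))"

definition payoff_B ::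
    "('m::finite \<Rightarrow> real) \<Rightarrow> ('m \<Rightarrow> real measure) \<Rightarrow> ('m \<Rightarrow> real measure) \<Rightarrow> real ^ 'm \<Rightarrow> real" where
  "payoff_B v X Y c = 1 - payoff_A v X Y c"

definition followers_NE ::
    "('m::finite \<Rightarrow> real) \<Rightarrow> ('m \<Rightarrow> real) \<Rightarrow> ('m \<Rightarrow> real) \<Rightarrow> real ^ 'm \<Rightarrow>
     ('m \<Rightarrow> real measure) \<Rightarrow> ('m \<Rightarrow> real measure) \<Rightarrow> bool" where
  "followers_NE v a b c X Y \<longleftrightarrow>
     (\<forall>m. nonneg_dist_with_mean (a m) (X m)) \<and>
     (\<forall>m. nonneg_dist_with_mean (b m) (Y m)) \<and>
     (\<forall>X'. (\<forall>m. nonneg_dist_with_mean (a m) (X' m)) \<longrightarrow> payoff_A v X' Y c \<le> payoff_A v X Y c) \<and>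
     (\<forall>Y'. (\<forall>m. nonneg_dist_with_mean (b m) (Y' m)) \<longrightarrow> payoff_B v X Y' c \<le> payoff_B v X Y c)"

definition intervention_dist :: "(real ^ 'm::finite) measure \<Rightarrow> bool" where
  "intervention_dist F \<longleftrightarrow> prob_space F \<and> sets F = sets borel"

definition marginal :: "(real ^ 'm::finite) measure \<Rightarrow> 'm \<Rightarrow> real measure" where
  "marginal F m = distr F borel (\<lambda>c. c $ m)"

definition feasible :: "real \<Rightarrow> (real ^ 'm::finite) measure \<Rightarrow> bool" where
  "feasible \<rho> F \<longleftrightarrow>
     intervention_dist F \<and> (\<integral>\<^sup>+c. ennreal (\<Sum>m\<in>UNIV. \<bar>c $ m\<bar>) \<partial>F) \<le> ennreal \<rho>"

text \<open>Strategies of the followers in the whole game map the realized intervention vector to a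
  family of marginals.\<close>

definition payoff_C ::
    "('m::finite \<Rightarrow> real) \<Rightarrow> real \<Rightarrow> real \<Rightarrow> (real ^ 'm) measure \<Rightarrow>
     (real ^ 'm \<Rightarrow> 'm \<Rightarrow> real measure) \<Rightarrow> (real ^ 'm \<Rightarrow> 'm \<Rightarrow> real measure) \<Rightarrow> real" where
  "payoff_C v wA wB F SX SY =
     (\<integral>c. wA * payoff_A v (SX c) (SY c) c + wB * payoff_B v (SX c) (SY c) c \<partial>F)"

definition is_NSE ::
    "('m::finite \<Rightarrow> real) \<Rightarrow> ('m \<Rightarrow> real) \<Rightarrow> ('m \<Rightarrow> real) \<Rightarrow> real \<Rightarrow> real \<Rightarrow> real \<Rightarrow>
     (real ^ 'm) measure \<Rightarrow>
     (real ^ 'm \<Rightarrow> 'm \<Rightarrow> real measure) \<Rightarrow> (real ^ 'm \<Rightarrow> 'm \<Rightarrow> real measure) \<Rightarrow> bool" where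
  "is_NSE v a b wA wB \<rho> F SX SY \<longleftrightarrow>
     feasible \<rho> F \<and>
     (\<forall>F'. feasible \<rho> F' \<longrightarrow> payoff_C v wA wB F' SX SY \<le> payoff_C v wA wB F SX SY) \<and>
     (\<forall>c. followers_NE v a b c (SX c) (SY c))"

subsection \<open>The followers' equilibrium\<close>

definition r_thr :: "real \<Rightarrow> real \<Rightarrow> real" where
  "r_thr a b = a - (b + sqrt (b\<^sup>2 + 8 * a * b)) / 4"

definition d_eq :: "real \<Rightarrow> real \<Rightarrow> real \<Rightarrow> real" where
  "d_eq a b c =
     (if c \<ge> r_thr a b then (b + sqrt (b\<^sup>2 + 2 * c * b)) / 2
      else if 0 \<le> c then a - c
      else (a + sqrt (a\<^sup>2 - 2 * c * a)) / 2)"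

definition X_eq :: "real \<Rightarrow> real \<Rightarrow> real \<Rightarrow> real measure" where
  "X_eq a b c = (let d = d_eq a b c in
     if c \<ge> 0 then mixture (a / (c + d)) (uniform_dist c (c + 2 * d)) (dirac 0)
     else mixture (a / d) (uniform_dist 0 (2 * d)) (dirac 0))"

definition Y_eq :: "real \<Rightarrow> real \<Rightarrow> real \<Rightarrow> real measure" where
  "Y_eq a b c = (let d = d_eq a b c in
     if c \<ge> 0 then mixture (b / d) (uniform_dist 0 (2 * d)) (dirac 0)
     else mixture (b / (d - c)) (uniform_dist (- c) (- c + 2 * d)) (dirac 0))"

definition SX_eq ::
    "('m::finite \<Rightarrow> real) \<Rightarrow> ('m \<Rightarrow> real) \<Rightarrow> real ^ 'm \<Rightarrow> 'm \<Rightarrow> real measure" where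
  "SX_eq a b c m = X_eq (a m) (b m) (c $ m)"

definition SY_eq ::
    "('m::finite \<Rightarrow> real) \<Rightarrow> ('m \<Rightarrow> real) \<Rightarrow> real ^ 'm \<Rightarrow> 'm \<Rightarrow> real measure" where
  "SY_eq a b c m = Y_eq (a m) (b m) (c $ m)"

definition P_eq :: "real \<Rightarrow> real \<Rightarrow> real \<Rightarrow> real" where
  "P_eq a b c = win_prob (X_eq a b c) (Y_eq a b c) c"

subsection \<open>Allocations when A is favoured\<close>

definition is_p :: "real \<Rightarrow> real \<Rightarrow> real \<Rightarrow> real \<Rightarrow> real \<Rightarrow> bool" where
  "is_p v a b l p \<longleftrightarrow> p \<ge> 1 \<and> p * (1 + p) ^ 3 = 4 * v * b / (l * a\<^sup>2)"

definition p_sol :: "real \<Rightarrow> real \<Rightarrow> real \<Rightarrow> real \<Rightarrow> real" where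
  "p_sol v a b l = (THE p. is_p v a b l p)"

definition f_thr :: "real \<Rightarrow> real \<Rightarrow> real \<Rightarrow> real" where
  "f_thr v a b = v * b / (2 * a\<^sup>2)"

definition f_alloc :: "real \<Rightarrow> real \<Rightarrow> real \<Rightarrow> real \<Rightarrow> real" where
  "f_alloc v a b l =
     (if l \<ge> f_thr v a b then 0 else - (a / 2) * ((p_sol v a b l)\<^sup>2 - 1))"

subsection \<open>Allocations when B is favoured\<close>

definition P_plus :: "real \<Rightarrow> real \<Rightarrow> real \<Rightarrow> real" where
  "P_plus a b c = P_eq a b 0 - P_eq a b c"

text \<open>\<open>P_plus\<close> is considered on \<open>[0, \<infinity>)\<close> only, so its derivative at \<open>0\<close> is the right derivative;
  it is needed there because the tangency point is \<open>0\<close> when \<open>a = b\<close>.\<close>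

definition P_plus' :: "real \<Rightarrow> real \<Rightarrow> real \<Rightarrow> real" where
  "P_plus' a b c = vector_derivative (P_plus a b) (at c within {0..})"

definition is_tau :: "real \<Rightarrow> real \<Rightarrow> real \<Rightarrow> bool" where
  "is_tau a b t \<longleftrightarrow> t \<ge> r_thr a b \<and> P_plus a b t = t * P_plus' a b t"

definition tau :: "real \<Rightarrow> real \<Rightarrow> real" where
  "tau a b = (THE t. is_tau a b t)"

definition is_q :: "real \<Rightarrow> real \<Rightarrow> real \<Rightarrow> real \<Rightarrow> real \<Rightarrow> bool" where
  "is_q v a b h q \<longleftrightarrow>
     q \<ge> sqrt (1 + 2 * tau a b / b) \<and> q * (1 + q) ^ 3 = 4 * v * a / (h * b\<^sup>2)"

definition q_sol :: "real \<Rightarrow> real \<Rightarrow> real \<Rightarrow> real \<Rightarrow> real" where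
  "q_sol v a b h = (THE q. is_q v a b h q)"

definition g_thr :: "real \<Rightarrow> real \<Rightarrow> real \<Rightarrow> real" where
  "g_thr v a b = v * P_plus' a b (tau a b)"

text \<open>Set-valued, with a singleton value away from the breakpoint \<open>g_thr v a b\<close>.\<close>

definition g_alloc :: "real \<Rightarrow> real \<Rightarrow> real \<Rightarrow> real \<Rightarrow> real set" where
  "g_alloc v a b h =
     (if h > g_thr v a b then {0}
      else if h = g_thr v a b then {0..tau a b}
      else {b / 2 * ((q_sol v a b h)\<^sup>2 - 1)})"

text \<open>The families \<open>x\<close> with \<open>x m\<close> chosen from the value of the \<open>m\<close>-th correspondence at \<open>h\<close> that
  exhaust the budget. That \<open>h\<close> solves the set-valued budget equation means that there is one.\<close>

definition g_selections ::
    "('m::finite \<Rightarrow> real) \<Rightarrow> ('m \<Rightarrow> real) \<Rightarrow> ('m \<Rightarrow> real) \<Rightarrow> real \<Rightarrow> real \<Rightarrow> ('m \<Rightarrow> real) set" where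
  "g_selections v a b \<rho> h =
     {x. (\<forall>m. x m \<in> g_alloc (v m) (a m) (b m) h) \<and> (\<Sum>m\<in>UNIV. x m) = \<rho>}"

end

(* The followers' candidate strategies form an equilibrium for every offset because each player's
   winning probability against a fixed bid is dominated by an affine function of that bid, with
   equality on the support of the player's own strategy. This also yields P_m in closed form.

   In the variable q = sqrt (1 + 2 t / B) each branch of P_m beyond its breakpoint is, up to sign and
   a constant, 2 A / (B (1 + q)^2): a strictly convex function whose derivative is a constant times
   1 / (q (1 + q)^3). This is where the quartic equations of the theorem come from.

   The regulator's problem is solved by weak duality. With a multiplier h for the budget, the value
   v_m P_m (respectively v_m P_m^+) is bounded by k_m + h |c|, with equality exactly on a set E_m that
   has at most two points: the point f_m, respectively the point g_m or, at the breakpoint, the ends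
   0 and tau_m of the chord of the concave envelope. A feasible distribution is then optimal iff it
   lives on the product of the E_m and exhausts the budget. *)

theory Submission
  imports Defs
begin

subsection \<open>Mixtures and uniform distributions\<close>

text \<open>\<open>P_plus\<close> is not concave on the nonnegative axis: it is convex up to
  \<open>r_thr\<close> and concave beyond. A pure intervention strictly between 0 and
  \<open>tau\<close> is therefore beaten by the lottery on 0 and \<open>tau\<close> with the same
  mean; this is the origin of the randomisation when B is favoured, and \<open>tau\<close> is the
  point where a line from the origin touches the graph. For a = b the convex piece shrinks to the
  point 0, so that \<open>r_thr\<close> and \<open>tau\<close> are both 0; the lemmas have to
  include this case.

  At a breakpoint price every mean in \<open>{0..tau a b}\<close> is equally good for the penalised
  payoff, so the demand for budget is set-valued and a price can only be determined together with a
  selection. This is why the clearing price is a supremum and not an application of the intermediate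
  value theorem.

  The dual bound alone yields sufficiency. To see that every optimum meets it with equality, some
  feasible law attaining it must be exhibited; hence the coupling of prescribed marginals.\<close>

lemma mixture_kernel:
  assumes "prob_space \<mu>" "sets \<mu> = sets borel" "prob_space \<nu>" "sets \<nu> = sets borel"
  shows "(\<lambda>t. if t then \<mu> else \<nu>) \<in> measurable (measure_pmf q) (subprob_algebra borel)"
  using assms by (auto simp: space_subprob_algebra prob_space_imp_subprob_space)

lemma sets_mixture [simp]:
  assumes "prob_space \<mu>" "sets \<mu> = sets borel" "prob_space \<nu>" "sets \<nu> = sets borel"
  shows "sets (mixture p \<mu> \<nu>) = sets borel"
  unfolding mixture_def by (rule sets_bind) (use assms in auto)

lemma prob_space_mixture:
  assumes "prob_space \<mu>" "sets \<mu> = sets borel" "prob_space \<nu>" "sets \<nu> = sets borel"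
  shows "prob_space (mixture p \<mu> \<nu>)"
  unfolding mixture_def
  by (rule prob_space.prob_space_bind[OF _ _ mixture_kernel[OF assms]])
     (use assms in \<open>auto simp: prob_space_measure_pmf\<close>)

lemma nn_integral_mixture:
  assumes "prob_space \<mu>" "sets \<mu> = sets borel" "prob_space \<nu>" "sets \<nu> = sets borel"
    and "0 \<le> p" "p \<le> 1" and [measurable]: "f \<in> borel_measurable borel"
  shows "(\<integral>\<^sup>+x. f x \<partial>mixture p \<mu> \<nu>) =
    ennreal p * (\<integral>\<^sup>+x. f x \<partial>\<mu>) + ennreal (1 - p) * (\<integral>\<^sup>+x. f x \<partial>\<nu>)"
  unfolding mixture_def
  by (subst nn_integral_bind[OF _ mixture_kernel[OF assms(1-4)]])
     (use assms in \<open>simp_all add: mult.commute\<close>)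

lemma measure_mixture:
  assumes "prob_space \<mu>" "sets \<mu> = sets borel" "prob_space \<nu>" "sets \<nu> = sets borel"
    and "0 \<le> p" "p \<le> 1" and A: "A \<in> sets borel"
  shows "measure (mixture p \<mu> \<nu>) A = p * measure \<mu> A + (1 - p) * measure \<nu> A"
proof -
  interpret M: prob_space \<mu> by fact
  interpret N: prob_space \<nu> by fact
  have "emeasure (mixture p \<mu> \<nu>) A = (\<integral>\<^sup>+x. indicator A x \<partial>mixture p \<mu> \<nu>)"
    using A assms by simp
  also have "\<dots> = ennreal p * emeasure \<mu> A + ennreal (1 - p) * emeasure \<nu> A"
    using A assms by (subst nn_integral_mixture) auto
  also have "\<dots> = ennreal (p * measure \<mu> A + (1 - p) * measure \<nu> A)"
    using assms by (simp add: M.emeasure_eq_measure N.emeasure_eq_measure ennreal_mult' ennreal_plus)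
  finally have "measure (mixture p \<mu> \<nu>) A = enn2real (ennreal (p * measure \<mu> A + (1 - p) * measure \<nu> A))"
    by (simp only: measure_def[of "mixture p \<mu> \<nu>"])
  also have "\<dots> = p * measure \<mu> A + (1 - p) * measure \<nu> A"
    by (rule enn2real_ennreal) (use assms in auto)
  finally show ?thesis .
qed

lemma AE_mixture:
  assumes "prob_space \<mu>" "sets \<mu> = sets borel" "prob_space \<nu>" "sets \<nu> = sets borel"
    and "0 \<le> p" "p \<le> 1" and [measurable]: "Measurable.pred borel P"
    and "0 < p \<Longrightarrow> AE x in \<mu>. P x" "p < 1 \<Longrightarrow> AE x in \<nu>. P x"
  shows "AE x in mixture p \<mu> \<nu>. P x"
  unfolding mixture_def
  by (subst AE_bind[OF mixture_kernel[OF assms(1-4)]])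
     (use assms in \<open>auto simp: AE_measure_pmf_iff set_pmf_iff\<close>)

text \<open>The computation goes through \<open>nn_integral_mixture\<close>, which is why f has to
  be nonnegative almost everywhere; bids are. Integrability under the mixture then comes for
  free.\<close>

lemma has_bochner_integral_mixture:
  fixes f :: "real \<Rightarrow> real"
  assumes M: "prob_space \<mu>" "sets \<mu> = sets borel" "prob_space \<nu>" "sets \<nu> = sets borel"
    and p: "0 \<le> p" "p \<le> 1" and f [measurable]: "f \<in> borel_measurable borel"
    and \<mu>: "AE x in \<mu>. 0 \<le> f x" "has_bochner_integral \<mu> f I"
    and \<nu>: "AE x in \<nu>. 0 \<le> f x" "has_bochner_integral \<nu> f J"
  shows "has_bochner_integral (mixture p \<mu> \<nu>) f (p * I + (1 - p) * J)"
proof (rule has_bochner_integral_nn_integral)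
  have i: "integrable \<mu> f" "integral\<^sup>L \<mu> f = I" "integrable \<nu> f" "integral\<^sup>L \<nu> f = J"
    using \<mu>(2) \<nu>(2) by (auto simp: has_bochner_integral_iff)
  have I: "(\<integral>\<^sup>+x. f x \<partial>\<mu>) = ennreal I" "0 \<le> I"
    using nn_integral_eq_integral[OF i(1) \<mu>(1)] integral_nonneg_AE[OF \<mu>(1)] i(2) by simp_all
  have J: "(\<integral>\<^sup>+x. f x \<partial>\<nu>) = ennreal J" "0 \<le> J"
    using nn_integral_eq_integral[OF i(3) \<nu>(1)] integral_nonneg_AE[OF \<nu>(1)] i(4) by simp_all
  show "0 \<le> p * I + (1 - p) * J" using p I J by simp
  show "(\<integral>\<^sup>+x. f x \<partial>mixture p \<mu> \<nu>) = ennreal (p * I + (1 - p) * J)"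
    using p I(2) J(2)
    by (subst nn_integral_mixture[OF M p]) (simp_all add: I(1) J(1) ennreal_mult' ennreal_plus)
  show "AE x in mixture p \<mu> \<nu>. 0 \<le> f x"
    by (rule AE_mixture[OF M p]) (use \<mu>(1) \<nu>(1) in auto)
  show "f \<in> borel_measurable (mixture p \<mu> \<nu>)"
    using M by (simp cong: measurable_cong_sets)
qed

section \<open>Uniform and point distributions of bids\<close>

lemma prob_space_uniform_dist: "l < u \<Longrightarrow> prob_space (uniform_dist l u)"
  by (rule prob_space_uniform_measure) auto

lemma measure_uniform_dist_le:
  assumes "l < u" shows "measure (uniform_dist l u) {..t} = max 0 (min 1 ((t - l) / (u - l)))"
proof -
  have "{l..u} \<inter> {..t} = {l..min u t}" by auto
  then show ?thesis using assms
    by (subst measure_uniform_measure) (auto simp: min_def max_def field_simps)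
qed

lemma measure_uniform_dist_ge:
  assumes "l < u" shows "measure (uniform_dist l u) {t..} = max 0 (min 1 ((u - t) / (u - l)))"
proof -
  have "{l..u} \<inter> {t..} = {max l t..u}" by auto
  then show ?thesis using assms
    by (subst measure_uniform_measure) (auto simp: min_def max_def field_simps)
qed

text \<open>Leaving out the left end matters: in \<open>lotto_equilibrium_neg\<close> a bid of B
  equal to \<open>- c\<close> ties with A's possible atom at 0, and the winning probability jumps
  there.\<close>

lemma AE_uniform_dist:
  assumes "l < u" shows "AE x in uniform_dist l u. x \<in> {l<..u}"
proof (rule AE_uniform_measureI)
  show "AE x in lborel. x \<in> {l..u} \<longrightarrow> x \<in> {l<..u}"
    using AE_lborel_singleton[of l] by eventually_elim auto
qed simp

lemma has_bochner_integral_uniform_dist: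
  assumes "0 \<le> l" "l < u"
  shows "has_bochner_integral (uniform_dist l u) (\<lambda>x. x) ((l + u) / 2)"
proof (rule has_bochner_integral_nn_integral)
  have nn: "(\<integral>\<^sup>+x. ennreal x * indicator {l..u} x \<partial>lborel) = ennreal (u\<^sup>2 / 2 - l\<^sup>2 / 2)"
    using assms by (intro nn_integral_FTC_Icc) (auto intro!: derivative_eq_intros)
  have "(u\<^sup>2 / 2 - l\<^sup>2 / 2) / (u - l) = (l + u) / 2"
    using assms by (simp add: field_simps power2_eq_square)
  then show "(\<integral>\<^sup>+x. ennreal x \<partial>uniform_dist l u) = ennreal ((l + u) / 2)"
    using assms by (subst nn_integral_uniform_measure) (simp_all add: nn divide_ennreal power_mono)
  show "AE x in uniform_dist l u. 0 \<le> x"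
    using AE_uniform_dist[OF assms(2)] by eventually_elim (use assms in auto)
qed (use assms in auto)

lemma has_bochner_integral_dirac:
  "0 \<le> z \<Longrightarrow> has_bochner_integral (dirac z) (\<lambda>x. x) z"
  by (rule has_bochner_integral_nn_integral) (simp_all add: AE_return nn_integral_return)

lemma nonneg_dist_mixture_uniform:
  assumes "0 \<le> l" "0 < d" "0 \<le> p" "p \<le> 1"
  shows "nonneg_dist_with_mean (p * (l + d)) (mixture p (uniform_dist l (l + 2 * d)) (dirac 0))"
proof -
  let ?U = "uniform_dist l (l + 2 * d)"
  have U: "prob_space ?U" "sets ?U = sets borel" using assms by (auto intro: prob_space_uniform_dist)
  have D: "prob_space (dirac 0)" "sets (dirac 0) = sets borel" by (auto intro: prob_space_return)
  have AU: "AE x in ?U. 0 \<le> x"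
    using AE_uniform_dist[of l "l + 2 * d"] assms by (auto elim!: eventually_mono)
  have "has_bochner_integral (mixture p ?U (dirac 0)) (\<lambda>x. x)
      (p * ((l + (l + 2 * d)) / 2) + (1 - p) * 0)"
  proof (rule has_bochner_integral_mixture[OF U D assms(3,4) _ AU])
    show "has_bochner_integral ?U (\<lambda>x. x) ((l + (l + 2 * d)) / 2)"
      by (rule has_bochner_integral_uniform_dist) (use assms in auto)
    show "AE x in dirac 0. 0 \<le> x" by (subst AE_return) auto
    show "has_bochner_integral (dirac 0) (\<lambda>x. x) 0" by (rule has_bochner_integral_dirac) simp
  qed simp
  moreover have "AE x in mixture p ?U (dirac 0). 0 \<le> x"
    by (rule AE_mixture[OF U D]) (use assms AU in \<open>auto simp: AE_return\<close>)
  moreover have "p * ((l + (l + 2 * d)) / 2) + (1 - p) * 0 = p * (l + d)" by (simp add: algebra_simps)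
  ultimately have "has_bochner_integral (mixture p ?U (dirac 0)) (\<lambda>x. x) (p * (l + d))"
    and "AE x in mixture p ?U (dirac 0). 0 \<le> x" by metis+
  then show ?thesis
    unfolding nonneg_dist_with_mean_def
    using prob_space_mixture[OF U D] sets_mixture[OF U D] by (auto simp: has_bochner_integral_iff)
qed

text \<open>Fubini in both orders. Each player's payoff becomes the mean of a function of that
  player's own bid, the form in which affine bounds apply.\<close>

lemma win_prob_integral:
  assumes "prob_space \<mu>" "sets \<mu> = sets borel" "prob_space \<nu>" "sets \<nu> = sets borel"
  shows "win_prob \<mu> \<nu> c = (\<integral>x. measure \<nu> {..x - c} \<partial>\<mu>)"
    and "win_prob \<mu> \<nu> c = (\<integral>y. measure \<mu> {y + c..} \<partial>\<nu>)"
    and "integrable \<mu> (\<lambda>x. measure \<nu> {..x - c})"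
    and "integrable \<nu> (\<lambda>y. measure \<mu> {y + c..})"
proof -
  interpret M: prob_space \<mu> by fact
  interpret N: prob_space \<nu> by fact
  interpret pair_prob_space \<mu> \<nu> ..
  have sp: "space \<mu> = UNIV" "space \<nu> = UNIV"
    using assms by (auto dest: sets_eq_imp_space_eq)
  let ?A = "{(x, y). x \<ge> y + c}"
  have "{p \<in> space (borel \<Otimes>\<^sub>M borel). snd p + c \<le> fst p} \<in> sets (borel \<Otimes>\<^sub>M (borel :: real measure))"
    by measurable
  moreover have "{p \<in> space (borel \<Otimes>\<^sub>M borel). snd p + c \<le> fst p} = ?A"
    by (auto simp: space_pair_measure)
  ultimately have A: "?A \<in> sets (\<mu> \<Otimes>\<^sub>M \<nu>)"
    unfolding sets_pair_measure_cong[OF assms(2,4)] by simp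
  have int: "integrable (\<mu> \<Otimes>\<^sub>M \<nu>) (indicator ?A :: _ \<Rightarrow> real)"
    using A by (intro integrable_real_indicator) (auto simp: P.emeasure_eq_measure)
  have w: "win_prob \<mu> \<nu> c = (\<integral>z. indicator ?A z \<partial>(\<mu> \<Otimes>\<^sub>M \<nu>))"
    using A by (simp add: win_prob_def sp space_pair_measure)
  have i1: "(\<integral>y. indicator ?A (x, y) \<partial>\<nu>) = measure \<nu> {..x - c}" for x
  proof -
    have "(\<lambda>y. indicator ?A (x, y) :: real) = indicator {..x - c}"
      by (auto simp: fun_eq_iff indicator_def)
    then show ?thesis using sp by simp
  qed
  have i2: "(\<integral>x. indicator ?A (x, y) \<partial>\<mu>) = measure \<mu> {y + c..}" for y
  proof -
    have "(\<lambda>x. indicator ?A (x, y) :: real) = indicator {y + c..}"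
      by (auto simp: fun_eq_iff indicator_def)
    then show ?thesis using sp by simp
  qed
  show "win_prob \<mu> \<nu> c = (\<integral>x. measure \<nu> {..x - c} \<partial>\<mu>)"
    using integral_fst'[OF int] by (simp add: w i1)
  show "win_prob \<mu> \<nu> c = (\<integral>y. measure \<mu> {y + c..} \<partial>\<nu>)"
    using integral_snd[of "\<lambda>x y. indicator ?A (x, y) :: real"] int by (simp add: w i2)
  show "integrable \<mu> (\<lambda>x. measure \<nu> {..x - c})"
    using integrable_fst'[OF int] by (simp add: i1)
  show "integrable \<nu> (\<lambda>y. measure \<mu> {y + c..})"
    using integrable_snd[of "\<lambda>x y. indicator ?A (x, y) :: real"] int by (simp add: i2)
qed

subsection \<open>Equilibria from affine bounds\<close>

lemma integral_affine_bounds: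
  assumes "nonneg_dist_with_mean e \<mu>" "integrable \<mu> g"
  shows "(\<And>x. 0 \<le> x \<Longrightarrow> g x \<le> \<alpha> + \<beta> * x) \<Longrightarrow> (\<integral>x. g x \<partial>\<mu>) \<le> \<alpha> + \<beta> * e"
    and "(\<And>x. 0 \<le> x \<Longrightarrow> \<alpha> + \<beta> * x \<le> g x) \<Longrightarrow> \<alpha> + \<beta> * e \<le> (\<integral>x. g x \<partial>\<mu>)"
    and "(AE x in \<mu>. g x = \<alpha> + \<beta> * x) \<Longrightarrow> (\<integral>x. g x \<partial>\<mu>) = \<alpha> + \<beta> * e"
proof -
  have p: "prob_space \<mu>" and ae: "AE x in \<mu>. 0 \<le> x" and i: "integrable \<mu> (\<lambda>x. x)" "(\<integral>x. x \<partial>\<mu>) = e"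
    using assms unfolding nonneg_dist_with_mean_def by auto
  interpret prob_space \<mu> by fact
  have I: "integrable \<mu> (\<lambda>x. \<alpha> + \<beta> * x)" using i by auto
  have E: "(\<integral>x. \<alpha> + \<beta> * x \<partial>\<mu>) = \<alpha> + \<beta> * e"
    using i by (subst Bochner_Integration.integral_add) (auto simp: prob_space)
  show "(\<integral>x. g x \<partial>\<mu>) \<le> \<alpha> + \<beta> * e" if "\<And>x. 0 \<le> x \<Longrightarrow> g x \<le> \<alpha> + \<beta> * x"
    unfolding E[symmetric] by (rule integral_mono_AE[OF assms(2) I]) (use ae that in \<open>auto elim!: eventually_mono\<close>)
  show "\<alpha> + \<beta> * e \<le> (\<integral>x. g x \<partial>\<mu>)" if "\<And>x. 0 \<le> x \<Longrightarrow> \<alpha> + \<beta> * x \<le> g x"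
    unfolding E[symmetric] by (rule integral_mono_AE[OF I assms(2)]) (use ae that in \<open>auto elim!: eventually_mono\<close>)
  show "(\<integral>x. g x \<partial>\<mu>) = \<alpha> + \<beta> * e" if "AE x in \<mu>. g x = \<alpha> + \<beta> * x"
    unfolding E[symmetric] by (rule integral_cong_AE) (use assms(2) I that in auto)
qed

text \<open>A pair of strategies is an equilibrium as soon as each player's winning probability against a
  fixed bid is dominated by an affine function of that bid which is attained on the support of that
  player's own strategy: only the mean of a bid matters for an affine function.\<close>

lemma lotto_equilibrium:
  assumes X: "nonneg_dist_with_mean a X" and Y: "nonneg_dist_with_mean b Y"
    and x: "\<And>x. 0 \<le> x \<Longrightarrow> measure Y {..x - c} \<le> \<alpha> + \<beta> * x" "AE x in X. measure Y {..x - c} = \<alpha> + \<beta> * x"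
    and y: "\<And>y. 0 \<le> y \<Longrightarrow> \<gamma> + \<delta> * y \<le> measure X {y + c..}" "AE y in Y. measure X {y + c..} = \<gamma> + \<delta> * y"
  shows "win_prob X Y c = \<alpha> + \<beta> * a"
    and "nonneg_dist_with_mean a X' \<Longrightarrow> win_prob X' Y c \<le> win_prob X Y c"
    and "nonneg_dist_with_mean b Y' \<Longrightarrow> win_prob X Y c \<le> win_prob X Y' c"
proof -
  have s: "prob_space \<mu> \<and> sets \<mu> = sets borel" if "nonneg_dist_with_mean e \<mu>" for e \<mu>
    using that unfolding nonneg_dist_with_mean_def by auto
  note sX = s[OF X] and sY = s[OF Y]
  show eqX: "win_prob X Y c = \<alpha> + \<beta> * a"
    using integral_affine_bounds(3)[OF X _ x(2)] win_prob_integral(1,3)[of X Y c] sX sY by auto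
  have eqY: "win_prob X Y c = \<gamma> + \<delta> * b"
    using integral_affine_bounds(3)[OF Y _ y(2)] win_prob_integral(2,4)[of X Y c] sX sY by auto
  show "win_prob X' Y c \<le> win_prob X Y c" if X': "nonneg_dist_with_mean a X'"
    unfolding eqX
    using integral_affine_bounds(1)[OF X' _ x(1)] win_prob_integral(1,3)[of X' Y c] s[OF X'] sY by auto
  show "win_prob X Y c \<le> win_prob X Y' c" if Y': "nonneg_dist_with_mean b Y'"
    unfolding eqY
    using integral_affine_bounds(2)[OF Y' _ y(1)] win_prob_integral(2,4)[of X Y' c] s[OF Y'] sX by auto
qed

section \<open>Distribution functions, tails and supports of the candidate strategies\<close>

lemma measure_mixture_uniform_le:
  assumes "0 < d" "0 \<le> p" "p \<le> 1"
  shows "measure (mixture p (uniform_dist l (l + 2 * d)) (dirac 0)) {..t} =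
    p * max 0 (min 1 ((t - l) / (2 * d))) + (if 0 \<le> t then 1 - p else 0)"
  using assms
  by (subst measure_mixture)
     (auto simp: prob_space_uniform_dist prob_space_return measure_return measure_uniform_dist_le simp del: measure_uniform_measure)

lemma measure_mixture_uniform_ge:
  assumes "0 < d" "0 \<le> p" "p \<le> 1"
  shows "measure (mixture p (uniform_dist l (l + 2 * d)) (dirac 0)) {t..} =
    p * max 0 (min 1 ((l + 2 * d - t) / (2 * d))) + (if t \<le> 0 then 1 - p else 0)"
  using assms
  by (subst measure_mixture)
     (auto simp: prob_space_uniform_dist prob_space_return measure_return measure_uniform_dist_ge simp del: measure_uniform_measure)

lemma AE_mixture_uniform:
  assumes "0 < d" "0 \<le> p" "p \<le> 1"
  shows "AE x in mixture p (uniform_dist l (l + 2 * d)) (dirac 0).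
    x \<in> {l<..l + 2 * d} \<or> p < 1 \<and> x = 0"
proof (rule AE_mixture)
  show "AE x in uniform_dist l (l + 2 * d). x \<in> {l<..l + 2 * d} \<or> p < 1 \<and> x = 0"
    by (rule eventually_mono[OF AE_uniform_dist]) (use assms in auto)
  show "AE x in dirac 0. x \<in> {l<..l + 2 * d} \<or> p < 1 \<and> x = 0" if "p < 1"
    using that by (subst AE_return) auto
qed (use assms in \<open>auto simp: prob_space_uniform_dist prob_space_return\<close>)

text \<open>For c >= 0 every bid of A below c loses. The line that carries A's winning probabilities
  on the bids between c and c + 2d has intercept (2d(d - b) - bc) / (2d^2) at bid 0. The hypotheses
  \<open>line\<close> say that this intercept is nonnegative, so that the line dominates the value 0
  of losing bids, and that it vanishes unless a = c + d, which means that A's strategy has no atom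
  at 0 (complementary slackness). The hypothesis \<open>c0\<close> excludes such an atom when c = 0,
  where it would tie with B's bid 0.\<close>

lemma lotto_equilibrium_nonneg:
  fixes a b c d :: real
  defines "X \<equiv> mixture (a / (c + d)) (uniform_dist c (c + 2 * d)) (dirac 0)"
    and "Y \<equiv> mixture (b / d) (uniform_dist 0 (2 * d)) (dirac 0)"
  assumes c: "0 \<le> c" and b: "0 < b" and d: "b \<le> d" and a: "0 \<le> a" "a \<le> c + d"
    and c0: "c = 0 \<Longrightarrow> a = d"
    and line: "b * c \<le> 2 * d * (d - b)" "b * c = 2 * d * (d - b) \<or> a = c + d"
  shows "nonneg_dist_with_mean a X" "nonneg_dist_with_mean b Y"
    and "win_prob X Y c = a / (c + d) * (1 - b / (2 * d))"
    and "nonneg_dist_with_mean a X' \<Longrightarrow> win_prob X' Y c \<le> win_prob X Y c"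
    and "nonneg_dist_with_mean b Y' \<Longrightarrow> win_prob X Y c \<le> win_prob X Y' c"
proof -
  define p q where "p = a / (c + d)" and "q = b / d"
  have d0: "0 < d" using b d by simp
  have p: "0 \<le> p" "p \<le> 1" and q: "0 \<le> q" "q \<le> 1"
    using a b c d d0 by (auto simp: p_def q_def)
  have ap: "p * (c + d) = a" and bq: "q * d = b" using c d0 by (auto simp: p_def q_def)
  have p1: "p = 1" if "c = 0" using c0[OF that] that d0 by (auto simp: p_def)
  \<comment> \<open>The slope is the density of the uniform part of Y; the line is then fixed by its
    value \<open>1 - q\<close> at x = c, where A beats exactly B's atom at 0.\<close>
  define \<beta> \<alpha> where "\<beta> = q / (2 * d)" and "\<alpha> = 1 - q - \<beta> * c"
  have \<beta>: "0 \<le> \<beta>" "q = \<beta> * (2 * d)" using q d0 by (auto simp: \<beta>_def)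
  have \<alpha>_eq: "\<alpha> = (2 * d * (d - b) - b * c) / (2 * d\<^sup>2)"
    using d0 by (simp add: \<alpha>_def \<beta>_def q_def field_simps power2_eq_square)
  have \<alpha>: "0 \<le> \<alpha>" unfolding \<alpha>_eq using line(1) d0 by simp
  have \<alpha>0: "\<alpha> = 0 \<or> p = 1" using line(2) c d0 unfolding \<alpha>_eq p_def by auto
  have Xd: "X = mixture p (uniform_dist c (c + 2 * d)) (dirac 0)" by (simp add: X_def p_def)
  have Yd: "Y = mixture q (uniform_dist 0 (0 + 2 * d)) (dirac 0)" by (simp add: Y_def q_def)
  have mY: "measure Y {..x - c} = q * max 0 (min 1 ((x - c) / (2 * d))) + (if c \<le> x then 1 - q else 0)" for x
    unfolding Yd using measure_mixture_uniform_le[OF d0 q, of 0 "x - c"] by simp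
  have mX: "measure X {y + c..} = p * max 0 (1 - y / (2 * d))" if "0 \<le> y" for y
  proof -
    have "(c + 2 * d - (y + c)) / (2 * d) = 1 - y / (2 * d)" "0 \<le> y / (2 * d)"
      using d0 that by (auto simp: field_simps)
    then show ?thesis
      unfolding Xd using measure_mixture_uniform_ge[OF d0 p, of c "y + c"] p1 c that by (auto simp: min_def)
  qed
  show X: "nonneg_dist_with_mean a X"
    unfolding Xd using nonneg_dist_mixture_uniform[OF c d0 p] by (simp add: ap)
  show Y: "nonneg_dist_with_mean b Y"
    unfolding Yd using nonneg_dist_mixture_uniform[OF _ d0 q, of 0] by (simp add: bq)
  have x1: "measure Y {..x - c} \<le> \<alpha> + \<beta> * x" if "0 \<le> x" for x
  proof (cases "c \<le> x")
    case True
    have "measure Y {..x - c} \<le> q * ((x - c) / (2 * d)) + (1 - q)"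
      unfolding mY using True d0 by (intro add_mono mult_left_mono[OF _ q(1)]) auto
    then show ?thesis by (simp add: \<alpha>_def \<beta>_def algebra_simps diff_divide_distrib)
  next
    case False
    then have "measure Y {..x - c} = 0"
      unfolding mY using d0 by (simp add: divide_nonpos_pos)
    then show ?thesis using \<alpha> \<beta> that by simp
  qed
  have x2: "AE x in X. measure Y {..x - c} = \<alpha> + \<beta> * x"
  proof -
    have "measure Y {..x - c} = \<alpha> + \<beta> * x" if "x \<in> {c<..c + 2 * d} \<or> p < 1 \<and> x = 0" for x
    proof (cases "x \<in> {c<..c + 2 * d}")
      case True
      then have "max 0 (min 1 ((x - c) / (2 * d))) = (x - c) / (2 * d)"
        using d0 by (auto simp: min_def max_def field_simps)
      then show ?thesis unfolding mY using True by (simp add: \<alpha>_def \<beta>_def algebra_simps diff_divide_distrib)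
    next
      case False
      then have x: "x = 0" "0 < c" "\<alpha> = 0" using that p1 \<alpha>0 c by force+
      then have "(x - c) / (2 * d) < 0" using d0 by (simp add: divide_neg_pos)
      then show ?thesis unfolding mY using x by simp
    qed
    with AE_mixture_uniform[OF d0 p, of c] show ?thesis
      unfolding Xd[symmetric] by (auto elim!: eventually_mono)
  qed
  have y1: "p + (- (p / (2 * d))) * y \<le> measure X {y + c..}" if "0 \<le> y" for y
  proof -
    have "p * (1 - y / (2 * d)) \<le> p * max 0 (1 - y / (2 * d))" using p by (intro mult_left_mono) auto
    then show ?thesis unfolding mX[OF that] by (simp add: algebra_simps)
  qed
  have y2: "AE y in Y. measure X {y + c..} = p + (- (p / (2 * d))) * y"
  proof -
    have *: "measure X {y + c..} = p + (- (p / (2 * d))) * y" if "0 \<le> y" "y \<le> 2 * d" for y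
    proof -
      have "max 0 (1 - y / (2 * d)) = 1 - y / (2 * d)" using d0 that by (auto simp: max_def field_simps)
      then show ?thesis unfolding mX[OF that(1)] by (simp add: algebra_simps)
    qed
    from AE_mixture_uniform[OF d0 q, of 0] show ?thesis
      unfolding Yd[symmetric] by (rule eventually_mono) (rule *; use d0 in auto)
  qed
  note eq = lotto_equilibrium[OF X Y x1 x2 y1 y2]
  have "\<alpha> + \<beta> * a = p * (1 - b / (2 * d))"
  proof -
    have "b / (2 * d) = q / 2" by (simp add: q_def)
    moreover have "\<beta> * d = q / 2" using \<beta>(2) by simp
    moreover have "\<beta> * a = p * (\<beta> * c + \<beta> * d)" by (simp add: ap[symmetric] algebra_simps)
    moreover have "\<beta> * c = 1 - q - \<alpha>" by (simp add: \<alpha>_def)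
    ultimately have "\<alpha> + \<beta> * a = \<alpha> + p * (1 - q / 2 - \<alpha>)" "b / (2 * d) = q / 2" by simp_all
    \<comment> \<open>Whether the intercept is 0 or p is 1, the value collapses to p (1 - q /
      2).\<close>
    then show ?thesis using \<alpha>0 by auto
  qed
  then show "win_prob X Y c = a / (c + d) * (1 - b / (2 * d))" using eq(1) by (simp add: p_def)
  show "nonneg_dist_with_mean a X' \<Longrightarrow> win_prob X' Y c \<le> win_prob X Y c"
    "nonneg_dist_with_mean b Y' \<Longrightarrow> win_prob X Y c \<le> win_prob X Y' c"
    using eq(2,3) by auto
qed

text \<open>Now A has a head start of -c, and B either bids 0 and loses or bids above -c. The
  equation \<open>line\<close> makes A's tail probabilities, extended linearly from the bids above
  -c down to the bid 0, reach exactly 1, which is A's chance against a zero bid. Thus a single line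
  is attained both on B's atom and on B's uniform part.\<close>

lemma lotto_equilibrium_neg:
  fixes a b c d :: real
  defines "X \<equiv> mixture (a / d) (uniform_dist 0 (2 * d)) (dirac 0)"
    and "Y \<equiv> mixture (b / (d - c)) (uniform_dist (- c) (- c + 2 * d)) (dirac 0)"
  assumes c: "c < 0" and a: "0 < a" "a \<le> d" and b: "0 \<le> b" "b \<le> d - c"
    and line: "a * (- c) = 2 * d * (d - a)"
  shows "nonneg_dist_with_mean a X" "nonneg_dist_with_mean b Y"
    and "win_prob X Y c = 1 - b / (d - c) * (1 - a / (2 * d))"
    and "nonneg_dist_with_mean a X' \<Longrightarrow> win_prob X' Y c \<le> win_prob X Y c"
    and "nonneg_dist_with_mean b Y' \<Longrightarrow> win_prob X Y c \<le> win_prob X Y' c"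
proof -
  define p q where "p = a / d" and "q = b / (d - c)"
  have d0: "0 < d" using a by simp
  have p: "0 \<le> p" "p \<le> 1" and q: "0 \<le> q" "q \<le> 1"
    using a b c d0 by (auto simp: p_def q_def)
  have ap: "p * d = a" and bq: "q * (d - c) = b" using c d0 by (auto simp: p_def q_def)
  define \<beta> where "\<beta> = p / (2 * d)"
  have \<beta>: "0 \<le> \<beta>" "p = \<beta> * (2 * d)" using p d0 by (auto simp: \<beta>_def)
  have p_eq: "1 - p = \<beta> * (- c)"
  proof -
    have "\<beta> * (- c) = (a * (- c)) / (2 * d * d)" using d0 by (simp add: \<beta>_def p_def)
    also have "\<dots> = 1 - p" unfolding line using d0 by (simp add: p_def field_simps)
    finally show ?thesis by simp
  qed
  have Xd: "X = mixture p (uniform_dist 0 (0 + 2 * d)) (dirac 0)" by (simp add: X_def p_def)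
  have Yd: "Y = mixture q (uniform_dist (- c) (- c + 2 * d)) (dirac 0)" by (simp add: Y_def q_def)
  have mY: "measure Y {..x - c} = q * min 1 (x / (2 * d)) + (1 - q)" if "0 \<le> x" for x
    unfolding Yd using measure_mixture_uniform_le[OF d0 q, of "- c" "x - c"] that c d0 by (simp add: max_def)
  have mX: "measure X {y + c..} = p * max 0 (min 1 (1 - (y + c) / (2 * d))) + (if y + c \<le> 0 then 1 - p else 0)" for y
    unfolding Xd using measure_mixture_uniform_ge[OF d0 p, of 0 "y + c"] d0 by (simp add: field_simps)
  show X: "nonneg_dist_with_mean a X"
    unfolding Xd using nonneg_dist_mixture_uniform[OF _ d0 p, of 0] by (simp add: ap)
  show Y: "nonneg_dist_with_mean b Y"
    unfolding Yd using nonneg_dist_mixture_uniform[OF _ d0 q, of "- c"] c bq by simp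
  have x1: "measure Y {..x - c} \<le> (1 - q) + (q / (2 * d)) * x" if "0 \<le> x" for x
  proof -
    have "q * min 1 (x / (2 * d)) \<le> q * (x / (2 * d))" using q by (intro mult_left_mono) auto
    then show ?thesis unfolding mY[OF that] by (simp add: algebra_simps)
  qed
  have x2: "AE x in X. measure Y {..x - c} = (1 - q) + (q / (2 * d)) * x"
  proof -
    have *: "measure Y {..x - c} = (1 - q) + (q / (2 * d)) * x" if "0 \<le> x" "x \<le> 2 * d" for x
      unfolding mY[OF that(1)] using that d0 by (simp add: min_def)
    from AE_mixture_uniform[OF d0 p, of 0] show ?thesis
      unfolding Xd[symmetric] by (rule eventually_mono) (rule *; use d0 in auto)
  qed
  have above: "measure X {y + c..} = p * max 0 (1 - (y + c) / (2 * d))" if "0 < y + c" for y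
    unfolding mX using that d0 by (simp add: min_def field_simps)
  have shift: "p * (1 - (y + c) / (2 * d)) = 1 - \<beta> * y" for y
    using p_eq by (simp add: \<beta>_def algebra_simps add_divide_distrib)
  have y1: "1 + (- \<beta>) * y \<le> measure X {y + c..}" if "0 \<le> y" for y
  proof (cases "0 < y + c")
    case True
    have "p * (1 - (y + c) / (2 * d)) \<le> measure X {y + c..}"
      unfolding above[OF True] using p by (intro mult_left_mono) auto
    then show ?thesis using shift[of y] by simp
  next
    case False
    then have "measure X {y + c..} = 1"
      unfolding mX using d0 by (simp add: divide_nonpos_pos min_def)
    then show ?thesis using \<beta> that by simp
  qed
  have y2: "AE y in Y. measure X {y + c..} = 1 + (- \<beta>) * y"
  proof -
    have "measure X {y + c..} = 1 + (- \<beta>) * y" if "y \<in> {- c<..- c + 2 * d} \<or> y = 0" for y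
    proof (cases "y = 0")
      case True
      then show ?thesis unfolding mX using d0 c by (simp add: divide_nonpos_pos min_def)
    next
      case False
      with that have y: "0 < y + c" "y + c \<le> 2 * d" by auto
      then have "max 0 (1 - (y + c) / (2 * d)) = 1 - (y + c) / (2 * d)"
        using d0 by (simp add: max_def)
      then show ?thesis unfolding above[OF y(1)] using shift[of y] by simp
    qed
    with AE_mixture_uniform[OF d0 q, of "- c"] show ?thesis
      unfolding Yd[symmetric] by (auto elim!: eventually_mono)
  qed
  note eq = lotto_equilibrium[OF X Y x1 x2 y1 y2]
  show "win_prob X Y c = 1 - b / (d - c) * (1 - a / (2 * d))"
    using eq(1) by (simp add: q_def algebra_simps)
  show "nonneg_dist_with_mean a X' \<Longrightarrow> win_prob X' Y c \<le> win_prob X Y c"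
    "nonneg_dist_with_mean b Y' \<Longrightarrow> win_prob X Y c \<le> win_prob X Y' c"
    using eq(2,3) by auto
qed

subsection \<open>The followers' equilibrium in closed form\<close>

text \<open>\<open>decay A B t\<close> is \<open>A / (B + t + sqrt (B\<^sup>2 + 2 * B * t))\<close> expressed through \<open>q = bid_ratio B t\<close>,
  and \<open>- decay_rate A B t\<close> is its derivative in \<open>t\<close>. The branches of \<open>P_m\<close> are \<open>decay a b c\<close>
  for \<open>c \<ge> r\<close> and \<open>1 - decay b a (- c)\<close> for \<open>c < 0\<close>.\<close>

definition bid_ratio :: "real \<Rightarrow> real \<Rightarrow> real" where
  "bid_ratio B t = sqrt (1 + 2 * t / B)"

definition decay :: "real \<Rightarrow> real \<Rightarrow> real \<Rightarrow> real" where
  "decay A B t = 2 * A / (B * (1 + bid_ratio B t)\<^sup>2)"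

definition decay_rate :: "real \<Rightarrow> real \<Rightarrow> real \<Rightarrow> real" where
  "decay_rate A B t = 4 * A / (B\<^sup>2 * (bid_ratio B t * (1 + bid_ratio B t) ^ 3))"

lemma bid_ratio_ge_1: "0 < B \<Longrightarrow> 0 \<le> t \<Longrightarrow> 1 \<le> bid_ratio B t"
  unfolding bid_ratio_def by (simp add: real_le_rsqrt)

lemma bid_ratio_0 [simp]: "bid_ratio B 0 = 1"
  by (simp add: bid_ratio_def)

lemma bid_ratio_sq: "0 < B \<Longrightarrow> 0 \<le> t \<Longrightarrow> t = B / 2 * ((bid_ratio B t)\<^sup>2 - 1)"
  unfolding bid_ratio_def by (simp add: field_simps)

lemma bid_ratio_less: "0 < B \<Longrightarrow> s < t \<Longrightarrow> bid_ratio B s < bid_ratio B t"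
  unfolding bid_ratio_def by (simp add: divide_strict_right_mono)

lemma bid_ratio_of_sq: "0 < B \<Longrightarrow> 0 \<le> q \<Longrightarrow> bid_ratio B (B / 2 * (q\<^sup>2 - 1)) = q"
  unfolding bid_ratio_def by (simp add: field_simps)

text \<open>The quadratic equation identifies \<open>r_thr\<close>: it is the c at which the middle
  branch d = a - c meets the relation bc = 2d(d - b) of the upper branch. The last equivalence
  isolates the degenerate case in which the middle branch is empty.\<close>

lemma r_thr_props:
  assumes "0 < b" "b \<le> a"
  shows "0 \<le> r_thr a b" "b \<le> a - r_thr a b" "r_thr a b < a"
    and "2 * (a - r_thr a b)\<^sup>2 - b * (a - r_thr a b) = a * b"
    and "r_thr a b = 0 \<longleftrightarrow> a = b"
proof -
  define s where "s = sqrt (b\<^sup>2 + 8 * a * b)"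
  have s2: "s\<^sup>2 = b\<^sup>2 + 8 * a * b" unfolding s_def using assms by simp
  have s0: "0 \<le> s" unfolding s_def using assms by simp
  have ar: "a - r_thr a b = (b + s) / 4" by (simp add: r_thr_def s_def)
  have "(3 * b)\<^sup>2 \<le> s\<^sup>2" unfolding s2 using assms by (simp add: power2_eq_square algebra_simps)
  then have 1: "3 * b \<le> s" using power2_le_imp_le s0 by blast
  then show "b \<le> a - r_thr a b" unfolding ar by simp
  then show "r_thr a b < a" using assms by simp
  have e: "(4 * a - b)\<^sup>2 - s\<^sup>2 = 16 * a * (a - b)"
    unfolding s2 by (simp add: power2_eq_square algebra_simps)
  moreover have "0 \<le> 16 * a * (a - b)" using assms by simp
  ultimately have "s\<^sup>2 \<le> (4 * a - b)\<^sup>2" by linarith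
  then have "s \<le> 4 * a - b" by (rule power2_le_imp_le) (use assms in auto)
  then show "0 \<le> r_thr a b" using ar by simp
  have "2 * ((b + s) / 4)\<^sup>2 - b * ((b + s) / 4) = (s\<^sup>2 - b\<^sup>2) / 8"
    by (simp add: power2_eq_square field_simps)
  then show "2 * (a - r_thr a b)\<^sup>2 - b * (a - r_thr a b) = a * b"
    unfolding ar s2 by simp
  have "r_thr a b = 0 \<longleftrightarrow> s = 4 * a - b" using ar by auto
  also have "\<dots> \<longleftrightarrow> s\<^sup>2 = (4 * a - b)\<^sup>2" using assms s0 by (auto intro: power2_eq_imp_eq)
  also have "\<dots> \<longleftrightarrow> 16 * a * (a - b) = 0" using e by linarith
  also have "\<dots> \<longleftrightarrow> a = b" using assms by simp
  finally show "r_thr a b = 0 \<longleftrightarrow> a = b" .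
qed

lemma sqrt_eq_bid_ratio:
  assumes "0 < B" "0 \<le> t"
  shows "sqrt (B\<^sup>2 + 2 * t * B) = B * bid_ratio B t"
proof -
  have "B\<^sup>2 + 2 * t * B = B\<^sup>2 * (1 + 2 * t / B)" using assms by (simp add: field_simps power2_eq_square)
  then show ?thesis unfolding bid_ratio_def using assms by (simp only: real_sqrt_mult) simp
qed

text \<open>Serves both outer branches: A = a, B = b, t = c for c >= r, and A = b, B = a, t = -c for
  c < 0, where it gives the complementary probability. In the variable q all quantities are
  rational: d = B(1 + q)/2 and t + d = Bq(1 + q)/2.\<close>

lemma decay_win_prob:
  assumes "0 < B" "0 \<le> t"
  defines "d \<equiv> (B + sqrt (B\<^sup>2 + 2 * t * B)) / 2"
  shows "A / (t + d) * (1 - B / (2 * d)) = decay A B t" "B * t = 2 * d * (d - B)" "B \<le> d"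
proof -
  define q where "q = bid_ratio B t"
  have q: "1 \<le> q" and t: "t = B / 2 * (q\<^sup>2 - 1)"
    unfolding q_def by (rule bid_ratio_ge_1[OF assms(1,2)], rule bid_ratio_sq[OF assms(1,2)])
  have d: "d = B * (1 + q) / 2"
    unfolding d_def sqrt_eq_bid_ratio[OF assms(1,2)] q_def by (simp add: algebra_simps)
  have "t + d = B * q * (1 + q) / 2" unfolding d t by (simp add: field_simps power2_eq_square)
  moreover have "1 - B / (2 * d) = q / (1 + q)" unfolding d using q assms(1) by (simp add: divide_simps)
  ultimately have "A / (t + d) * (1 - B / (2 * d)) = A / (B * q * (1 + q) / 2) * (q / (1 + q))"
    by (simp only:)
  also have "\<dots> = decay A B t"
    unfolding decay_def q_def[symmetric] using q assms(1) by (simp add: power2_eq_square mult_ac)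
  finally show "A / (t + d) * (1 - B / (2 * d)) = decay A B t" .
  show "B * t = 2 * d * (d - B)" unfolding d t by (simp add: field_simps power2_eq_square)
  show "B \<le> d" unfolding d using q assms(1) by (simp add: divide_simps)
qed

lemma eq_strategies:
  assumes b: "0 < b" and a: "b \<le> a"
  shows X_eq_dist: "nonneg_dist_with_mean a (X_eq a b c)"
    and Y_eq_dist: "nonneg_dist_with_mean b (Y_eq a b c)"
    and P_eq_formula: "P_eq a b c =
      (if r_thr a b \<le> c then decay a b c
       else if 0 \<le> c then 1 - b / (2 * (a - c)) else 1 - decay b a (- c))"
    and X_eq_best: "nonneg_dist_with_mean a X' \<Longrightarrow> win_prob X' (Y_eq a b c) c \<le> win_prob (X_eq a b c) (Y_eq a b c) c"
    and Y_eq_best: "nonneg_dist_with_mean b Y' \<Longrightarrow> win_prob (X_eq a b c) (Y_eq a b c) c \<le> win_prob (X_eq a b c) Y' c"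
proof -
  note r = r_thr_props[OF b a]
  have "nonneg_dist_with_mean a (X_eq a b c) \<and> nonneg_dist_with_mean b (Y_eq a b c) \<and>
    P_eq a b c = (if r_thr a b \<le> c then decay a b c
       else if 0 \<le> c then 1 - b / (2 * (a - c)) else 1 - decay b a (- c)) \<and>
    (\<forall>X'. nonneg_dist_with_mean a X' \<longrightarrow> win_prob X' (Y_eq a b c) c \<le> win_prob (X_eq a b c) (Y_eq a b c) c) \<and>
    (\<forall>Y'. nonneg_dist_with_mean b Y' \<longrightarrow> win_prob (X_eq a b c) (Y_eq a b c) c \<le> win_prob (X_eq a b c) Y' c)"
  proof (cases "0 \<le> c")
    case c: True
    define d where "d = d_eq a b c"
    have XY: "X_eq a b c = mixture (a / (c + d)) (uniform_dist c (c + 2 * d)) (dirac 0)"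
      "Y_eq a b c = mixture (b / d) (uniform_dist 0 (2 * d)) (dirac 0)"
      using c by (simp_all add: X_eq_def Y_eq_def d_def Let_def)
    have *: "b \<le> d \<and> a \<le> c + d \<and> (c = 0 \<longrightarrow> a = d) \<and> b * c \<le> 2 * d * (d - b) \<and>
        (b * c = 2 * d * (d - b) \<or> a = c + d) \<and>
        a / (c + d) * (1 - b / (2 * d)) = (if r_thr a b \<le> c then decay a b c else 1 - b / (2 * (a - c)))"
    proof (cases "r_thr a b \<le> c")
      case True
      then have d: "d = (b + sqrt (b\<^sup>2 + 2 * c * b)) / 2" by (simp add: d_def d_eq_def)
      note w = decay_win_prob[OF b c, folded d]
      \<comment> \<open>This makes the weight a / (c + d) a probability. If d < y = a - c, then 2d(d
        - b) < 2y(y - b); but y is at most a - r, so y(2y - b) is at most ab, that is, 2y(y - b) is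
        at most bc, contradicting bc = 2d(d - b).\<close>
      have "a \<le> c + d"
      proof (rule ccontr)
        define y where "y = a - c"
        assume "\<not> a \<le> c + d"
        then have y: "d < y" "y \<le> a - r_thr a b" using True by (auto simp: y_def)
        have "d * (d - b) < y * (y - b)" using y w(3) b by (intro mult_strict_mono') auto
        moreover have "y * (2 * y - b) \<le> (a - r_thr a b) * (2 * (a - r_thr a b) - b)"
          using y w(3) b by (intro mult_mono) auto
        moreover have "\<dots> = a * b" using r(4) by (simp add: power2_eq_square algebra_simps)
        moreover have "b * c = a * b - b * y" by (simp add: y_def algebra_simps)
        ultimately show False using w(2) by (simp add: algebra_simps)
      qed
      \<comment> \<open>The upper branch contains c = 0 only if r = 0, hence a = b; and at c = 0 its
        d equals b.\<close>
      moreover have "a = d" if "c = 0"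
        using True that r(1,5) b by (simp add: d)
      ultimately show ?thesis using w True by auto
    next
      case False
      then have d: "d = a - c" using c by (simp add: d_def d_eq_def)
      \<comment> \<open>The function y(2y - b) equals ab at y = a - r and increases from there; on
        this branch d = a - c lies to the right of a - r.\<close>
      have "(a - r_thr a b) * (2 * (a - r_thr a b) - b) \<le> d * (2 * d - b)"
        using False r(2) b unfolding d by (intro mult_mono) auto
      then have "a * b \<le> d * (2 * d - b)" using r(4) by (simp add: power2_eq_square algebra_simps)
      moreover have "a * b = b * c + b * d" by (simp add: d algebra_simps)
      ultimately have "b * c \<le> 2 * d * (d - b)" by (simp add: algebra_simps)
      moreover have "b \<le> d" using False r(2) by (simp add: d)
      ultimately show ?thesis using False b a by (auto simp: d)
    qed
    have a0: "0 \<le> a" using a b by simp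
    have P: "P_eq a b c = (if r_thr a b \<le> c then decay a b c
       else if 0 \<le> c then 1 - b / (2 * (a - c)) else 1 - decay b a (- c))"
      using lotto_equilibrium_nonneg(3)[OF c b _ a0, of d] * c unfolding P_eq_def XY by auto
    show ?thesis
      unfolding P XY
      using lotto_equilibrium_nonneg(1,2,4,5)[OF c b _ a0, of d] * by auto
  next
    case c: False
    define d where "d = d_eq a b c"
    have a0: "0 < a" using a b by simp
    have d: "d = (a + sqrt (a\<^sup>2 + 2 * (- c) * a)) / 2" using c r(1) by (simp add: d_def d_eq_def)
    have XY: "X_eq a b c = mixture (a / d) (uniform_dist 0 (2 * d)) (dirac 0)"
      "Y_eq a b c = mixture (b / (d - c)) (uniform_dist (- c) (- c + 2 * d)) (dirac 0)"
      using c by (simp_all add: X_eq_def Y_eq_def d_def Let_def)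
    have c': "c < 0" "0 \<le> - c" using c by auto
    note w = decay_win_prob[OF a0 c'(2), folded d]
    have *: "b \<le> d - c" "0 \<le> b" using w(3) a b c by auto
    note E = lotto_equilibrium_neg[OF c'(1) a0 w(3) *(2,1) w(2)]
    have P: "P_eq a b c = (if r_thr a b \<le> c then decay a b c
       else if 0 \<le> c then 1 - b / (2 * (a - c)) else 1 - decay b a (- c))"
      using E(3) w(1)[of b] c r(1) unfolding P_eq_def XY by (simp add: minus_add)
    show ?thesis unfolding P XY using E(1,2,4,5) by auto
  qed
  then show "nonneg_dist_with_mean a (X_eq a b c)" "nonneg_dist_with_mean b (Y_eq a b c)"
    "P_eq a b c = (if r_thr a b \<le> c then decay a b c
       else if 0 \<le> c then 1 - b / (2 * (a - c)) else 1 - decay b a (- c))"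
    "nonneg_dist_with_mean a X' \<Longrightarrow> win_prob X' (Y_eq a b c) c \<le> win_prob (X_eq a b c) (Y_eq a b c) c"
    "nonneg_dist_with_mean b Y' \<Longrightarrow> win_prob (X_eq a b c) (Y_eq a b c) c \<le> win_prob (X_eq a b c) Y' c"
    by blast+
qed

lemma followers_NE_eq:
  fixes v a b :: "'m::finite \<Rightarrow> real"
  assumes "\<And>m. 0 < v m" "\<And>m. 0 < b m" "\<And>m. b m \<le> a m"
  shows "followers_NE v a b c (SX_eq a b c) (SY_eq a b c)"
  unfolding followers_NE_def payoff_B_def payoff_A_def SX_eq_def SY_eq_def
  using assms
  by (auto intro!: sum_mono mult_left_mono X_eq_dist Y_eq_dist X_eq_best Y_eq_best simp: less_imp_le)

subsection \<open>Marginal effect of an intervention\<close>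

lemma decay_rate_pos: "0 < A \<Longrightarrow> 0 < B \<Longrightarrow> 0 \<le> t \<Longrightarrow> 0 < decay_rate A B t"
  unfolding decay_rate_def using bid_ratio_ge_1[of B t]
  by (intro divide_pos_pos mult_pos_pos zero_less_power) auto

text \<open>The quartic expands distances because q((1 + q)^3 - 1) is itself increasing. Besides
  strict monotonicity this gives a 1-Lipschitz inverse, hence the continuity of the demand
  functions.\<close>

lemma quartic_diff_ge:
  fixes p q :: real
  assumes "0 \<le> p" "p \<le> q"
  shows "q - p \<le> q * (1 + q) ^ 3 - p * (1 + p) ^ 3"
proof -
  have "p * ((1 + p) ^ 3 - 1) \<le> q * ((1 + q) ^ 3 - 1)"
    using assms by (intro mult_mono diff_right_mono power_mono) auto
  then show ?thesis by (simp add: algebra_simps)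
qed

lemma decay_rate_less:
  assumes "0 < A" "0 < B" "0 \<le> s" "s < t"
  shows "decay_rate A B t < decay_rate A B s"
proof -
  define p q where "p = bid_ratio B s" and "q = bid_ratio B t"
  have p: "1 \<le> p" and q: "p < q"
    unfolding p_def q_def using assms bid_ratio_ge_1 bid_ratio_less by auto
  then have "p * (1 + p) ^ 3 < q * (1 + q) ^ 3"
    using quartic_diff_ge[of p q] by simp
  moreover have "0 < p * (1 + p) ^ 3" using p by simp
  ultimately show ?thesis
    unfolding decay_rate_def p_def[symmetric] q_def[symmetric] using assms p q
    by (intro divide_strict_left_mono mult_strict_left_mono mult_pos_pos) auto
qed

text \<open>Strict convexity as a tangent inequality, without second derivatives: over a common
  denominator, the gap in the variables q and y is (q - y)^2 times a polynomial with positive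
  coefficients.\<close>

lemma decay_tangent:
  assumes A: "0 < A" and B: "0 < B" and x: "0 \<le> x" and t: "0 \<le> t" and ne: "t \<noteq> x"
  shows "decay A B x - decay_rate A B x * (t - x) < decay A B t"
proof -
  define q y where "q = bid_ratio B t" and "y = bid_ratio B x"
  have q: "1 \<le> q" and y: "1 \<le> y" unfolding q_def y_def using bid_ratio_ge_1 B x t by auto
  have qy: "q \<noteq> y"
    using bid_ratio_less[OF B, of t x] bid_ratio_less[OF B, of x t] ne unfolding q_def y_def by (metis less_irrefl neq_iff)
  have tx: "t - x = B / 2 * (q\<^sup>2 - y\<^sup>2)"
    using bid_ratio_sq[OF B t] bid_ratio_sq[OF B x] unfolding q_def y_def by (simp add: right_diff_distrib)
  define D where "D = (1 + q)\<^sup>2 * (y * (1 + y) ^ 3)"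
  have D: "0 < D" unfolding D_def using q y by simp
  have 1: "1 / (1 + q)\<^sup>2 = y * (1 + y) ^ 3 / D"
    unfolding D_def using q y by simp
  have 2: "1 / (1 + y)\<^sup>2 = y * (1 + y) * (1 + q)\<^sup>2 / D"
    unfolding D_def using q y by (simp add: power3_eq_cube power2_eq_square)
  have 3: "(q\<^sup>2 - y\<^sup>2) / (y * (1 + y) ^ 3) = (q\<^sup>2 - y\<^sup>2) * (1 + q)\<^sup>2 / D"
    unfolding D_def using q y by simp
  have N: "y * (1 + y) ^ 3 - y * (1 + y) * (1 + q)\<^sup>2 + (q\<^sup>2 - y\<^sup>2) * (1 + q)\<^sup>2
      = (q - y)\<^sup>2 * (q\<^sup>2 + 2 * q * y + y\<^sup>2 + 2 * q + 3 * y + 1)"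
    by algebra
  have "0 < (q - y)\<^sup>2 * (q\<^sup>2 + 2 * q * y + y\<^sup>2 + 2 * q + 3 * y + 1)"
    using q y qy by (intro mult_pos_pos add_nonneg_pos) auto
  then have pos: "0 < 1 / (1 + q)\<^sup>2 - 1 / (1 + y)\<^sup>2 + (q\<^sup>2 - y\<^sup>2) / (y * (1 + y) ^ 3)"
    unfolding 1 2 3 N[symmetric] using D by (simp add: add_divide_distrib[symmetric] diff_divide_distrib[symmetric])
  have dq: "decay A B t = 2 * A / B * (1 / (1 + q)\<^sup>2)" "decay A B x = 2 * A / B * (1 / (1 + y)\<^sup>2)"
    by (simp_all add: decay_def q_def y_def)
  have "decay_rate A B x * (t - x) = 2 * A / B * ((q\<^sup>2 - y\<^sup>2) / (y * (1 + y) ^ 3))"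
    unfolding tx decay_rate_def y_def[symmetric] using B by (simp add: power2_eq_square)
  then have "decay A B t - (decay A B x - decay_rate A B x * (t - x)) =
      2 * A / B * (1 / (1 + q)\<^sup>2 - 1 / (1 + y)\<^sup>2 + (q\<^sup>2 - y\<^sup>2) / (y * (1 + y) ^ 3))"
    unfolding dq by (simp only: distrib_left right_diff_distrib)
  moreover have "0 < \<dots>" using pos A B by (intro mult_pos_pos) auto
  ultimately show ?thesis by linarith
qed

lemma DERIV_decay:
  assumes B: "0 < B" and t: "0 \<le> t"
  shows "(decay A B has_real_derivative - decay_rate A B t) (at t within S)"
proof -
  define q where "q = bid_ratio B t"
  have q: "1 \<le> q" unfolding q_def using bid_ratio_ge_1 B t by auto
  have pos: "0 < 1 + 2 * t / B" using B t by (simp add: add_pos_nonneg)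
  have "(bid_ratio B has_real_derivative 1 / (B * q)) (at t)"
    unfolding bid_ratio_def[abs_def] q_def using pos B
    by (auto intro!: derivative_eq_intros simp: field_simps)
  then have "((\<lambda>t. 2 * A / (B * (1 + bid_ratio B t)\<^sup>2)) has_real_derivative
      - (2 * A * (B * (2 * (1 + q) * (1 / (B * q))))) / (B * (1 + q)\<^sup>2)\<^sup>2) (at t)"
    using q B unfolding q_def
    by (auto intro!: derivative_eq_intros simp: power2_eq_square)
  moreover have "- (2 * A * (B * (2 * (1 + q) * (1 / (B * q))))) / (B * (1 + q)\<^sup>2)\<^sup>2 = - decay_rate A B t"
    unfolding decay_rate_def q_def[symmetric] using q B
    by (simp add: divide_simps) algebra
  ultimately show ?thesis unfolding decay_def[abs_def]
    using has_field_derivative_at_within by metis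
qed

text \<open>The tangent at t lies below the graph and has nonpositive slope, so it already forces a
  larger value at s.\<close>

lemma decay_mono:
  assumes "0 < A" "0 < B" "0 \<le> s" "s \<le> t"
  shows "decay A B t \<le> decay A B s"
proof (cases "s = t")
  case False
  have "0 \<le> decay_rate A B t * (t - s)" using assms decay_rate_pos[of A B t] by simp
  moreover have "decay A B t - decay_rate A B t * (s - t) < decay A B s"
    by (rule decay_tangent) (use assms False in auto)
  ultimately show ?thesis by (simp add: right_diff_distrib)
qed simp

text \<open>The middle and the upper branch of \<open>P_eq\<close> meet at \<open>r_thr\<close> with
  equal values and equal slopes, so \<open>P_plus\<close> is differentiable across the change of
  formula.\<close>

lemma decay_r_thr:
  assumes b: "0 < b" and a: "b \<le> a"
  shows "decay a b (r_thr a b) = 1 - b / (2 * (a - r_thr a b))"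
    and "decay_rate a b (r_thr a b) = b / (2 * (a - r_thr a b)\<^sup>2)"
proof -
  \<comment> \<open>On the upper branch d = b(1 + q)/2, and at c = r this d equals a - r; solving
    for q gives the definition.\<close>
  define y q where "y = a - r_thr a b" and "q = 2 * y / b - 1"
  have y: "b \<le> y" "2 * y\<^sup>2 - b * y = a * b" using r_thr_props[OF b a] by (auto simp: y_def)
  have yq: "y = b * (1 + q) / 2" using b by (simp add: q_def)
  have q: "1 \<le> q" using y(1) b by (simp add: q_def field_simps)
  have ab: "a = b * q * (1 + q) / 2"
  proof -
    have "b * a = b * (b * q * (1 + q) / 2)" using y(2) unfolding yq by (simp add: power2_eq_square field_simps)
    then show ?thesis using b by simp
  qed
  have r: "r_thr a b = b / 2 * (q\<^sup>2 - 1)"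
  proof -
    have "r_thr a b = a - y" by (simp add: y_def)
    also have "\<dots> = b * q * (1 + q) / 2 - b * (1 + q) / 2" by (simp only: ab yq)
    also have "\<dots> = b / 2 * (q\<^sup>2 - 1)" by (simp add: power2_eq_square field_simps)
    finally show ?thesis .
  qed
  have br: "bid_ratio b (r_thr a b) = q" unfolding r by (rule bid_ratio_of_sq) (use b q in auto)
  have "decay a b (r_thr a b) = 2 * (b * q * (1 + q) / 2) / (b * (1 + q)\<^sup>2)"
    unfolding decay_def br by (simp only: ab[symmetric])
  also have "\<dots> = 1 - b / (2 * y)" unfolding yq using b q by (simp add: divide_simps power2_eq_square)
  finally show "decay a b (r_thr a b) = 1 - b / (2 * (a - r_thr a b))" by (simp add: y_def)
  have "decay_rate a b (r_thr a b) = 4 * (b * q * (1 + q) / 2) / (b\<^sup>2 * (q * (1 + q) ^ 3))"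
    unfolding decay_rate_def br by (simp only: ab[symmetric])
  also have "\<dots> = b / (2 * y\<^sup>2)"
    unfolding yq using b q by (simp add: divide_simps power2_eq_square power3_eq_cube)
  finally show "decay_rate a b (r_thr a b) = b / (2 * (a - r_thr a b)\<^sup>2)" by (simp add: y_def)
qed

section \<open>Shape of \<open>P_plus\<close>: convex piece, concave piece, and the chord to
  \<open>tau\<close>\<close>

context
  fixes a b :: real
  assumes b: "0 < b" and ab: "b \<le> a"
begin

lemma P_eq_0: "P_eq a b 0 = 1 - b / (2 * a)"
proof (cases "r_thr a b = 0")
  case True
  then have "P_eq a b 0 = decay a b 0" using P_eq_formula[OF b ab, of 0] by simp
  moreover have "a = b" using True r_thr_props(5)[OF b ab] by simp
  ultimately show ?thesis using b by (simp add: decay_def)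
next
  case False
  then show ?thesis using r_thr_props(1)[OF b ab] by (simp add: P_eq_formula[OF b ab])
qed

lemma P_plus_high: "r_thr a b \<le> c \<Longrightarrow> P_plus a b c = 1 - b / (2 * a) - decay a b c"
  by (simp add: P_plus_def P_eq_0 P_eq_formula[OF b ab, of c])

lemma P_plus_low:
  assumes "0 \<le> c" "c \<le> r_thr a b"
  shows "P_plus a b c = b * c / (2 * a * (a - c))"
proof -
  have "P_eq a b c = 1 - b / (2 * (a - c))"
    using assms by (cases "c = r_thr a b") (auto simp: P_eq_formula[OF b ab] decay_r_thr(1)[OF b ab])
  moreover have "0 < a - c" "0 < a" using assms r_thr_props(3)[OF b ab] b ab by auto
  then have "(1 - b / (2 * a)) - (1 - b / (2 * (a - c))) = b * c / (2 * a * (a - c))"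
    by (simp add: field_simps)
  ultimately show ?thesis by (simp add: P_plus_def P_eq_0)
qed

text \<open>A negative intervention cannot hurt A, so for a regulator favouring B it only spends
  budget.\<close>

lemma P_plus_neg:
  assumes "c < 0" shows "P_plus a b c \<le> 0"
proof -
  have "decay b a (- c) \<le> decay b a 0" by (rule decay_mono) (use assms b ab in auto)
  also have "\<dots> = b / (2 * a)" by (simp add: decay_def)
  finally show ?thesis
    using assms r_thr_props(1)[OF b ab] by (simp add: P_plus_def P_eq_0 P_eq_formula[OF b ab, of c])
qed

text \<open>The two closed formulas are glued along \<open>{0..r_thr a b}\<close> and
  \<open>{r_thr a b..}\<close>. The point c = \<open>r_thr a b\<close> has to be included: it is
  where \<open>tau\<close> lies when a = b, and then it is the left end of the domain.\<close>

lemma has_vector_derivative_P_plus: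
  assumes c: "r_thr a b \<le> c"
  shows "(P_plus a b has_vector_derivative decay_rate a b c) (at c within {0..})"
proof -
  note r = r_thr_props[OF b ab]
  let ?S = "{0..r_thr a b}" and ?T = "{r_thr a b..}"
  let ?L = "\<lambda>c. b * c / (2 * a * (a - c))" and ?H = "\<lambda>c. 1 - b / (2 * a) - decay a b c"
  have cl: "closure ?S \<inter> closure ?T = {r_thr a b}" using r(1) by auto
  have "((\<lambda>x. if x \<in> ?S then ?L x else ?H x) has_vector_derivative
      (if c \<in> ?S then b / (2 * (a - c)\<^sup>2) else decay_rate a b c)) (at c within {0..})"
  proof (rule has_vector_derivative_If_within_closures)
    show "c \<in> ?S \<union> ?T" "{0..} = ?S \<union> ?T" using c r(1) by auto
    show "(?L has_vector_derivative b / (2 * (a - c)\<^sup>2)) (at c within ?S \<union> (closure ?S \<inter> closure ?T))"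
      if "c \<in> ?S \<union> (closure ?S \<inter> closure ?T)"
    proof -
      define y where "y = a - c"
      have c: "c = a - y" and "0 < y" "0 < a" using that r(1,3) cl by (auto simp: y_def)
      then have "(?L has_real_derivative b / (2 * (a - c)\<^sup>2)) (at c)"
        unfolding c by (auto intro!: derivative_eq_intros simp: field_simps power2_eq_square)
      then show ?thesis
        by (simp add: has_field_derivative_at_within has_real_derivative_iff_has_vector_derivative[symmetric])
    qed
    show "(?H has_vector_derivative decay_rate a b c) (at c within ?T \<union> (closure ?S \<inter> closure ?T))"
    proof -
      have "0 \<le> c" using c r(1) by simp
      from DERIV_diff[OF DERIV_const DERIV_decay[OF b this]]
      show ?thesis by (simp add: has_real_derivative_iff_has_vector_derivative[symmetric])
    qed
    assume "c \<in> closure ?S" "c \<in> closure ?T"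
    then have [simp]: "c = r_thr a b" using cl by blast
    show "?L c = ?H c" using P_plus_low[of c] P_plus_high[of c] r(1) by simp
    show "b / (2 * (a - c)\<^sup>2) = decay_rate a b c" using decay_r_thr(2)[OF b ab] by simp
  qed
  moreover have "(if c \<in> ?S then b / (2 * (a - c)\<^sup>2) else decay_rate a b c) = decay_rate a b c"
    using c decay_r_thr(2)[OF b ab] by (auto simp: order_antisym_conv)
  ultimately have "((\<lambda>x. if x \<in> ?S then ?L x else ?H x) has_vector_derivative decay_rate a b c) (at c within {0..})"
    by (simp only:)
  then show ?thesis
    by (rule has_vector_derivative_transform[rotated 2])
       (use c r(1) in \<open>auto simp: P_plus_low P_plus_high\<close>)
qed

lemma P_plus'_eq:
  assumes "r_thr a b \<le> c" shows "P_plus' a b c = decay_rate a b c"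
  unfolding P_plus'_def
proof (rule vector_derivative_within[OF _ has_vector_derivative_P_plus[OF assms]])
  have "0 \<le> c" using assms r_thr_props(1)[OF b ab] by simp
  then have "at c within {c..} \<le> at c within {0..}" by (intro at_le) auto
  moreover have "at c within {c..} \<noteq> bot" by (simp add: at_within_Ici_at_right)
  ultimately show "at c within {0..} \<noteq> bot" by (auto simp: bot_unique)
qed

lemma is_tau_iff:
  "is_tau a b t \<longleftrightarrow> r_thr a b \<le> t \<and> P_plus a b t = t * decay_rate a b t"
  unfolding is_tau_def using P_plus'_eq by auto

lemma P_plus_tangent:
  assumes "r_thr a b \<le> x" "r_thr a b \<le> c" "c \<noteq> x"
  shows "P_plus a b c < P_plus a b x + decay_rate a b x * (c - x)"
  using decay_tangent[of a b x c] assms P_plus_high r_thr_props(1)[OF b ab] b ab by simp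

lemma ex1_tau: "\<exists>!t. is_tau a b t"
proof -
  note r = r_thr_props[OF b ab]
  \<comment> \<open>D t is the intercept at 0 of the tangent to \<open>P_plus\<close> at t, so its
    zeros are the tangency points.\<close>
  define D where "D = (\<lambda>t. 1 - b / (2 * a) - decay a b t - t * decay_rate a b t)"
  have a: "0 < a" using b ab by simp
  have "continuous_on {r_thr a b..4 * a} D"
  proof -
    have "1 + bid_ratio b t \<noteq> 0" "bid_ratio b t \<noteq> 0" if "r_thr a b \<le> t" for t
      using bid_ratio_ge_1[OF b, of t] that r(1) by auto
    moreover have "continuous_on {r_thr a b..4 * a} (bid_ratio b)"
      unfolding bid_ratio_def[abs_def] by (intro continuous_intros) (use b in auto)
    ultimately show ?thesis unfolding D_def decay_def decay_rate_def
      by (intro continuous_intros) (use b in auto)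
  qed
  \<comment> \<open>On the convex piece \<open>P_plus\<close> starts from 0, so the chord from the
    origin to r is at most as steep as the graph at r.\<close>
  moreover have "D (r_thr a b) \<le> 0"
  proof -
    define y where "y = a - r_thr a b"
    have y: "0 < y" "y \<le> a" using r b by (auto simp: y_def)
    have "D (r_thr a b) = b * r_thr a b / (2 * a * y) - r_thr a b * (b / (2 * y\<^sup>2))"
      unfolding D_def using P_plus_high[of "r_thr a b"] P_plus_low[of "r_thr a b"] r(1)
        decay_r_thr(2)[OF b ab] by (simp add: y_def)
    also have "\<dots> = b * r_thr a b / (2 * y) * (1 / a - 1 / y)"
      using y a by (simp add: field_simps power2_eq_square)
    also have "\<dots> \<le> 0"
      using y a b r(1) by (intro mult_nonneg_nonpos) (auto simp: frac_le)
    finally show ?thesis .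
  qed
  \<comment> \<open>The point 4a is far enough right: there 8a = b(q^2 - 1) is at most b(1 + q)^2,
    which bounds \<open>decay\<close> plus t times \<open>decay_rate\<close> by 1/2, while 1 - b /
    (2a) is at least 1/2.\<close>
  moreover have "0 \<le> D (4 * a)"
  proof -
    define q where "q = bid_ratio b (4 * a)"
    have q: "1 \<le> q" unfolding q_def using bid_ratio_ge_1[OF b] a by simp
    have t: "4 * a = b / 2 * (q\<^sup>2 - 1)" unfolding q_def using bid_ratio_sq[OF b] a by simp
    have "8 * a \<le> b * (1 + q)\<^sup>2"
    proof -
      have "8 * a = b * (q\<^sup>2 - 1)" using t by simp
      also have "\<dots> \<le> b * (1 + q)\<^sup>2" using b q by (intro mult_left_mono) (auto simp: power2_eq_square algebra_simps)
      finally show ?thesis .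
    qed
    then have e: "4 * a / (b * (1 + q)\<^sup>2) \<le> 1 / 2" using b q by (simp add: divide_simps)
    have "decay_rate a b (4 * a) * (4 * a) = 2 * a / (b * (1 + q)\<^sup>2) * ((q - 1) / q)"
    proof -
      have "decay_rate a b (4 * a) * (4 * a) = 4 * a / (b\<^sup>2 * (q * (1 + q) ^ 3)) * (b / 2 * (q\<^sup>2 - 1))"
        unfolding decay_rate_def q_def[symmetric] by (simp only: t[symmetric])
      also have "q\<^sup>2 - 1 = (q - 1) * (1 + q)" by (simp add: power2_eq_square algebra_simps)
      also have "4 * a / (b\<^sup>2 * (q * (1 + q) ^ 3)) * (b / 2 * ((q - 1) * (1 + q))) = 2 * a / (b * (1 + q)\<^sup>2) * ((q - 1) / q)"
        using b q by (simp add: divide_simps power2_eq_square power3_eq_cube)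
      finally show ?thesis .
    qed
    also have "\<dots> \<le> 2 * a / (b * (1 + q)\<^sup>2)"
      using a b q by (intro mult_left_le) auto
    finally have "decay a b (4 * a) + 4 * a * decay_rate a b (4 * a) \<le> 4 * a / (b * (1 + q)\<^sup>2)"
      unfolding decay_def q_def[symmetric] by (simp add: mult.commute[of "4 * a"])
    moreover have "1 / 2 \<le> 1 - b / (2 * a)" using a ab by (simp add: field_simps)
    ultimately show ?thesis unfolding D_def using e by linarith
  qed
  moreover have "r_thr a b \<le> 4 * a" using r(3) a by simp
  ultimately obtain t where t: "r_thr a b \<le> t" "D t = 0"
    using IVT'[of D "r_thr a b" 0 "4 * a"] by auto
  then have "is_tau a b t" unfolding is_tau_iff by (simp add: D_def P_plus_high)
  \<comment> \<open>Both tangents pass through the origin, and each lies strictly above the graph at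
    the other point; so each would have to be steeper than the other.\<close>
  moreover have False if "is_tau a b s" "is_tau a b t" "s < t" for s t
  proof -
    have st: "r_thr a b \<le> s" "r_thr a b \<le> t" "P_plus a b s = s * decay_rate a b s" "P_plus a b t = t * decay_rate a b t"
      using that by (auto simp: is_tau_iff)
    have "t * decay_rate a b t < decay_rate a b s * t"
      using P_plus_tangent[OF st(1,2)] that(3) st(3,4) by (simp add: algebra_simps)
    moreover have "s * decay_rate a b s < decay_rate a b t * s"
      using P_plus_tangent[OF st(2,1)] that(3) st(3,4) by (simp add: algebra_simps)
    ultimately have "decay_rate a b t < decay_rate a b s" "decay_rate a b s < decay_rate a b t"
      using st(1) r(1) that(3) by (auto simp: mult.commute mult_less_cancel_left)
    then show False by simp
  qed
  ultimately show ?thesis by (metis linorder_neqE)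
qed

lemma tau_props:
  shows "is_tau a b (tau a b)" "r_thr a b \<le> tau a b" "0 \<le> tau a b"
    and "P_plus a b (tau a b) = tau a b * decay_rate a b (tau a b)"
    and "g_thr v a b = v * decay_rate a b (tau a b)"
proof -
  show *: "is_tau a b (tau a b)" unfolding tau_def by (rule theI'[OF ex1_tau])
  then show "r_thr a b \<le> tau a b" "0 \<le> tau a b" "P_plus a b (tau a b) = tau a b * decay_rate a b (tau a b)"
    "g_thr v a b = v * decay_rate a b (tau a b)"
    using r_thr_props(1)[OF b ab] P_plus'_eq[of "tau a b"] by (auto simp: is_tau_iff g_thr_def)
qed

text \<open>The line through the origin with the slope at \<open>tau\<close> is the tangent at
  \<open>tau\<close>, hence dominates the concave piece. On the convex piece the ratio
  \<open>P_plus a b c\<close> / c = b / (2a(a - c)) increases with c, so it stays below its value at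
  r, which the line already dominates.\<close>

lemma P_plus_le_chord:
  assumes c: "0 \<le> c"
  shows "P_plus a b c \<le> decay_rate a b (tau a b) * c"
    and "P_plus a b c = decay_rate a b (tau a b) * c \<longleftrightarrow> c = 0 \<or> c = tau a b"
proof -
  let ?s = "decay_rate a b (tau a b)"
  note r = r_thr_props[OF b ab] and \<tau> = tau_props
  have high: "P_plus a b x < ?s * x" if "r_thr a b \<le> x" "x \<noteq> tau a b" for x
    using P_plus_tangent[OF \<tau>(2) that(1,2)] \<tau>(4) by (simp add: algebra_simps)
  have high': "P_plus a b x \<le> ?s * x" if "r_thr a b \<le> x" for x
    using high[OF that] \<tau>(4) by (cases "x = tau a b") (auto simp: mult.commute)
  have low: "P_plus a b c < ?s * c" if "0 < c" "c < r_thr a b"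
  proof -
    have y: "0 < a - r_thr a b" "a - r_thr a b < a - c" "0 < a" using r b ab that by auto
    have "b / (2 * a * (a - c)) < b / (2 * a * (a - r_thr a b))"
      using y b by (intro divide_strict_left_mono mult_strict_left_mono mult_pos_pos) auto
    then have 1: "b / (2 * a * (a - c)) * c < b / (2 * a * (a - r_thr a b)) * c"
      using that by (intro mult_strict_right_mono) auto
    have "b / (2 * a * (a - r_thr a b)) * r_thr a b \<le> ?s * r_thr a b"
      using high'[of "r_thr a b"] P_plus_low[of "r_thr a b"] r(1) by (simp add: mult_ac)
    then have "b / (2 * a * (a - r_thr a b)) \<le> ?s"
      by (rule mult_right_le_imp_le) (use that in auto)
    then have "b / (2 * a * (a - r_thr a b)) * c \<le> ?s * c" using that by (intro mult_right_mono) auto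
    with 1 show ?thesis using P_plus_low[of c] that by (simp add: mult_ac)
  qed
  have 0: "P_plus a b 0 = 0" by (simp add: P_plus_def)
  consider "c = 0" | "0 < c" "c < r_thr a b" | "r_thr a b \<le> c" "c \<noteq> tau a b" | "c = tau a b" using c by force
  then show "P_plus a b c \<le> ?s * c" using 0 low high high' \<tau> by cases auto
  show "P_plus a b c = ?s * c \<longleftrightarrow> c = 0 \<or> c = tau a b"
    using 0 low high[of c] \<tau>(4) c by (cases "c = 0"; cases "c < r_thr a b") (force simp: mult.commute)+
qed

text \<open>Beyond \<open>tau\<close> tangents dominate the convex piece too: the tangent at x lies
  above the chord at \<open>tau\<close> and is flatter than the chord, so it lies above it
  everywhere to the left of \<open>tau\<close>.\<close>

lemma P_plus_tangent_beyond_tau: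
  assumes x: "tau a b < x" and c: "0 \<le> c" "c \<noteq> x"
  shows "P_plus a b c < P_plus a b x + decay_rate a b x * (c - x)"
proof (cases "r_thr a b \<le> c")
  case True
  then show ?thesis using P_plus_tangent[of x c] x c tau_props(2) by simp
next
  case False
  let ?s = "decay_rate a b (tau a b)" and ?h = "decay_rate a b x"
  have "?h < ?s" using decay_rate_less[of a b "tau a b" x] tau_props(3) x b ab by simp
  then have "?h * (tau a b - c) \<le> ?s * (tau a b - c)"
    using False tau_props(2) by (intro mult_right_mono) auto
  moreover have "?s * tau a b < P_plus a b x + ?h * (tau a b - x)"
    using P_plus_tangent[of x "tau a b"] tau_props(2,4) x by (simp add: mult.commute)
  moreover have "P_plus a b c \<le> ?s * c" by (rule P_plus_le_chord(1)[OF c(1)])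
  ultimately show ?thesis by (simp add: algebra_simps)
qed

end

subsection \<open>Market clearing\<close>

definition quartic :: "real \<Rightarrow> real" where
  "quartic q = q * (1 + q) ^ 3"

lemma quartic_expanding: "0 \<le> p \<Longrightarrow> p \<le> q \<Longrightarrow> q - p \<le> quartic q - quartic p"
  unfolding quartic_def by (rule quartic_diff_ge)

lemma quartic_0 [simp]: "quartic 0 = 0"
  by (simp add: quartic_def)

lemma quartic_inj: "0 \<le> p \<Longrightarrow> 0 \<le> q \<Longrightarrow> quartic p = quartic q \<Longrightarrow> p = q"
  using quartic_expanding[of p q] quartic_expanding[of q p] by linarith

definition quartic_root :: "real \<Rightarrow> real" where
  "quartic_root y = (THE q. 0 \<le> q \<and> quartic q = y)"

lemma quartic_root:
  assumes "0 \<le> y"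
  shows "0 \<le> quartic_root y" "quartic (quartic_root y) = y"
proof -
  have "continuous_on {0..y} quartic" unfolding quartic_def by (intro continuous_intros)
  then have "\<exists>q\<ge>0. q \<le> y \<and> quartic q = y"
    using quartic_expanding[of 0 y] assms by (intro IVT') auto
  then have "\<exists>!q. 0 \<le> q \<and> quartic q = y" using quartic_inj by metis
  from theI'[OF this] show "0 \<le> quartic_root y" "quartic (quartic_root y) = y"
    unfolding quartic_root_def by auto
qed

lemma quartic_nonneg: "0 \<le> q \<Longrightarrow> 0 \<le> quartic q"
  by (simp add: quartic_def)

lemma quartic_root_eq: "0 \<le> q \<Longrightarrow> quartic_root (quartic q) = q"
  using quartic_root[OF quartic_nonneg, of q] quartic_inj[of "quartic_root (quartic q)" q] by simp

lemma quartic_root_diff_le: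
  assumes "0 \<le> x" "x \<le> y"
  shows "quartic_root x \<le> quartic_root y" "quartic_root y - quartic_root x \<le> y - x"
proof -
  have y: "0 \<le> y" using assms by simp
  note X = quartic_root[OF assms(1)] and Y = quartic_root[OF y]
  show le: "quartic_root x \<le> quartic_root y"
  proof (rule ccontr)
    assume "\<not> ?thesis"
    then have "quartic_root x - quartic_root y \<le> x - y" "quartic_root y < quartic_root x"
      using quartic_expanding[OF Y(1), of "quartic_root x"] X(2) Y(2) by auto
    with assms(2) show False by linarith
  qed
  show "quartic_root y - quartic_root x \<le> y - x"
    using quartic_expanding[OF X(1) le] X(2) Y(2) by simp
qed

lemma quartic_root_less:
  assumes "0 \<le> x" "x < y" shows "quartic_root x < quartic_root y"
proof -
  have "quartic_root x \<noteq> quartic_root y"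
  proof
    assume "quartic_root x = quartic_root y"
    then have "quartic (quartic_root x) = quartic (quartic_root y)" by (rule arg_cong)
    then show False using quartic_root(2)[of x] quartic_root(2)[of y] assms by simp
  qed
  then show ?thesis using quartic_root_diff_le(1)[of x y] assms by simp
qed

lemma continuous_on_quartic_root: "continuous_on {0..} quartic_root"
proof (rule lipschitz_on_continuous_on)
  have "\<bar>quartic_root x - quartic_root y\<bar> \<le> \<bar>x - y\<bar>" if "0 \<le> x" "0 \<le> y" for x y
    using quartic_root_diff_le[of x y] quartic_root_diff_le[of y x] that by linarith
  then show "1-lipschitz_on {0..} quartic_root"
    by (intro lipschitz_onI) (auto simp: dist_real_def)
qed

text \<open>Monotonicity places the nonnegative root above s as soon as \<open>quartic s\<close>
  does not exceed y. The value s = 1 serves \<open>is_p\<close>, and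
  \<open>bid_ratio b (tau a b)\<close> serves \<open>is_q\<close>.\<close>

lemma quartic_ex1:
  assumes "0 \<le> s" "quartic s \<le> y"
  shows "\<exists>!q. s \<le> q \<and> quartic q = y" "(THE q. s \<le> q \<and> quartic q = y) = quartic_root y"
proof -
  have "s \<le> quartic_root y"
    using quartic_root_diff_le(1)[OF quartic_nonneg[OF assms(1)] assms(2)] quartic_root_eq[OF assms(1)] by simp
  moreover have "q = quartic_root y" if "s \<le> q" "quartic q = y" for q
    using quartic_root_eq[of q] that assms by simp
  moreover have "quartic (quartic_root y) = y"
    using quartic_root(2)[of y] quartic_nonneg[OF assms(1)] assms(2) by simp
  ultimately have *: "s \<le> q \<and> quartic q = y \<longleftrightarrow> q = quartic_root y" for q by blast
  show "\<exists>!q. s \<le> q \<and> quartic q = y" "(THE q. s \<le> q \<and> quartic q = y) = quartic_root y"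
    unfolding * by simp_all
qed

text \<open>\<open>demand v A B\<close> inverts the marginal value \<open>t \<mapsto> v * decay_rate A B t\<close>.\<close>

definition demand :: "real \<Rightarrow> real \<Rightarrow> real \<Rightarrow> real \<Rightarrow> real" where
  "demand v A B h = B / 2 * ((quartic_root (4 * v * A / (h * B\<^sup>2)))\<^sup>2 - 1)"

context
  fixes v A B :: real
  assumes v: "0 < v" and A: "0 < A" and B: "0 < B"
begin

lemma demand_decay_rate:
  assumes "0 \<le> t" shows "demand v A B (v * decay_rate A B t) = t"
proof -
  define q where "q = bid_ratio B t"
  have q: "1 \<le> q" unfolding q_def using bid_ratio_ge_1[OF B assms] .
  then have "4 * v * A / (v * decay_rate A B t * B\<^sup>2) = quartic q"
    unfolding decay_rate_def quartic_def q_def[symmetric] using v A B by simp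
  then have "demand v A B (v * decay_rate A B t) = B / 2 * (q\<^sup>2 - 1)"
    unfolding demand_def using q by (simp add: quartic_root_eq)
  also have "\<dots> = t" unfolding q_def by (rule bid_ratio_sq[OF B assms, symmetric])
  finally show ?thesis .
qed

lemma demand_less:
  assumes "0 < h" "h < h'" shows "demand v A B h' < demand v A B h"
proof -
  have "4 * v * A / (h' * B\<^sup>2) < 4 * v * A / (h * B\<^sup>2)"
    using assms v A B by (intro divide_strict_left_mono) auto
  moreover have pos: "0 \<le> 4 * v * A / (h' * B\<^sup>2)" using assms v A B by simp
  ultimately have "quartic_root (4 * v * A / (h' * B\<^sup>2)) < quartic_root (4 * v * A / (h * B\<^sup>2))"
    using quartic_root_less by simp
  with quartic_root(1)[OF pos] show ?thesis
    unfolding demand_def using B by (simp add: power_strict_mono)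
qed

lemma continuous_on_demand: "continuous_on {0<..} (demand v A B)"
  unfolding demand_def
  by (intro continuous_intros continuous_on_compose2[OF continuous_on_quartic_root])
     (use v A B in auto)

text \<open>The other half of the inversion: the marginal value at the demanded amount has the same
  demand as h, and strict monotonicity makes demand injective in the price.\<close>

lemma decay_rate_demand:
  assumes t: "0 \<le> t" and h: "0 < h" "h \<le> v * decay_rate A B t"
  shows "t \<le> demand v A B h" "v * decay_rate A B (demand v A B h) = h"
proof -
  show le: "t \<le> demand v A B h"
    using demand_less[OF h(1), of "v * decay_rate A B t"] demand_decay_rate[OF t] h(2)
    by (cases "h = v * decay_rate A B t") auto
  let ?h = "v * decay_rate A B (demand v A B h)"
  have "demand v A B ?h = demand v A B h" "0 < ?h"
    using demand_decay_rate decay_rate_pos[OF A B] le t v by auto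
  then show "?h = h" using demand_less[OF h(1), of ?h] demand_less[of ?h h] by (metis less_irrefl linorder_neqE)
qed

end

text \<open>The aggregate correspondence jumps from \<open>\<Sum>lo\<close> to \<open>\<Sum>up\<close> at the largest price \<open>h\<close> at which
  \<open>\<Sum>up\<close> still covers the budget, and the budget lies in between; a convex combination of the
  two selections exhausts it.\<close>

lemma clearing_price:
  fixes D :: "'m::finite \<Rightarrow> real \<Rightarrow> real" and \<theta> \<tau> :: "'m \<Rightarrow> real"
  assumes \<rho>: "0 < \<rho>" and \<theta>: "\<And>m. 0 < \<theta> m" and \<tau>: "\<And>m. 0 \<le> \<tau> m" "\<And>m. D m (\<theta> m) = \<tau> m"
    and mono: "\<And>m h h'. 0 < h \<Longrightarrow> h < h' \<Longrightarrow> D m h' < D m h"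
    and cont: "\<And>m. continuous_on {0<..} (D m)"
    and surj: "\<And>m x. \<tau> m \<le> x \<Longrightarrow> \<exists>h>0. h \<le> \<theta> m \<and> x \<le> D m h"
  shows "\<exists>h>0. \<exists>x. (\<forall>m. x m \<in> (if h > \<theta> m then {0} else if h = \<theta> m then {0..\<tau> m} else {D m h})) \<and>
    (\<Sum>m\<in>UNIV. x m) = \<rho>"
proof -
  \<comment> \<open>The two agree except at a breakpoint h = \<open>\<theta> m\<close>, where they
    take the ends \<open>\<tau> m\<close> and 0 of the interval of admissible allocations.\<close>
  define up lo where "up m h = (if h > \<theta> m then 0 else D m h)"
    and "lo m h = (if h \<ge> \<theta> m then 0 else D m h)" for m h
  have D_ge: "\<tau> m \<le> D m h" if "0 < h" "h \<le> \<theta> m" for m h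
    using mono[of h "\<theta> m" m] \<tau>(2)[of m] that by (cases "h = \<theta> m") auto
  have up_nn: "0 \<le> up m h" if "0 < h" for m h
    using D_ge[of h m] \<tau>(1)[of m] that by (auto simp: up_def)
  have up_mono: "up m h' \<le> up m h" if "0 < h" "h \<le> h'" for m h h'
  proof (cases "h' \<le> \<theta> m")
    case True
    then show ?thesis using mono[of h h' m] that by (cases "h = h'") (auto simp: up_def)
  next
    case False
    then show ?thesis using up_nn[OF that(1), of m] by (simp add: up_def)
  qed
  define H where "H = {h. 0 < h \<and> \<rho> \<le> (\<Sum>m\<in>UNIV. up m h)}"
  have "\<exists>h. h \<in> H"
  proof -
    \<comment> \<open>There is at least one battlefield, and at a low enough price it alone absorbs
      the budget.\<close>
    fix m0 :: 'm
    obtain h where h: "0 < h" "h \<le> \<theta> m0" "max \<rho> (\<tau> m0) \<le> D m0 h"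
      using surj[of m0 "max \<rho> (\<tau> m0)"] by auto
    have "\<rho> \<le> up m0 h" using h by (simp add: up_def)
    also have "\<dots> \<le> (\<Sum>m\<in>UNIV. up m h)" using up_nn[OF h(1)] by (intro member_le_sum) auto
    finally show ?thesis using h(1) by (auto simp: H_def)
  qed
  then obtain h1 where h1: "h1 \<in> H" by blast
  have bdd: "bdd_above H"
  \<comment> \<open>A price above every threshold leaves no demand, so it cannot cover a positive
    budget.\<close>
  proof (rule bdd_aboveI)
    fix h assume h: "h \<in> H"
    have "\<exists>m. h \<le> \<theta> m"
    proof (rule ccontr)
      assume "\<nexists>m. h \<le> \<theta> m"
      then have "(\<Sum>m\<in>UNIV. up m h) = 0" by (simp add: up_def not_le)
      with h \<rho> show False by (simp add: H_def)
    qed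
    then obtain m where "h \<le> \<theta> m" by blast
    also have "\<dots> \<le> (\<Sum>m\<in>UNIV. \<theta> m)" using \<theta> by (intro member_le_sum) (auto simp: less_imp_le)
    finally show "h \<le> (\<Sum>m\<in>UNIV. \<theta> m)" .
  qed
  define h0 where "h0 = Sup H"
  have h0: "0 < h0" using cSup_upper[OF h1 bdd] h1 by (auto simp: h0_def H_def)
  have contD: "isCont (D m) h0" for m
    using cont[of m] h0 by (simp add: continuous_on_eq_continuous_at)
  have below: "\<rho> \<le> (\<Sum>m\<in>UNIV. up m h)" if "0 < h" "h < h0" for h
  proof -
    have "H \<noteq> {}" "h < Sup H" using h1 \<open>h < h0\<close> by (auto simp: h0_def)
    then obtain h' where "h' \<in> H" "h < h'" using less_cSup_iff[OF _ bdd] by blast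
    then show ?thesis
      using sum_mono[of UNIV "\<lambda>m. up m h'" "\<lambda>m. up m h"] up_mono[OF that(1), of h'] by (auto simp: H_def)
  qed
  have above: "(\<Sum>m\<in>UNIV. up m h) \<le> \<rho>" if "h0 < h" for h
    using cSup_upper[OF _ bdd, of h] that h0 by (force simp: h0_def H_def)
  \<comment> \<open>The limits from the two sides differ only at breakpoints: \<open>up m\<close> is
    continuous from the left, and its limit from the right is \<open>lo m h0\<close>.\<close>
  have up_lim: "(up m \<longlongrightarrow> up m h0) (at_left h0)" for m
  proof (cases "h0 \<le> \<theta> m")
    case True
    have "eventually (\<lambda>h. D m h = up m h) (at_left h0)"
      using True by (auto simp: up_def eventually_at_filter)
    moreover have "(D m \<longlongrightarrow> up m h0) (at_left h0)"
      using contD[of m] True by (simp add: up_def continuous_at filterlim_at_split isCont_def)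
    ultimately show ?thesis by (rule Lim_transform_eventually[rotated])
  next
    case False
    have "eventually (\<lambda>h. h \<in> {\<theta> m<..<h0}) (at_left h0)" using False by (intro eventually_at_left_real) simp
    then have "eventually (\<lambda>h. 0 = up m h) (at_left h0)" by eventually_elim (auto simp: up_def)
    then show ?thesis using False by (intro Lim_transform_eventually[OF tendsto_const]) (auto simp: up_def)
  qed
  have lo_lim: "(up m \<longlongrightarrow> lo m h0) (at_right h0)" for m
  proof (cases "h0 < \<theta> m")
    case True
    have "eventually (\<lambda>h. h \<in> {h0<..<\<theta> m}) (at_right h0)" using True by (intro eventually_at_right_real) simp
    then have "eventually (\<lambda>h. D m h = up m h) (at_right h0)" by eventually_elim (auto simp: up_def)
    moreover have "(D m \<longlongrightarrow> lo m h0) (at_right h0)"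
      using contD[of m] True by (simp add: lo_def continuous_at filterlim_at_split isCont_def)
    ultimately show ?thesis by (rule Lim_transform_eventually[rotated])
  next
    case False
    have "eventually (\<lambda>h. 0 = up m h) (at_right h0)"
      using False by (auto simp: up_def eventually_at_filter)
    then show ?thesis using False by (intro Lim_transform_eventually[OF tendsto_const]) (auto simp: lo_def)
  qed
  have "\<rho> \<le> (\<Sum>m\<in>UNIV. up m h0)"
  proof (rule tendsto_lowerbound[OF tendsto_sum[OF up_lim]])
    have "eventually (\<lambda>h. h \<in> {0<..<h0}) (at_left h0)" using h0 by (intro eventually_at_left_real)
    then show "eventually (\<lambda>h. \<rho> \<le> (\<Sum>m\<in>UNIV. up m h)) (at_left h0)"
      by eventually_elim (auto intro: below)
  qed simp
  moreover have "(\<Sum>m\<in>UNIV. lo m h0) \<le> \<rho>"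
  proof (rule tendsto_upperbound[OF tendsto_sum[OF lo_lim]])
    show "eventually (\<lambda>h. (\<Sum>m\<in>UNIV. up m h) \<le> \<rho>) (at_right h0)"
      using above by (auto simp: eventually_at_filter)
  qed simp
  moreover define L U where "L = (\<Sum>m\<in>UNIV. lo m h0)" and "U = (\<Sum>m\<in>UNIV. up m h0)"
  ultimately have LU: "L \<le> \<rho>" "\<rho> \<le> U" by auto
  obtain t where t: "0 \<le> t" "t \<le> 1" "L + t * (U - L) = \<rho>"
  proof (cases "L = U")
    case True
    then show ?thesis using LU by (intro that[of 0]) auto
  next
    case False
    then show ?thesis using LU by (intro that[of "(\<rho> - L) / (U - L)"]) (auto simp: divide_simps)
  qed
  define x where "x m = lo m h0 + t * (up m h0 - lo m h0)" for m
  have "(\<Sum>m\<in>UNIV. x m) = \<rho>"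
    using t(3) by (simp add: x_def L_def U_def sum.distrib sum_distrib_left[symmetric] sum_subtractf)
  moreover have "x m \<in> (if h0 > \<theta> m then {0} else if h0 = \<theta> m then {0..\<tau> m} else {D m h0})" for m
    using t(1,2) \<tau>[of m] mult_left_le_one_le[of "\<tau> m" t] by (auto simp: x_def lo_def up_def)
  ultimately show ?thesis using h0 by blast
qed

text \<open>Only the higher price can sit on the breakpoint, and even the largest allocation there,
  \<open>D \<theta>\<close>, lies below the demand at a lower price.\<close>

lemma correspondence_strict_antimono:
  fixes D :: "real \<Rightarrow> real"
  assumes mono: "\<And>h h'. 0 < h \<Longrightarrow> h < h' \<Longrightarrow> D h' < D h" and "D \<theta> = \<tau>" "0 \<le> \<tau>"
    and "0 < h" "h < h'" "h' \<le> \<theta>"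
    and "x \<in> (if h > \<theta> then {0} else if h = \<theta> then {0..\<tau>} else {D h})"
    and "x' \<in> (if h' > \<theta> then {0} else if h' = \<theta> then {0..\<tau>} else {D h'})"
  shows "x' < x"
  using assms(2-) mono[of h h'] by (auto split: if_splits)

text \<open>Raising the price lowers every allocation, strictly on battlefields whose threshold is
  not yet passed. A positive budget keeps at least one such battlefield, so the totals cannot
  agree.\<close>

lemma clearing_price_unique:
  fixes D :: "'m::finite \<Rightarrow> real \<Rightarrow> real" and \<theta> \<tau> :: "'m \<Rightarrow> real"
  assumes "0 < \<rho>" and \<tau>: "\<And>m. 0 \<le> \<tau> m" "\<And>m. D m (\<theta> m) = \<tau> m"
    and mono: "\<And>m h h'. 0 < h \<Longrightarrow> h < h' \<Longrightarrow> D m h' < D m h"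
    and "0 < h" "0 < h'"
    and x: "\<And>m. x m \<in> (if h > \<theta> m then {0} else if h = \<theta> m then {0..\<tau> m} else {D m h})" "(\<Sum>m\<in>UNIV. x m) = \<rho>"
    and x': "\<And>m. x' m \<in> (if h' > \<theta> m then {0} else if h' = \<theta> m then {0..\<tau> m} else {D m h'})" "(\<Sum>m\<in>UNIV. x' m) = \<rho>"
  shows "h = h'"
proof -
  have False
    if h: "0 < h" "h < h'"
      and x: "\<And>m. x m \<in> (if h > \<theta> m then {0} else if h = \<theta> m then {0..\<tau> m} else {D m h})" "(\<Sum>m\<in>UNIV. x m) = \<rho>"
      and x': "\<And>m. x' m \<in> (if h' > \<theta> m then {0} else if h' = \<theta> m then {0..\<tau> m} else {D m h'})" "(\<Sum>m\<in>UNIV. x' m) = \<rho>"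
    for h h' x x'
  proof -
    have nn: "0 \<le> x m" for m
      using x(1)[of m] mono[OF h(1), of "\<theta> m" m] \<tau>[of m] by (auto split: if_splits)
    have lt: "x' m < x m" if "h' \<le> \<theta> m" for m
      by (rule correspondence_strict_antimono[OF mono \<tau>(2) \<tau>(1) h that x(1) x'(1)])
    have le: "x' m \<le> x m" for m
      using lt[of m] nn[of m] x'(1)[of m] by (cases "h' \<le> \<theta> m") auto
    have "\<exists>m. h' \<le> \<theta> m"
    proof (rule ccontr)
      assume "\<nexists>m. h' \<le> \<theta> m"
      then have "x' m = 0" for m using x'(1)[of m] by (simp add: not_le)
      with x'(2) assms(1) show False by simp
    qed
    then have "(\<Sum>m\<in>UNIV. x' m) < (\<Sum>m\<in>UNIV. x m)"
      using lt le by (intro sum_strict_mono_ex1) auto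
    with x(2) x'(2) show False by simp
  qed
  from this[OF assms(5) _ x x'] this[OF assms(6) _ x' x] show ?thesis by (metis linorder_neqE)
qed

subsection \<open>Interventions and budget duality\<close>

lemma intervention_distD:
  assumes "intervention_dist F"
  shows "prob_space F" "sets F = sets borel" "space F = UNIV"
  using assms sets_eq_imp_space_eq[of F borel] by (auto simp: intervention_dist_def)

lemma borel_measurable_intervention:
  fixes f :: "real ^ 'm::finite \<Rightarrow> 'b::topological_space"
  assumes "intervention_dist F" "f \<in> borel_measurable borel"
  shows "f \<in> borel_measurable F"
  using assms(2) measurable_cong_sets[OF intervention_distD(2)[OF assms(1)] refl] by auto

lemma borel_measurable_coord [measurable]: "(\<lambda>c :: real ^ 'm::finite. c $ m) \<in> borel_measurable borel"
  by (intro borel_measurable_continuous_onI continuous_intros)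

lemma coord_measurable:
  "intervention_dist F \<Longrightarrow> (\<lambda>c. c $ m) \<in> borel_measurable F"
  by (rule borel_measurable_intervention) auto

lemma AE_marginal:
  assumes F: "intervention_dist F" and P: "Measurable.pred borel P"
  shows "(AE x in marginal F m. P x) \<longleftrightarrow> (AE c in F. P (c $ m))"
  unfolding marginal_def
  by (rule AE_distr_iff) (use P coord_measurable[OF F] in \<open>auto simp: pred_def\<close>)

lemma measure_marginal:
  assumes F: "intervention_dist F" and A: "A \<in> sets borel"
  shows "measure (marginal F m) A = measure F {c. c $ m \<in> A}"
  unfolding marginal_def
  using A coord_measurable[OF F] intervention_distD(3)[OF F]
  by (subst measure_distr) (auto simp: vimage_def)

lemma prob_space_marginal:
  assumes F: "intervention_dist F"
  shows "prob_space (marginal F m)" "sets (marginal F m) = sets borel"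
  unfolding marginal_def
  using prob_space.prob_space_distr[OF intervention_distD(1)[OF F] coord_measurable[OF F]]
  by auto

section \<open>Point and two-point marginals\<close>

lemma marginal_dirac_iff:
  assumes F: "intervention_dist F"
  shows "marginal F m = dirac z \<longleftrightarrow> (AE c in F. c $ m = z)"
proof
  assume "marginal F m = dirac z"
  moreover have "AE x in dirac z. x = z" by (subst AE_return) auto
  ultimately have "AE x in marginal F m. x = z" by metis
  then show "AE c in F. c $ m = z" by (subst (asm) AE_marginal[OF F]) auto
next
  assume AE: "AE c in F. c $ m = z"
  interpret prob_space F by (rule intervention_distD(1)[OF F])
  have "marginal F m = distr F borel (\<lambda>_. z)"
    unfolding marginal_def
    by (rule distr_cong_AE) (use AE coord_measurable[OF F] in auto)
  then show "marginal F m = dirac z" by (simp add: distr_const)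
qed

text \<open>A coordinate living on 0 and t is almost surely t times an indicator, so its mean and
  its law both depend only on the mass at t.\<close>

lemma two_point_coord:
  fixes F :: "(real ^ 'm::finite) measure"
  assumes F: "intervention_dist F" and AE: "AE c in F. c $ m = 0 \<or> c $ m = t" and t: "t \<noteq> 0"
  shows "integrable F (\<lambda>c. c $ m)" "(\<integral>c. c $ m \<partial>F) = t * measure F {c. c $ m = t}"
    and "A \<in> sets borel \<Longrightarrow> measure F {c. c $ m \<in> A} =
      measure F {c. c $ m = t} * indicator A t + (1 - measure F {c. c $ m = t}) * indicator A 0"
proof -
  interpret prob_space F by (rule intervention_distD(1)[OF F])
  have sets: "{c. c $ m \<in> A} \<in> sets F" if "A \<in> sets borel" for A
  proof -
    have "(\<lambda>c. c $ m) -` A \<inter> space F \<in> sets F"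
      using coord_measurable[OF F] that by (rule measurable_sets)
    then show ?thesis by (simp add: vimage_def intervention_distD(3)[OF F])
  qed
  have T: "{c. c $ m = t} \<in> sets F" using sets[of "{t}"] by simp
  note meas = coord_measurable[OF F, of m]
  have eq: "AE c in F. c $ m = t * indicator {c. c $ m = t} c"
    using AE by eventually_elim (use t in \<open>auto simp: indicator_def\<close>)
  have i: "integrable F (\<lambda>c. t * indicator {c. c $ m = t} c)"
    using T by (intro integrable_mult_right integrable_real_indicator) (auto simp: emeasure_eq_measure)
  show "integrable F (\<lambda>c. c $ m)"
    using integrable_cong_AE[OF meas borel_measurable_integrable[OF i] eq] i by simp
  show "(\<integral>c. c $ m \<partial>F) = t * measure F {c. c $ m = t}"
    using integral_cong_AE[OF meas borel_measurable_integrable[OF i] eq] T by simp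
  assume A: "A \<in> sets borel"
  let ?I = "\<lambda>c. indicator {c. c $ m = t} c * indicator A t + (1 - indicator {c. c $ m = t} c) * indicator A 0 :: real"
  have iI: "integrable F (indicator {c. c $ m = t} :: _ \<Rightarrow> real)"
    using T by (intro integrable_real_indicator) (auto simp: emeasure_eq_measure)
  have "(\<integral>c. indicator {c. c $ m \<in> A} c \<partial>F) = (\<integral>c. ?I c \<partial>F)"
  proof (rule integral_cong_AE)
    show "AE c in F. indicator {c. c $ m \<in> A} c = ?I c"
      using AE by eventually_elim (use t in \<open>auto simp: indicator_def\<close>)
  qed (use sets[OF A] T in auto)
  also have "\<dots> = measure F {c. c $ m = t} * indicator A t + (1 - measure F {c. c $ m = t}) * indicator A 0"
    using iI T by (simp add: prob_space)
  finally show "measure F {c. c $ m \<in> A} =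
      measure F {c. c $ m = t} * indicator A t + (1 - measure F {c. c $ m = t}) * indicator A 0"
    using sets[OF A] by simp
qed

text \<open>The marginal prescribed when B is favoured. For 0 <= x <= t it is the law on {0, t} with
  mean x; the other branch also takes in allocations beyond t.\<close>

definition two_point :: "real \<Rightarrow> real \<Rightarrow> real measure" where
  "two_point t x = (if x < t then mixture (x / t) (dirac t) (dirac 0) else dirac x)"

lemma prob_space_dirac [simp]: "prob_space (dirac z)"
  by (simp add: prob_space_return)

text \<open>A law on {0, t} is determined by its mean. This replaces equality of measures by an
  almost-sure constraint and one integral, the data that the duality argument delivers.\<close>

lemma marginal_two_point_iff:
  fixes F :: "(real ^ 'm::finite) measure"
  assumes F: "intervention_dist F" and x: "0 \<le> x" "x \<le> t"
  shows "marginal F m = two_point t x \<longleftrightarrow> (AE c in F. c $ m = 0 \<or> c $ m = t) \<and> (\<integral>c. c $ m \<partial>F) = x"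
\<comment> \<open>The weight x / t has no meaning for t = 0, a case that does arise, since
  \<open>tau\<close> is 0 for a = b.\<close>
proof (cases "t = 0")
  case True
  have "(\<integral>c. c $ m \<partial>F) = x" if AE: "AE c in F. c $ m = 0"
  proof -
    have "(\<integral>c. c $ m \<partial>F) = (\<integral>c. 0 \<partial>F)"
      by (rule integral_cong_AE) (use AE coord_measurable[OF F] in auto)
    then show ?thesis using True x by simp
  qed
  then show ?thesis using True x by (auto simp: two_point_def marginal_dirac_iff[OF F])
next
  case False
  interpret prob_space F by (rule intervention_distD(1)[OF F])
  have t: "0 < t" using False x by simp
  define p where "p = x / t"
  have p: "0 \<le> p" "p \<le> 1" "t * p = x" using x t by (auto simp: p_def)
  let ?M = "mixture p (dirac t) (dirac 0)"
  note D = prob_space_dirac sets_return prob_space_dirac sets_return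
  have M: "measure ?M A = p * indicator A t + (1 - p) * indicator A 0" if "A \<in> sets borel" for A
    using that by (subst measure_mixture[OF D p(1,2)]) (auto simp: measure_return)
  have tp: "two_point t x = ?M"
  proof (cases "x < t")
    case False
    then have "p = 1" "x = t" using x t by (auto simp: p_def)
    moreover have "mixture 1 (dirac t) (dirac 0) = dirac t"
    proof (rule measure_eqI)
      fix A assume "A \<in> sets (mixture 1 (dirac t) (dirac 0))"
      then have A: "A \<in> sets borel" by (simp add: sets_mixture)
      interpret M: prob_space "mixture 1 (dirac t) (dirac 0)" by (rule prob_space_mixture[OF D])
      show "emeasure (mixture 1 (dirac t) (dirac 0)) A = emeasure (dirac t) A"
        using M[OF A] A \<open>p = 1\<close> by (simp add: M.emeasure_eq_measure emeasure_return split: split_indicator)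
    qed (simp add: sets_mixture)
    ultimately show ?thesis by (simp add: two_point_def)
  qed (simp add: two_point_def p_def)
  show ?thesis
  proof
    assume eq: "marginal F m = two_point t x"
    have "AE y in ?M. y = 0 \<or> y = t"
      by (rule AE_mixture[OF D p(1,2)]) (auto simp: AE_return)
    then have AE: "AE c in F. c $ m = 0 \<or> c $ m = t"
      unfolding tp[symmetric] eq[symmetric] by (subst (asm) AE_marginal[OF F]) auto
    have "measure F {c. c $ m = t} = p"
      using measure_marginal[OF F, of "{t}" m] M[of "{t}"] t by (simp add: eq tp)
    then show "(AE c in F. c $ m = 0 \<or> c $ m = t) \<and> (\<integral>c. c $ m \<partial>F) = x"
      using AE two_point_coord(2)[OF F AE] t p by simp
  next
    assume R: "(AE c in F. c $ m = 0 \<or> c $ m = t) \<and> (\<integral>c. c $ m \<partial>F) = x"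
    then have AE: "AE c in F. c $ m = 0 \<or> c $ m = t" by simp
    have "t * measure F {c. c $ m = t} = t * p" using two_point_coord(2)[OF F AE] R t p by simp
    then have "measure F {c. c $ m = t} = p" using t by simp
    note meas = two_point_coord(3)[OF F AE, unfolded this]
    show "marginal F m = two_point t x"
      unfolding tp
    proof (rule measure_eqI)
      show "sets (marginal F m) = sets ?M" using prob_space_marginal(2)[OF F] by (simp add: sets_mixture)
      fix A assume "A \<in> sets (marginal F m)"
      then have A: "A \<in> sets borel" using prob_space_marginal(2)[OF F] by simp
      interpret M: prob_space ?M by (rule prob_space_mixture[OF D])
      interpret N: prob_space "marginal F m" by (rule prob_space_marginal(1)[OF F])
      show "emeasure (marginal F m) A = emeasure ?M A"
        using measure_marginal[OF F A, of m] meas[OF _ A] M[OF A] t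
        by (simp add: M.emeasure_eq_measure N.emeasure_eq_measure)
    qed
  qed
qed

lemma two_point_mean_bounds:
  fixes F :: "(real ^ 'm::finite) measure"
  assumes F: "intervention_dist F" and t: "0 \<le> t" and AE: "AE c in F. c $ m = 0 \<or> c $ m = t"
  shows "integrable F (\<lambda>c. c $ m)" "0 \<le> (\<integral>c. c $ m \<partial>F)" "(\<integral>c. c $ m \<partial>F) \<le> t"
proof -
  interpret prob_space F by (rule intervention_distD(1)[OF F])
  note meas = coord_measurable[OF F, of m]
  show i: "integrable F (\<lambda>c. c $ m)"
    by (rule integrable_const_bound[where B = t]) (use AE t meas in \<open>auto elim!: eventually_mono\<close>)
  show "0 \<le> (\<integral>c. c $ m \<partial>F)"
    by (rule integral_nonneg_AE) (use AE t in \<open>auto elim!: eventually_mono\<close>)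
  have "(\<integral>c. c $ m \<partial>F) \<le> (\<integral>c. t \<partial>F)"
    by (rule integral_mono_AE[OF i]) (use AE t in \<open>auto elim!: eventually_mono\<close>)
  then show "(\<integral>c. c $ m \<partial>F) \<le> t" by (simp add: prob_space)
qed

text \<open>Couples the prescribed marginals through one uniform variable.\<close>

lemma exists_two_point_coupling:
  fixes x t :: "'m::finite \<Rightarrow> real"
  assumes x: "\<And>m. 0 \<le> x m" and t: "\<And>m. 0 \<le> t m"
  shows "\<exists>F. intervention_dist F \<and> (\<forall>m. marginal F m = two_point (t m) (x m))"
proof -
  let ?U = "uniform_dist 0 1"
  interpret U: prob_space ?U by (rule prob_space_uniform_dist) simp
  define C where "C u = (\<chi> m. if x m < t m then (if u \<le> x m / t m then t m else 0) else x m)" for u :: real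
  have C: "C \<in> borel_measurable ?U"
    unfolding C_def by (subst borel_measurable_euclidean_space) (auto simp: Basis_vec_def inner_axis)
  define F where "F = distr ?U borel C"
  have F: "intervention_dist F"
    unfolding F_def intervention_dist_def using C U.prob_space_distr by auto
  have "marginal F m = two_point (t m) (x m)" for m
  proof (cases "x m < t m")
    case True
    have AE: "AE c in F. c $ m = 0 \<or> c $ m = t m"
      unfolding F_def using C True by (subst AE_distr_iff) (auto simp: C_def)
    have tm: "t m \<noteq> 0" using True x[of m] by simp
    have "measure F {c. c $ m = t m} = measure ?U {..x m / t m}"
    proof -
      have "{c :: real ^ 'm. c $ m = t m} = (\<lambda>c. c $ m) -` {t m} \<inter> space borel" by auto
      then have "{c :: real ^ 'm. c $ m = t m} \<in> sets borel"
        using measurable_sets[OF borel_measurable_coord, of "{t m}"] by simp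
      then have "measure F {c. c $ m = t m} = measure ?U (C -` {c. c $ m = t m} \<inter> space ?U)"
        unfolding F_def using C by (subst measure_distr) auto
      also have "C -` {c. c $ m = t m} \<inter> space ?U = {..x m / t m}"
        using True tm by (auto simp: C_def)
      finally show ?thesis .
    qed
    also have "\<dots> = x m / t m"
      using measure_uniform_dist_le[of 0 1 "x m / t m"] True x[of m] by (simp del: measure_uniform_measure)
    finally show ?thesis
      using two_point_coord(2)[OF F AE tm] True AE x tm by (subst marginal_two_point_iff[OF F]) auto
  next
    case False
    then have "AE c in F. c $ m = x m"
      unfolding F_def using C by (subst AE_distr_iff) (auto simp: C_def)
    then show ?thesis
      using False marginal_dirac_iff[OF F, of m "x m"] by (simp add: two_point_def)
  qed
  then show ?thesis using F by blast
qed

section \<open>Feasibility and the dual bound\<close>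

lemma feasible_iff:
  fixes F :: "(real ^ 'm::finite) measure"
  assumes "0 \<le> \<rho>"
  shows "feasible \<rho> F \<longleftrightarrow> intervention_dist F \<and> integrable F (\<lambda>c. \<Sum>m\<in>UNIV. \<bar>c $ m\<bar>) \<and>
    (\<integral>c. (\<Sum>m\<in>UNIV. \<bar>c $ m\<bar>) \<partial>F) \<le> \<rho>"
proof (cases "intervention_dist F")
  case True
  have meas: "(\<lambda>c :: real ^ 'm. \<Sum>m\<in>UNIV. \<bar>c $ m\<bar>) \<in> borel_measurable F"
    by (rule borel_measurable_intervention[OF True]) simp
  have nn: "AE c in F. 0 \<le> (\<Sum>m\<in>UNIV. \<bar>c $ m\<bar>)" by (auto intro: sum_nonneg)
  show ?thesis
  proof
    assume f: "feasible \<rho> F"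
    then have "integrable F (\<lambda>c. \<Sum>m\<in>UNIV. \<bar>c $ m\<bar>)"
      using meas nn by (intro integrableI_nonneg) (auto simp: feasible_def intro: le_less_trans)
    then show "intervention_dist F \<and> integrable F (\<lambda>c. \<Sum>m\<in>UNIV. \<bar>c $ m\<bar>) \<and>
      (\<integral>c. (\<Sum>m\<in>UNIV. \<bar>c $ m\<bar>) \<partial>F) \<le> \<rho>"
      using True f assms nn_integral_eq_integral[OF _ nn] by (auto simp: feasible_def)
  next
    assume "intervention_dist F \<and> integrable F (\<lambda>c. \<Sum>m\<in>UNIV. \<bar>c $ m\<bar>) \<and>
      (\<integral>c. (\<Sum>m\<in>UNIV. \<bar>c $ m\<bar>) \<partial>F) \<le> \<rho>"
    then show "feasible \<rho> F"
      using nn_integral_eq_integral[OF _ nn] by (auto simp: feasible_def ennreal_leI)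
  qed
qed (simp add: feasible_def)

text \<open>Integrating the pointwise bounds gives the value V = sum of k plus h times the budget as
  an upper bound. The law F0 shows that V is attained, so being optimal means having value V, and
  then every inequality used along the way is an equality.\<close>

lemma budget_duality:
  fixes \<phi> :: "'m::finite \<Rightarrow> real \<Rightarrow> real" and F0 :: "(real ^ 'm) measure"
  assumes \<rho>: "0 \<le> \<rho>" and h: "0 < h"
    and meas: "\<And>m. \<phi> m \<in> borel_measurable borel" and bnd: "\<And>m c. \<bar>\<phi> m c\<bar> \<le> K"
    and le: "\<And>m c. \<phi> m c \<le> k m + h * \<bar>c\<bar>"
    and eq: "\<And>m c. \<phi> m c = k m + h * \<bar>c\<bar> \<longleftrightarrow> c \<in> E m"
  defines "J \<equiv> \<lambda>F. (\<integral>c. (\<Sum>m\<in>UNIV. \<phi> m (c $ m)) \<partial>F)"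
    and "opt \<equiv> \<lambda>F. intervention_dist F \<and> (AE c in F. \<forall>m. c $ m \<in> E m) \<and>
      integrable F (\<lambda>c. \<Sum>m\<in>UNIV. \<bar>c $ m\<bar>) \<and> (\<integral>c. (\<Sum>m\<in>UNIV. \<bar>c $ m\<bar>) \<partial>F) = \<rho>"
  assumes F0: "opt F0"
  shows "feasible \<rho> F \<and> (\<forall>F'. feasible \<rho> F' \<longrightarrow> J F' \<le> J F) \<longleftrightarrow> opt F"
proof -
  let ?n = "\<lambda>c :: real ^ 'm. \<Sum>m\<in>UNIV. \<bar>c $ m\<bar>"
  let ?\<phi> = "\<lambda>c :: real ^ 'm. \<Sum>m\<in>UNIV. \<phi> m (c $ m)"
  let ?V = "(\<Sum>m\<in>UNIV. k m) + h * \<rho>"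
  have int\<phi>: "integrable F ?\<phi>" if "intervention_dist F" for F
  proof -
    interpret prob_space F by (rule intervention_distD(1)[OF that])
    have "(\<lambda>c :: real ^ 'm. \<phi> m (c $ m)) \<in> borel_measurable borel" for m
      by (rule measurable_compose[OF borel_measurable_coord meas])
    then have "integrable F (\<lambda>c. \<phi> m (c $ m))" for m
      by (intro integrable_const_bound[where B = K] borel_measurable_intervention[OF that]) (auto simp: bnd)
    then show ?thesis by auto
  qed
  have pt: "?\<phi> c \<le> (\<Sum>m\<in>UNIV. k m) + h * ?n c" for c
    using sum_mono[of UNIV "\<lambda>m. \<phi> m (c $ m)" "\<lambda>m. k m + h * \<bar>c $ m\<bar>"] le
    by (simp add: sum.distrib sum_distrib_left)
  have pt_eq: "\<forall>m. c $ m \<in> E m" if "?\<phi> c = (\<Sum>m\<in>UNIV. k m) + h * ?n c" for c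
  proof -
    have "(\<Sum>m\<in>UNIV. k m + h * \<bar>c $ m\<bar> - \<phi> m (c $ m)) = 0"
      using that by (simp add: sum.distrib sum_distrib_left sum_subtractf)
    then have "\<forall>m\<in>UNIV. k m + h * \<bar>c $ m\<bar> - \<phi> m (c $ m) = 0"
      using le by (subst (asm) sum_nonneg_eq_0_iff) auto
    then show ?thesis using eq by (metis UNIV_I eq_iff_diff_eq_0)
  qed
  have upper: "J F \<le> ?V" and attained: "J F = ?V \<Longrightarrow> opt F" if f: "feasible \<rho> F" for F
  proof -
    have F: "intervention_dist F" and i: "integrable F ?n" and n: "(\<integral>c. ?n c \<partial>F) \<le> \<rho>"
      using f feasible_iff[OF \<rho>] by auto
    interpret prob_space F by (rule intervention_distD(1)[OF F])
    have ik: "integrable F (\<lambda>c. (\<Sum>m\<in>UNIV. k m) + h * ?n c)" using i by auto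
    have R: "(\<integral>c. (\<Sum>m\<in>UNIV. k m) + h * ?n c \<partial>F) = (\<Sum>m\<in>UNIV. k m) + h * (\<integral>c. ?n c \<partial>F)"
      by (subst Bochner_Integration.integral_add) (use i in \<open>auto simp: prob_space simp del: Bochner_Integration.integral_sum\<close>)
    have hn: "h * (\<integral>c. ?n c \<partial>F) \<le> h * \<rho>" using h n by simp
    have J: "J F \<le> (\<Sum>m\<in>UNIV. k m) + h * (\<integral>c. ?n c \<partial>F)"
      unfolding J_def R[symmetric] by (rule integral_mono[OF int\<phi>[OF F] ik]) (rule pt)
    then show "J F \<le> ?V" using hn by linarith
    assume V: "J F = ?V"
    \<comment> \<open>Slack in the budget would lower the bound by a positive multiple h of the
      slack, so an optimum exhausts the budget.\<close>
    have "h * (\<integral>c. ?n c \<partial>F) = h * \<rho>" using V J hn by linarith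
    then have n': "(\<integral>c. ?n c \<partial>F) = \<rho>" using h by (metis mult_left_cancel less_irrefl)
    have "integrable F (\<lambda>c. (\<Sum>m\<in>UNIV. k m) + h * ?n c - ?\<phi> c)"
      by (rule Bochner_Integration.integrable_diff[OF ik int\<phi>[OF F]])
    moreover have "(\<integral>c. (\<Sum>m\<in>UNIV. k m) + h * ?n c - ?\<phi> c \<partial>F) = 0"
      using V n' unfolding J_def by (subst Bochner_Integration.integral_diff[OF ik int\<phi>[OF F]]) (simp add: R)
    ultimately have "AE c in F. (\<Sum>m\<in>UNIV. k m) + h * ?n c - ?\<phi> c = 0"
      using pt by (subst (asm) integral_nonneg_eq_0_iff_AE) auto
    then have "AE c in F. \<forall>m. c $ m \<in> E m"
      by eventually_elim (rule pt_eq, simp)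
    then show "opt F" using F i n' by (simp add: opt_def)
  qed
  have opt: "feasible \<rho> F \<and> J F = ?V" if o: "opt F" for F
  proof -
    have F: "intervention_dist F" and i: "integrable F ?n" and n: "(\<integral>c. ?n c \<partial>F) = \<rho>"
      and AE: "AE c in F. \<forall>m. c $ m \<in> E m"
      using o by (auto simp: opt_def)
    interpret prob_space F by (rule intervention_distD(1)[OF F])
    have ik: "integrable F (\<lambda>c. (\<Sum>m\<in>UNIV. k m) + h * ?n c)" using i by auto
    have "J F = (\<integral>c. (\<Sum>m\<in>UNIV. k m) + h * ?n c \<partial>F)"
      unfolding J_def
    proof (rule integral_cong_AE)
      show "AE c in F. ?\<phi> c = (\<Sum>m\<in>UNIV. k m) + h * ?n c"
        using AE
      proof eventually_elim
        case (elim c)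
        then have "\<phi> m (c $ m) = k m + h * \<bar>c $ m\<bar>" for m using eq by blast
        then show ?case by (simp add: sum.distrib sum_distrib_left)
      qed
    qed (use int\<phi>[OF F] ik in auto)
    also have "\<dots> = ?V"
      by (subst Bochner_Integration.integral_add) (use i n in \<open>auto simp: prob_space simp del: Bochner_Integration.integral_sum\<close>)
    finally show ?thesis using F i n feasible_iff[OF \<rho>] by auto
  qed
  show ?thesis using upper attained opt[OF F0] opt[of F] by (metis order_antisym)
qed

subsection \<open>Optimal interventions on one battlefield\<close>

lemma P_eq_bounds:
  assumes "0 < b" "b \<le> a" shows "0 \<le> P_eq a b c" "P_eq a b c \<le> 1"
proof -
  have "prob_space (X_eq a b c)" "prob_space (Y_eq a b c)"
    using X_eq_dist[OF assms] Y_eq_dist[OF assms] by (auto simp: nonneg_dist_with_mean_def)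
  then interpret pair_prob_space "X_eq a b c" "Y_eq a b c"
    by (simp add: pair_prob_space_def pair_sigma_finite_def prob_space_imp_sigma_finite)
  show "0 \<le> P_eq a b c" "P_eq a b c \<le> 1" by (auto simp: P_eq_def win_prob_def)
qed

lemma borel_measurable_P_eq:
  assumes "0 < b" "b \<le> a" shows "P_eq a b \<in> borel_measurable borel"
proof -
  have "P_eq a b = (\<lambda>c. if r_thr a b \<le> c then decay a b c
       else if 0 \<le> c then 1 - b / (2 * (a - c)) else 1 - decay b a (- c))"
    using P_eq_formula[OF assms] by (auto simp: fun_eq_iff)
  also have "\<dots> \<in> borel_measurable borel"
    unfolding decay_def bid_ratio_def by measurable
  finally show ?thesis .
qed

lemma P_eq_neg:
  assumes "0 < b" "b \<le> a" "0 \<le> t" shows "P_eq a b (- t) = 1 - decay b a t"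
proof (cases "t = 0")
  case True
  then show ?thesis using P_eq_0[OF assms(1,2)] by (simp add: decay_def)
next
  case False
  then show ?thesis
    using P_eq_formula[OF assms(1,2), of "- t"] r_thr_props(1)[OF assms(1,2)] assms(3) by simp
qed

text \<open>A positive intervention never helps A; this rules out positive coordinates when A is
  favoured.\<close>

lemma P_plus_nonneg:
  assumes ab: "0 < b" "b \<le> a" and c: "0 \<le> c" shows "0 \<le> P_plus a b c"
proof -
  note r = r_thr_props[OF ab]
  have low: "0 \<le> P_plus a b c" if "0 \<le> c" "c \<le> r_thr a b" for c
    using P_plus_low[OF ab that] that r(3) ab by simp
  show ?thesis
  proof (cases "c \<le> r_thr a b")
    case False
    have "decay a b c \<le> decay a b (r_thr a b)" by (rule decay_mono) (use ab r(1) False in auto)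
    then have "P_plus a b (r_thr a b) \<le> P_plus a b c" using P_plus_high[OF ab] False by simp
    then show ?thesis using low[of "r_thr a b"] r(1) by simp
  qed (use low c in simp)
qed

lemma is_p_iff: "is_p v a b l p \<longleftrightarrow> 1 \<le> p \<and> quartic p = 4 * v * b / (l * a\<^sup>2)"
  by (simp add: is_p_def quartic_def)

lemma is_q_iff: "is_q v a b h q \<longleftrightarrow> bid_ratio b (tau a b) \<le> q \<and> quartic q = 4 * v * a / (h * b\<^sup>2)"
  by (simp add: is_q_def quartic_def bid_ratio_def)

text \<open>Translates "the price is below the marginal value at t" into the hypothesis of
  \<open>quartic_ex1\<close>.\<close>

lemma quartic_bid_ratio_le:
  assumes "0 < v" "0 < A" "0 < B" "0 \<le> t" "0 < h" "h \<le> v * decay_rate A B t"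
  shows "quartic (bid_ratio B t) \<le> 4 * v * A / (h * B\<^sup>2)"
proof -
  define Q where "Q = quartic (bid_ratio B t)"
  have Q: "0 < Q" using bid_ratio_ge_1[OF assms(3,4)] by (simp add: quartic_def Q_def)
  have "h * (B\<^sup>2 * Q) \<le> v * decay_rate A B t * (B\<^sup>2 * Q)"
    using assms(6) Q by (intro mult_right_mono) auto
  also have "\<dots> = 4 * v * A"
    using Q assms(3) by (simp add: decay_rate_def quartic_def[symmetric] Q_def[symmetric])
  finally show ?thesis using assms(3,5) by (simp add: Q_def[symmetric] pos_le_divide_eq mult_ac)
qed

lemma f_thr_eq: "f_thr v a b = v * decay_rate b a 0"
  by (simp add: f_thr_def decay_rate_def)

text \<open>The roles of a and b are exchanged because negative interventions are governed by
  \<open>decay b a\<close>. At the threshold itself the demand is 0, so moving that point from one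
  branch to the other changes nothing and gives the same shape as for
  \<open>g_alloc\<close>.\<close>

lemma f_alloc_props:
  assumes v: "0 < v" and ab: "0 < b" "b \<le> a" and l: "0 < l"
  shows "l < f_thr v a b \<Longrightarrow> \<exists>!p. is_p v a b l p"
    and "f_alloc v a b l = (if l > f_thr v a b then 0 else - demand v b a l)"
proof -
  have a: "0 < a" using ab by simp
  have *: "(\<exists>!p. is_p v a b l p) \<and> p_sol v a b l = quartic_root (4 * v * b / (l * a\<^sup>2))" if "l < f_thr v a b"
    using quartic_ex1[of 1 "4 * v * b / (l * a\<^sup>2)"] quartic_bid_ratio_le[OF v ab(1) a order_refl l]
      that by (simp add: f_thr_eq is_p_iff p_sol_def)
  then show "l < f_thr v a b \<Longrightarrow> \<exists>!p. is_p v a b l p" by blast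
  have "demand v b a (f_thr v a b) = 0" unfolding f_thr_eq by (rule demand_decay_rate[OF v ab(1) a]) simp
  then show "f_alloc v a b l = (if l > f_thr v a b then 0 else - demand v b a l)"
    using * unfolding f_alloc_def by (auto simp: demand_def)
qed

lemma g_alloc_props:
  assumes v: "0 < v" and ab: "0 < b" "b \<le> a" and h: "0 < h"
  shows "h < g_thr v a b \<Longrightarrow> \<exists>!q. is_q v a b h q"
    and "g_alloc v a b h = (if h > g_thr v a b then {0} else if h = g_thr v a b then {0..tau a b}
      else {demand v a b h})"
proof -
  have a: "0 < a" using ab by simp
  note \<tau> = tau_props[OF ab]
  have *: "(\<exists>!q. is_q v a b h q) \<and> q_sol v a b h = quartic_root (4 * v * a / (h * b\<^sup>2))" if "h < g_thr v a b"
    using quartic_ex1[of "bid_ratio b (tau a b)" "4 * v * a / (h * b\<^sup>2)"]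
      quartic_bid_ratio_le[OF v a ab(1) \<tau>(3) h] bid_ratio_ge_1[OF ab(1) \<tau>(3)]
      that by (simp add: \<tau>(5) is_q_iff q_sol_def)
  then show "h < g_thr v a b \<Longrightarrow> \<exists>!q. is_q v a b h q" by blast
  show "g_alloc v a b h = (if h > g_thr v a b then {0} else if h = g_thr v a b then {0..tau a b}
      else {demand v a b h})"
    using * unfolding g_alloc_def by (auto simp: demand_def)
qed

text \<open>The marginal value at x is itself a price at which x is demanded;
  \<open>clearing_price\<close> uses this to make demand unbounded.\<close>

lemma demand_reaches:
  assumes "0 < v" "0 < A" "0 < B" "0 \<le> t" "t \<le> x"
  shows "\<exists>h>0. h \<le> v * decay_rate A B t \<and> x \<le> demand v A B h"
proof (intro exI conjI)
  show "0 < v * decay_rate A B x" using decay_rate_pos assms by simp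
  show "v * decay_rate A B x \<le> v * decay_rate A B t"
    using decay_rate_less[of A B t x] assms by (cases "t = x") auto
  show "x \<le> demand v A B (v * decay_rate A B x)"
    using demand_decay_rate[of v A B x] assms by simp
qed

text \<open>The amount z = -f satisfies the optimality conditions for the price l: its marginal
  value is at most l, with equality unless z = 0. Strict concavity of \<open>P_eq\<close> on the
  nonpositive axis turns them into a strict inequality there, and positive c gains nothing while
  costing budget.\<close>

lemma f_alloc_tangent:
  assumes v: "0 < v" and ab: "0 < b" "b \<le> a" and l: "0 < l"
  defines "f \<equiv> f_alloc v a b l"
  shows "f \<le> 0"
    and "v * P_eq a b c \<le> (v * P_eq a b f - l * \<bar>f\<bar>) + l * \<bar>c\<bar>"
    and "v * P_eq a b c = (v * P_eq a b f - l * \<bar>f\<bar>) + l * \<bar>c\<bar> \<longleftrightarrow> c = f"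
proof -
  have a: "0 < a" using ab by simp
  define z where "z = - f"
  have z: "0 \<le> z \<and> v * decay_rate b a z \<le> l \<and> (z = 0 \<or> v * decay_rate b a z = l)"
  proof (cases "l > f_thr v a b")
    case True
    then show ?thesis using f_alloc_props(2)[OF v ab l] by (simp add: z_def f_def f_thr_eq)
  next
    case False
    then have "z = demand v b a l" using f_alloc_props(2)[OF v ab l] by (simp add: z_def f_def)
    then show ?thesis
      using decay_rate_demand[OF v ab(1) a order_refl l] False by (simp add: f_thr_eq)
  qed
  then show f0: "f \<le> 0" by (simp add: z_def)
  have fz: "f = - z" by (simp add: z_def)
  have neg: "v * P_eq a b (- t) < (v * P_eq a b f - l * z) + l * t" if t: "0 \<le> t" "t \<noteq> z" for t
  proof -
    have "decay b a z - decay_rate b a z * (t - z) < decay b a t"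
      using decay_tangent[OF ab(1) a _ t] z by simp
    then have "v * (decay b a z - decay_rate b a z * (t - z)) < v * decay b a t" using v by simp
    moreover have "v * (decay b a z - decay_rate b a z * (t - z)) = v * decay b a z - v * decay_rate b a z * (t - z)"
      by (simp add: algebra_simps)
    \<comment> \<open>Either the slope equals l, or z = 0 and the factor t - z is
      nonnegative.\<close>
    moreover have "v * decay_rate b a z * (t - z) \<le> l * (t - z)"
      using z t(1) by (auto intro: mult_right_mono)
    moreover have "l * (t - z) = l * t - l * z" by (simp add: algebra_simps)
    moreover have "v * P_eq a b (- t) = v - v * decay b a t" "v * P_eq a b (- z) = v - v * decay b a z"
      using P_eq_neg[OF ab t(1)] P_eq_neg[OF ab, of z] z by (simp_all add: right_diff_distrib)
    ultimately show ?thesis unfolding fz by linarith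
  qed
  have lt: "v * P_eq a b c < (v * P_eq a b f - l * z) + l * \<bar>c\<bar>" if "c \<noteq> f" for c
  proof (cases "c \<le> 0")
    case True
    then show ?thesis using neg[of "- c"] that by (simp add: fz)
  next
    case False
    have "v * P_eq a b c \<le> v * P_eq a b 0"
      using P_plus_nonneg[OF ab, of c] False v by (simp add: P_plus_def)
    also have "\<dots> \<le> v * P_eq a b f - l * z"
      using neg[of 0] by (cases "z = 0") (auto simp: fz)
    also have "\<dots> < v * P_eq a b f - l * z + l * \<bar>c\<bar>" using False l by simp
    finally show ?thesis .
  qed
  have zf: "\<bar>f\<bar> = z" using z by (simp add: fz)
  show "v * P_eq a b c \<le> (v * P_eq a b f - l * \<bar>f\<bar>) + l * \<bar>c\<bar>"
    and "v * P_eq a b c = (v * P_eq a b f - l * \<bar>f\<bar>) + l * \<bar>c\<bar> \<longleftrightarrow> c = f"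
    using lt[of c] zf by (cases "c = f"; simp)+
qed

text \<open>The contact set of the price line with \<open>v * P_plus\<close>. At the breakpoint it
  contains only the ends of the interval in \<open>g_alloc\<close>; intermediate allocations arise
  as means of laws on these two points.\<close>

definition g_support :: "real \<Rightarrow> real \<Rightarrow> real \<Rightarrow> real \<Rightarrow> real set" where
  "g_support v a b h = (if h > g_thr v a b then {0} else if h = g_thr v a b then {0, tau a b}
     else {demand v a b h})"

lemma demand_gt_tau:
  assumes v: "0 < v" and ab: "0 < b" "b \<le> a" and h: "0 < h" "h < g_thr v a b"
  shows "tau a b < demand v a b h" "v * decay_rate a b (demand v a b h) = h"
proof -
  have a: "0 < a" using ab by simp
  note \<tau> = tau_props[OF ab]
  show "v * decay_rate a b (demand v a b h) = h"
    using decay_rate_demand(2)[OF v a ab(1) \<tau>(3) h(1)] h(2) by (simp add: \<tau>(5))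
  show "tau a b < demand v a b h"
    using demand_less[OF v a ab(1) h] demand_decay_rate[OF v a ab(1) \<tau>(3)] by (simp add: \<tau>(5))
qed

text \<open>Below the breakpoint price the bounding line is the tangent at the demanded point, which
  lies beyond \<open>tau\<close>. From the breakpoint price on it passes through the origin and is
  at least as steep as the chord, so the intercept is 0.\<close>

lemma g_support_tangent:
  assumes v: "0 < v" and ab: "0 < b" "b \<le> a" and h: "0 < h"
  shows "\<exists>k. \<forall>c. v * P_plus a b c \<le> k + h * \<bar>c\<bar> \<and>
    (v * P_plus a b c = k + h * \<bar>c\<bar> \<longleftrightarrow> c \<in> g_support v a b h)"
proof (cases "h < g_thr v a b")
  case True
  define z where "z = demand v a b h"
  have z: "tau a b < z" "v * decay_rate a b z = h"
    unfolding z_def by (rule demand_gt_tau[OF v ab h True])+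
  have "0 \<le> z" using z(1) tau_props(3)[OF ab] by simp
  have P0: "P_plus a b 0 = 0" by (simp add: P_plus_def)
  define k where "k = v * P_plus a b z - h * z"
  have lt: "v * P_plus a b c < k + h * c" if "0 \<le> c" "c \<noteq> z" for c
  proof -
    have "v * P_plus a b c < v * (P_plus a b z + decay_rate a b z * (c - z))"
      using P_plus_tangent_beyond_tau[OF ab z(1) that] v by simp
    also have "\<dots> = v * P_plus a b z + (v * decay_rate a b z) * (c - z)" by (simp add: algebra_simps)
    finally show ?thesis unfolding z(2) by (simp add: k_def algebra_simps)
  qed
  \<comment> \<open>The tangent dominates \<open>P_plus\<close> also at c = 0, so its intercept is
    nonnegative and the bound extends to negative c.\<close>
  have k: "0 \<le> k" using lt[of 0] P0 \<open>0 \<le> z\<close> z(1) tau_props(3)[OF ab] by simp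
  have "v * P_plus a b c \<le> k + h * \<bar>c\<bar> \<and> (v * P_plus a b c = k + h * \<bar>c\<bar> \<longleftrightarrow> c = z)" for c
  proof (cases "c < 0")
    case True
    have "v * P_plus a b c \<le> 0" using P_plus_neg[OF ab True] v by (simp add: mult_nonneg_nonpos)
    moreover have "0 < h * \<bar>c\<bar>" by (rule mult_pos_pos) (use h True in auto)
    ultimately have "v * P_plus a b c < k + h * \<bar>c\<bar>" using k by linarith
    then show ?thesis using True \<open>0 \<le> z\<close> by auto
  next
    case False
    then show ?thesis using lt[of c] \<open>0 \<le> z\<close> by (cases "c = z") (auto simp: k_def)
  qed
  then show ?thesis using True by (auto simp: g_support_def z_def[symmetric])
next
  case False
  let ?s = "decay_rate a b (tau a b)"
  have s: "v * ?s \<le> h" using False tau_props(5)[OF ab, of v] by simp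
  have "v * P_plus a b c \<le> h * \<bar>c\<bar> \<and> (v * P_plus a b c = h * \<bar>c\<bar> \<longleftrightarrow> c \<in> g_support v a b h)" for c
  proof (cases "c < 0")
    case True
    have "v * P_plus a b c \<le> 0" using P_plus_neg[OF ab True] v by (simp add: mult_nonneg_nonpos)
    moreover have "0 < h * \<bar>c\<bar>" by (rule mult_pos_pos) (use h True in auto)
    ultimately have "v * P_plus a b c < h * \<bar>c\<bar>" by linarith
    then show ?thesis using True tau_props(3)[OF ab] False by (auto simp: g_support_def)
  next
    case c: False
    have le: "v * P_plus a b c \<le> v * (?s * c)" using P_plus_le_chord(1)[OF ab, of c] c v by simp
    have eq: "v * P_plus a b c = v * (?s * c) \<longleftrightarrow> c = 0 \<or> c = tau a b"
      using P_plus_le_chord(2)[OF ab, of c] c v by simp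
    have le': "v * ?s * c \<le> h * c" using s c by (intro mult_right_mono) auto
    show ?thesis
    proof (cases "h = v * ?s")
      case True
      then show ?thesis using le eq c tau_props(5)[OF ab, of v] by (simp add: g_support_def mult_ac)
    next
      case False
      then have "v * ?s < h" using s by simp
      show ?thesis
      proof (cases "c = 0")
        case True
        then show ?thesis
          using \<open>v * ?s < h\<close> tau_props(5)[OF ab, of v] by (simp add: g_support_def P_plus_def)
      next
        case c0: False
        then have "v * ?s * c < h * c" using c \<open>v * ?s < h\<close> by simp
        then have "v * P_plus a b c < h * \<bar>c\<bar>" using le c by (simp add: mult.assoc)
        then show ?thesis
          using c0 \<open>v * ?s < h\<close> tau_props(5)[OF ab, of v] by (simp add: g_support_def)
      qed
    qed
  qed
  then show ?thesis by (intro exI[of _ 0]) simp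
qed

text \<open>Translates the almost-sure description of optima into the form of the theorem: the
  allocation chosen from \<open>g_alloc\<close> is the mean of the coordinate, and it determines the
  marginal.\<close>

lemma g_support_marginal:
  fixes F :: "(real ^ 'm::finite) measure"
  assumes F: "intervention_dist F" and v: "0 < v" and ab: "0 < b" "b \<le> a" and h: "0 < h"
  shows "AE c in F. c $ m \<in> g_support v a b h \<Longrightarrow>
      integrable F (\<lambda>c. c $ m) \<and> (AE c in F. 0 \<le> c $ m) \<and>
      (\<integral>c. c $ m \<partial>F) \<in> g_alloc v a b h \<and> marginal F m = two_point (tau a b) (\<integral>c. c $ m \<partial>F)"
    and "x \<in> g_alloc v a b h \<Longrightarrow> marginal F m = two_point (tau a b) x \<Longrightarrow>
      (AE c in F. c $ m \<in> g_support v a b h) \<and> (\<integral>c. c $ m \<partial>F) = x"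
proof -
  interpret prob_space F by (rule intervention_distD(1)[OF F])
  note \<tau> = tau_props(3)[OF ab] and g = g_alloc_props(2)[OF v ab h]
  have const: "integrable F (\<lambda>c. c $ m) \<and> (\<integral>c. c $ m \<partial>F) = z" if "AE c in F. c $ m = z" for z
  proof -
    have "(\<integral>c. c $ m \<partial>F) = (\<integral>c. z \<partial>F)"
      by (rule integral_cong_AE) (use that coord_measurable[OF F] in auto)
    moreover have "integrable F (\<lambda>c. c $ m)"
      by (rule integrable_const_bound[where B = "\<bar>z\<bar>"])
         (use that coord_measurable[OF F] in \<open>auto elim!: eventually_mono\<close>)
    ultimately show ?thesis by (simp add: prob_space)
  qed
  show "integrable F (\<lambda>c. c $ m) \<and> (AE c in F. 0 \<le> c $ m) \<and>
      (\<integral>c. c $ m \<partial>F) \<in> g_alloc v a b h \<and> marginal F m = two_point (tau a b) (\<integral>c. c $ m \<partial>F)"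
    if AE: "AE c in F. c $ m \<in> g_support v a b h"
  proof (cases "h < g_thr v a b")
    case True
    define z where "z = demand v a b h"
    have z: "tau a b < z" unfolding z_def by (rule demand_gt_tau(1)[OF v ab h True])
    have AE': "AE c in F. c $ m = z" using AE True by (simp add: g_support_def z_def)
    have "AE c in F. 0 \<le> c $ m" using AE' by eventually_elim (use z \<tau> in simp)
    moreover have "marginal F m = dirac z" using AE' marginal_dirac_iff[OF F] by blast
    ultimately show ?thesis using const[OF AE'] z True by (simp add: g z_def two_point_def)
  next
    case False
    then have AE': "AE c in F. c $ m = 0 \<or> c $ m = tau a b"
      using AE by (auto simp: g_support_def split: if_splits elim!: eventually_mono)
    have "AE c in F. 0 \<le> c $ m" using AE' by eventually_elim (use \<tau> in auto)
    moreover have "(\<integral>c. c $ m \<partial>F) \<in> g_alloc v a b h"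
    proof (cases "h = g_thr v a b")
      case True
      then show ?thesis using two_point_mean_bounds[OF F \<tau> AE'] unfolding g by (simp add: True[symmetric])
    next
      case h: False
      have "AE c in F. c $ m = 0" using AE h False by (simp add: g_support_def)
      then show ?thesis using const[of 0] h False by (simp add: g)
    qed
    ultimately show ?thesis
      using two_point_mean_bounds[OF F \<tau> AE'] marginal_two_point_iff[OF F, of "\<integral>c. c $ m \<partial>F" "tau a b" m] AE'
      by auto
  qed
  assume x: "x \<in> g_alloc v a b h" and marg: "marginal F m = two_point (tau a b) x"
  show "(AE c in F. c $ m \<in> g_support v a b h) \<and> (\<integral>c. c $ m \<partial>F) = x"
  proof (cases "h < g_thr v a b")
    case True
    define z where "z = demand v a b h"
    have z: "tau a b < z" unfolding z_def by (rule demand_gt_tau(1)[OF v ab h True])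
    have "x = z" using x True by (simp add: g z_def)
    then have "AE c in F. c $ m = z" using marg z marginal_dirac_iff[OF F] by (simp add: two_point_def)
    then show ?thesis using const True \<open>x = z\<close> by (auto simp: g_support_def z_def)
  next
    case False
    then have x': "0 \<le> x" "x \<le> tau a b" using x \<tau> by (auto simp: g split: if_splits)
    have *: "AE c in F. c $ m = 0 \<or> c $ m = tau a b" "(\<integral>c. c $ m \<partial>F) = x"
      using marginal_two_point_iff[OF F x', of m] marg by auto
    \<comment> \<open>Above the breakpoint price the contact set is {0} alone, whereas the two-point
      description allows {0, tau}; a nonnegative coordinate with mean 0 closes the gap.\<close>
    have "AE c in F. c $ m = 0" if "x = 0"
    proof -
      have "AE c in F. 0 \<le> c $ m" using *(1) by eventually_elim (use \<tau> in auto)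
      then show ?thesis
        using integral_nonneg_eq_0_iff_AE[OF two_point_mean_bounds(1)[OF F \<tau> *(1)]] *(2) that by simp
    qed
    then show ?thesis using * False x by (auto simp: g_support_def g split: if_splits)
  qed
qed

section \<open>Reduction to the regulator's optimisation problem\<close>

lemma payoff_C_eq:
  fixes v a b :: "'m::finite \<Rightarrow> real"
  assumes ab: "\<And>m. 0 < b m" "\<And>m. b m \<le> a m" and F: "intervention_dist F"
  shows "integrable F (\<lambda>c. v m * P_eq (a m) (b m) (c $ m))"
    and "payoff_C v wA wB F (SX_eq a b) (SY_eq a b) =
      wB + (wA - wB) * (\<integral>c. (\<Sum>m\<in>UNIV. v m * P_eq (a m) (b m) (c $ m)) \<partial>F)"
proof -
  interpret prob_space F by (rule intervention_distD(1)[OF F])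
  have "(\<lambda>c :: real ^ 'm. P_eq (a m) (b m) (c $ m)) \<in> borel_measurable borel" for m
    by (rule measurable_compose[OF borel_measurable_coord borel_measurable_P_eq[OF ab]])
  then have "integrable F (\<lambda>c. P_eq (a m) (b m) (c $ m))" for m
    using P_eq_bounds[OF ab]
    by (intro integrable_const_bound[where B = 1] borel_measurable_intervention[OF F]) auto
  then show i: "integrable F (\<lambda>c. v m * P_eq (a m) (b m) (c $ m))" for m by simp
  let ?W = "\<lambda>c :: real ^ 'm. \<Sum>m\<in>UNIV. v m * P_eq (a m) (b m) (c $ m)"
  have W: "integrable F ?W" using i by (intro Bochner_Integration.integrable_sum)
  have "payoff_C v wA wB F (SX_eq a b) (SY_eq a b) = (\<integral>c. wB + (wA - wB) * ?W c \<partial>F)"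
    unfolding payoff_C_def payoff_B_def payoff_A_def SX_eq_def SY_eq_def P_eq_def[symmetric]
    by (simp add: algebra_simps)
  also have "\<dots> = wB + (wA - wB) * (\<integral>c. ?W c \<partial>F)"
    by (subst Bochner_Integration.integral_add) (use W in \<open>auto simp: prob_space simp del: Bochner_Integration.integral_sum\<close>)
  finally show "payoff_C v wA wB F (SX_eq a b) (SY_eq a b) = wB + (wA - wB) * (\<integral>c. ?W c \<partial>F)" .
qed

text \<open>The followers are in equilibrium after every intervention, so only the regulator's
  optimality remains, and the payoff depends on F through A's expected share W alone.\<close>

lemma is_NSE_iff:
  fixes v a b :: "'m::finite \<Rightarrow> real"
  assumes v: "\<And>m. 0 < v m" and ab: "\<And>m. 0 < b m" "\<And>m. b m \<le> a m"
  defines "W \<equiv> \<lambda>F. (\<integral>c. (\<Sum>m\<in>UNIV. v m * P_eq (a m) (b m) (c $ m)) \<partial>F)"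
  shows "is_NSE v a b wA wB \<rho> F (SX_eq a b) (SY_eq a b) \<longleftrightarrow>
    feasible \<rho> F \<and> (\<forall>F'. feasible \<rho> F' \<longrightarrow> (wA - wB) * W F' \<le> (wA - wB) * W F)"
proof -
  have "payoff_C v wA wB F (SX_eq a b) (SY_eq a b) = wB + (wA - wB) * W F" if "feasible \<rho> F" for F
    using payoff_C_eq(2)[of b a F v wA wB] ab that unfolding W_def feasible_def by simp
  then show ?thesis
    unfolding is_NSE_def using followers_NE_eq[OF v ab] by (auto simp del: mult_le_cancel_left)
qed

subsection \<open>The equilibria of the whole game\<close>

text \<open>With equal weights the payoff does not depend on the intervention, so every feasible law
  is optimal; zero marginals are one such choice, whence an implication and not an
  equivalence.\<close>

lemma NSE_equal_weights:
  fixes v a b :: "'m::finite \<Rightarrow> real"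
  assumes v: "\<And>m. 0 < v m" and ab: "\<And>m. 0 < b m" "\<And>m. b m \<le> a m"
    and F: "intervention_dist F" "\<And>m. marginal F m = dirac 0"
  shows "is_NSE v a b w w \<rho> F (SX_eq a b) (SY_eq a b)"
proof -
  have "AE c in F. c $ m = 0" for m using F marginal_dirac_iff by blast
  then have "AE c in F. \<forall>m\<in>UNIV. c $ m = 0" by (intro AE_finite_allI) auto
  then have "AE c in F. ennreal (\<Sum>m\<in>UNIV. \<bar>c $ m\<bar>) = 0" by eventually_elim simp
  then have "(\<integral>\<^sup>+c. ennreal (\<Sum>m\<in>UNIV. \<bar>c $ m\<bar>) \<partial>F) = (\<integral>\<^sup>+c. 0 \<partial>F)"
    by (rule nn_integral_cong_AE)
  then show ?thesis
    unfolding is_NSE_iff[OF v ab] feasible_def using F(1) by simp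
qed

lemma NSE_favouring_A:
  fixes v a b :: "'m::finite \<Rightarrow> real"
  assumes \<rho>: "0 \<le> \<rho>" and v: "\<And>m. 0 < v m" "\<And>m. v m \<le> K" and ab: "\<And>m. 0 < b m" "\<And>m. b m \<le> a m"
    and w: "wB < wA" and l: "0 < l" "(\<Sum>m\<in>UNIV. - f_alloc (v m) (a m) (b m) l) = \<rho>"
  shows "is_NSE v a b wA wB \<rho> F (SX_eq a b) (SY_eq a b) \<longleftrightarrow>
    intervention_dist F \<and> (\<forall>m. marginal F m = dirac (f_alloc (v m) (a m) (b m) l))"
proof -
  define f where "f m = f_alloc (v m) (a m) (b m) l" for m
  define \<phi> where "\<phi> m c = v m * P_eq (a m) (b m) c" for m c
  let ?n = "\<lambda>c :: real ^ 'm. \<Sum>m\<in>UNIV. \<bar>c $ m\<bar>"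
  let ?opt = "\<lambda>F. intervention_dist F \<and> (AE c in F. \<forall>m. c $ m \<in> {f m}) \<and> integrable F ?n \<and> (\<integral>c. ?n c \<partial>F) = \<rho>"
  have f: "f m \<le> 0" for m unfolding f_def by (rule f_alloc_tangent(1)[OF v(1) ab l(1)])
  have sum_f: "(\<Sum>m\<in>UNIV. \<bar>f m\<bar>) = \<rho>" using l(2) f by (simp add: f_def[symmetric])
  have opt_iff: "?opt F \<longleftrightarrow> intervention_dist F \<and> (\<forall>m. marginal F m = dirac (f m))" for F
  proof (cases "intervention_dist F")
    case F: True
    interpret prob_space F by (rule intervention_distD(1)[OF F])
    have AE: "(\<forall>m. marginal F m = dirac (f m)) \<longleftrightarrow> (AE c in F. \<forall>m. c $ m \<in> {f m})"
      using eventually_ball_finite_distrib[of "UNIV :: 'm set" "\<lambda>c m. c $ m = f m" "ae_filter F"] marginal_dirac_iff[OF F] by simp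
    have "integrable F ?n \<and> (\<integral>c. ?n c \<partial>F) = \<rho>" if "AE c in F. \<forall>m. c $ m \<in> {f m}"
    proof -
      have n: "AE c in F. ?n c = \<rho>" using that by eventually_elim (simp add: sum_f)
      have meas: "?n \<in> borel_measurable F" by (rule borel_measurable_intervention[OF F]) simp
      have "(\<integral>c. ?n c \<partial>F) = (\<integral>c. \<rho> \<partial>F)" by (rule integral_cong_AE) (use n meas in auto)
      moreover have "integrable F ?n"
        by (rule integrable_const_bound[where B = "\<bar>\<rho>\<bar>"]) (use n meas in \<open>auto elim!: eventually_mono\<close>)
      ultimately show ?thesis by (simp add: prob_space)
    qed
    then show ?thesis using AE F by blast
  qed simp
  define F0 where "F0 = return borel (\<chi> m. f m)"
  have F0: "?opt F0"
  proof -
    have "intervention_dist F0" by (simp add: F0_def intervention_dist_def prob_space_return)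
    moreover have "marginal F0 m = dirac (f m)" for m
      unfolding marginal_def F0_def by (subst distr_return) auto
    ultimately show ?thesis unfolding opt_iff by blast
  qed
  have bnd: "\<bar>\<phi> m c\<bar> \<le> K" for m c
  proof -
    have "\<bar>\<phi> m c\<bar> = v m * P_eq (a m) (b m) c"
      using v(1)[of m] P_eq_bounds(1)[OF ab, of m c] by (simp add: \<phi>_def)
    also have "\<dots> \<le> v m * 1" using v(1)[of m] P_eq_bounds(2)[OF ab, of m c] by (intro mult_left_mono) auto
    finally show ?thesis using v(2)[of m] by simp
  qed
  have meas: "\<phi> m \<in> borel_measurable borel" for m
    unfolding \<phi>_def using borel_measurable_P_eq[OF ab] by simp
  define k where "k m = v m * P_eq (a m) (b m) (f m) - l * \<bar>f m\<bar>" for m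
  have le: "\<phi> m c \<le> k m + l * \<bar>c\<bar>" for m c
    unfolding \<phi>_def k_def f_def by (rule f_alloc_tangent(2)[OF v(1) ab l(1)])
  have eq: "\<phi> m c = k m + l * \<bar>c\<bar> \<longleftrightarrow> c \<in> {f m}" for m c
    unfolding \<phi>_def k_def f_def singleton_iff by (rule f_alloc_tangent(3)[OF v(1) ab l(1)])
  have dual: "feasible \<rho> F \<and> (\<forall>F'. feasible \<rho> F' \<longrightarrow>
      (\<integral>c. (\<Sum>m\<in>UNIV. \<phi> m (c $ m)) \<partial>F') \<le> (\<integral>c. (\<Sum>m\<in>UNIV. \<phi> m (c $ m)) \<partial>F)) \<longleftrightarrow> ?opt F"
    by (rule budget_duality[OF \<rho> l(1) meas bnd le eq F0])
  have "is_NSE v a b wA wB \<rho> F (SX_eq a b) (SY_eq a b) \<longleftrightarrow> ?opt F"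
    unfolding is_NSE_iff[OF v(1) ab] dual[symmetric] \<phi>_def using w by (simp add: mult_le_cancel_left)
  then show ?thesis unfolding opt_iff unfolding f_def .
qed

lemma NSE_favouring_B:
  fixes v a b :: "'m::finite \<Rightarrow> real"
  assumes \<rho>: "0 \<le> \<rho>" and v: "\<And>m. 0 < v m" "\<And>m. v m \<le> K" and ab: "\<And>m. 0 < b m" "\<And>m. b m \<le> a m"
    and w: "wA < wB" and h: "0 < h" and sel: "g_selections v a b \<rho> h \<noteq> {}"
  shows "is_NSE v a b wA wB \<rho> F (SX_eq a b) (SY_eq a b) \<longleftrightarrow>
    intervention_dist F \<and> (\<exists>x\<in>g_selections v a b \<rho> h. \<forall>m. marginal F m = two_point (tau (a m) (b m)) (x m))"
proof -
  define E where "E m = g_support (v m) (a m) (b m) h" for m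
  define \<phi> where "\<phi> m c = v m * P_plus (a m) (b m) c" for m c
  let ?n = "\<lambda>c :: real ^ 'm. \<Sum>m\<in>UNIV. \<bar>c $ m\<bar>"
  let ?opt = "\<lambda>F. intervention_dist F \<and> (AE c in F. \<forall>m. c $ m \<in> E m) \<and> integrable F ?n \<and> (\<integral>c. ?n c \<partial>F) = \<rho>"
  have opt_iff: "?opt F \<longleftrightarrow> intervention_dist F \<and>
      (\<exists>x\<in>g_selections v a b \<rho> h. \<forall>m. marginal F m = two_point (tau (a m) (b m)) (x m))" for F
  proof (cases "intervention_dist F")
    case F: True
    note sm = g_support_marginal[OF F v(1) ab h]
    have AE_all: "(AE c in F. \<forall>m. c $ m \<in> E m) \<longleftrightarrow> (\<forall>m. AE c in F. c $ m \<in> E m)"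
      using eventually_ball_finite_distrib[of "UNIV :: 'm set" "\<lambda>c m. c $ m \<in> E m" "ae_filter F"] by simp
    have n: "integrable F ?n \<and> (\<integral>c. ?n c \<partial>F) = (\<Sum>m\<in>UNIV. \<integral>c. c $ m \<partial>F)"
      if "\<forall>m. AE c in F. c $ m \<in> E m"
    proof -
      have i: "integrable F (\<lambda>c. c $ m)" and nn: "AE c in F. 0 \<le> c $ m" for m
        using sm(1) that by (auto simp: E_def)
      have "(\<integral>c. \<bar>c $ m\<bar> \<partial>F) = (\<integral>c. c $ m \<partial>F)" for m
        by (rule integral_cong_AE) (use i[of m] nn[of m] in \<open>auto elim!: eventually_mono\<close>)
      then show ?thesis using i by (simp add: Bochner_Integration.integral_sum)
    qed
    show ?thesis
    proof
      assume o: "?opt F"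
      then have E: "\<forall>m. AE c in F. c $ m \<in> E m" unfolding AE_all by blast
      define x where "x m = (\<integral>c. c $ m \<partial>F)" for m
      have "x \<in> g_selections v a b \<rho> h"
        using n[OF E] o sm(1) E by (auto simp: g_selections_def x_def E_def)
      moreover have "marginal F m = two_point (tau (a m) (b m)) (x m)" for m
        using sm(1) E unfolding x_def E_def by blast
      ultimately show "intervention_dist F \<and>
        (\<exists>x\<in>g_selections v a b \<rho> h. \<forall>m. marginal F m = two_point (tau (a m) (b m)) (x m))"
        using F by blast
    next
      assume "intervention_dist F \<and>
        (\<exists>x\<in>g_selections v a b \<rho> h. \<forall>m. marginal F m = two_point (tau (a m) (b m)) (x m))"
      then obtain x where x: "\<And>m. x m \<in> g_alloc (v m) (a m) (b m) h" "(\<Sum>m\<in>UNIV. x m) = \<rho>"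
        "\<And>m. marginal F m = two_point (tau (a m) (b m)) (x m)"
        by (auto simp: g_selections_def)
      have "(AE c in F. c $ m \<in> E m) \<and> (\<integral>c. c $ m \<partial>F) = x m" for m
        unfolding E_def by (rule sm(2)[OF x(1) x(3)])
      then show "?opt F" using n F x(2) unfolding AE_all by simp
    qed
  qed simp
  \<comment> \<open>The dual bound is attained by coupling the marginals of any selection.\<close>
  have "\<exists>F0. ?opt F0"
  proof -
    obtain x where x: "x \<in> g_selections v a b \<rho> h" using sel by blast
    have "0 \<le> x m" for m
    proof -
      have "x m \<in> g_alloc (v m) (a m) (b m) h" using x by (simp add: g_selections_def)
      moreover have "tau (a m) (b m) < demand (v m) (a m) (b m) h" if "h < g_thr (v m) (a m) (b m)"
        by (rule demand_gt_tau(1)[OF v(1) ab h that])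
      ultimately show ?thesis
        using tau_props(3)[OF ab, of m]
        unfolding g_alloc_props(2)[OF v(1) ab h] by (auto split: if_splits)
    qed
    then show ?thesis
      unfolding opt_iff using exists_two_point_coupling[of x "\<lambda>m. tau (a m) (b m)"] tau_props(3)[OF ab] x by blast
  qed
  then obtain F0 where F0: "?opt F0" by blast
  have "\<forall>m. \<exists>k. \<forall>c. \<phi> m c \<le> k + h * \<bar>c\<bar> \<and> (\<phi> m c = k + h * \<bar>c\<bar> \<longleftrightarrow> c \<in> E m)"
    using g_support_tangent[OF v(1) ab h] unfolding \<phi>_def E_def by blast
  then obtain k where k: "\<And>m c. \<phi> m c \<le> k m + h * \<bar>c\<bar>" "\<And>m c. \<phi> m c = k m + h * \<bar>c\<bar> \<longleftrightarrow> c \<in> E m"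
    by metis
  have bnd: "\<bar>\<phi> m c\<bar> \<le> K" for m c
  proof -
    have "\<bar>P_plus (a m) (b m) c\<bar> \<le> 1"
      using P_eq_bounds[OF ab, of m c] P_eq_bounds[OF ab, of m 0] by (simp add: P_plus_def)
    then have "\<bar>\<phi> m c\<bar> \<le> v m * 1" using v(1)[of m] by (simp add: \<phi>_def abs_mult)
    then show ?thesis using v(2)[of m] by simp
  qed
  have meas: "\<phi> m \<in> borel_measurable borel" for m
    unfolding \<phi>_def P_plus_def using borel_measurable_P_eq[OF ab] by simp
  have dual: "feasible \<rho> F \<and> (\<forall>F'. feasible \<rho> F' \<longrightarrow>
      (\<integral>c. (\<Sum>m\<in>UNIV. \<phi> m (c $ m)) \<partial>F') \<le> (\<integral>c. (\<Sum>m\<in>UNIV. \<phi> m (c $ m)) \<partial>F)) \<longleftrightarrow> ?opt F"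
    by (rule budget_duality[OF \<rho> h meas bnd k F0])
  let ?W = "\<lambda>F. (\<integral>c. (\<Sum>m\<in>UNIV. v m * P_eq (a m) (b m) (c $ m)) \<partial>F)"
  \<comment> \<open>Maximising the total of \<open>P_plus\<close> is minimising A's share, up to the
    constant share without intervention.\<close>
  have J: "(\<integral>c. (\<Sum>m\<in>UNIV. \<phi> m (c $ m)) \<partial>F) = (\<Sum>m\<in>UNIV. v m * P_eq (a m) (b m) 0) - ?W F"
    if "feasible \<rho> F" for F
  proof -
    have F: "intervention_dist F" using that by (simp add: feasible_def)
    interpret prob_space F by (rule intervention_distD(1)[OF F])
    have i: "integrable F (\<lambda>c. \<Sum>m\<in>UNIV. v m * P_eq (a m) (b m) (c $ m))"
      using payoff_C_eq(1)[of b a F v] ab F by (intro Bochner_Integration.integrable_sum) auto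
    have "(\<lambda>c. \<Sum>m\<in>UNIV. \<phi> m (c $ m)) = (\<lambda>c. (\<Sum>m\<in>UNIV. v m * P_eq (a m) (b m) 0) - (\<Sum>m\<in>UNIV. v m * P_eq (a m) (b m) (c $ m)))"
      by (simp add: \<phi>_def P_plus_def right_diff_distrib sum_subtractf)
    then show ?thesis
      using Bochner_Integration.integral_diff[OF integrable_const i, of "\<Sum>m\<in>UNIV. v m * P_eq (a m) (b m) 0"]
      by (simp add: prob_space)
  qed
  have "is_NSE v a b wA wB \<rho> F (SX_eq a b) (SY_eq a b) \<longleftrightarrow> ?opt F"
    unfolding is_NSE_iff[OF v(1) ab] dual[symmetric]
    using w J by (auto simp: mult_le_cancel_left)
  then show ?thesis unfolding opt_iff .
qed

section \<open>Existence and uniqueness of the clearing price\<close>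

lemma budget_price_A:
  fixes v a b :: "'m::finite \<Rightarrow> real"
  assumes \<rho>: "0 \<le> \<rho>" and v: "\<And>m. 0 < v m" and ab: "\<And>m. 0 < b m" "\<And>m. b m \<le> a m"
  defines "S \<equiv> \<lambda>l. (\<Sum>m\<in>UNIV. - f_alloc (v m) (a m) (b m) l)"
  shows "\<exists>l>0. S l = \<rho>" and "0 < \<rho> \<Longrightarrow> \<exists>!l. 0 < l \<and> S l = \<rho>"
proof -
  let ?D = "\<lambda>m. demand (v m) (b m) (a m)" and ?\<theta> = "\<lambda>m. f_thr (v m) (a m) (b m)"
  have a: "0 < a m" for m using ab[of m] by simp
  have \<theta>: "0 < ?\<theta> m" for m using v[of m] ab(1)[of m] a[of m] by (simp add: f_thr_def)
  have D\<theta>: "?D m (?\<theta> m) = 0" for m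
    unfolding f_thr_eq by (rule demand_decay_rate[OF v ab(1) a order_refl])
  have mono: "?D m h' < ?D m h" if "0 < h" "h < h'" for m h h' by (rule demand_less[OF v ab(1) a that])
  \<comment> \<open>With \<open>\<tau>\<close> constantly 0 the interval at the threshold
    degenerates to {0}, so the single-valued demand is an instance of the set-valued one.\<close>
  have sel: "- f_alloc (v m) (a m) (b m) l \<in> (if l > ?\<theta> m then {0} else if l = ?\<theta> m then {0..0} else {?D m l})"
    if "0 < l" for m l
    unfolding f_alloc_props(2)[OF v ab that] using D\<theta>[of m] by auto
  have unique: "l = l'" if "0 < \<rho>" "0 < l" "S l = \<rho>" "0 < l'" "S l' = \<rho>" for l l'
    by (rule clearing_price_unique[where D = ?D and \<theta> = ?\<theta> and \<tau> = "\<lambda>_. 0", OF that(1) order_refl D\<theta> mono that(2,4)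
          sel[OF that(2)] _ sel[OF that(4)]])
       (use that in \<open>simp_all add: S_def\<close>)
  show ex: "\<exists>l>0. S l = \<rho>"
  proof (cases "\<rho> = 0")
    \<comment> \<open>With no budget to spend, any price that reaches every threshold clears; the
      sum of the thresholds is a convenient one.\<close>
    case True
    have "?\<theta> m \<le> (\<Sum>m\<in>UNIV. ?\<theta> m)" for m using \<theta> by (intro member_le_sum) (auto simp: less_imp_le)
    moreover have "0 < (\<Sum>m\<in>UNIV. ?\<theta> m)" using \<theta> by (intro sum_pos) auto
    ultimately show ?thesis using True by (intro exI[of _ "\<Sum>m\<in>UNIV. ?\<theta> m"]) (simp add: S_def f_alloc_def)
  next
    case False
    then have \<rho>': "0 < \<rho>" using \<rho> by simp
    have "\<exists>l>0. \<exists>x. (\<forall>m. x m \<in> (if l > ?\<theta> m then {0} else if l = ?\<theta> m then {0..0} else {?D m l})) \<and>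
        (\<Sum>m\<in>UNIV. x m) = \<rho>"
      by (rule clearing_price[where D = ?D and \<tau> = "\<lambda>_. 0", OF \<rho>' \<theta> order_refl D\<theta> mono continuous_on_demand[OF v ab(1) a]])
         (use demand_reaches[OF v ab(1) a order_refl] in \<open>simp_all add: f_thr_eq\<close>)
    then obtain l x where l: "0 < l" "(\<Sum>m\<in>UNIV. x m) = \<rho>"
      and x: "\<And>m. x m \<in> (if l > ?\<theta> m then {0} else if l = ?\<theta> m then {0..0} else {?D m l})" by blast
    have "x m = - f_alloc (v m) (a m) (b m) l" for m
      using x[of m] sel[OF l(1), of m] by (auto split: if_splits)
    then show ?thesis using l by (auto simp: S_def)
  qed
  show "\<exists>!l. 0 < l \<and> S l = \<rho>" if "0 < \<rho>" using ex unique[OF that] by blast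
qed

lemma budget_price_B:
  fixes v a b :: "'m::finite \<Rightarrow> real"
  assumes \<rho>: "0 \<le> \<rho>" and v: "\<And>m. 0 < v m" and ab: "\<And>m. 0 < b m" "\<And>m. b m \<le> a m"
  shows "\<exists>h>0. g_selections v a b \<rho> h \<noteq> {}" and "0 < \<rho> \<Longrightarrow> \<exists>!h. 0 < h \<and> g_selections v a b \<rho> h \<noteq> {}"
proof -
  let ?D = "\<lambda>m. demand (v m) (a m) (b m)" and ?\<theta> = "\<lambda>m. g_thr (v m) (a m) (b m)" and ?\<tau> = "\<lambda>m. tau (a m) (b m)"
  have a: "0 < a m" for m using ab[of m] by simp
  note \<tau> = tau_props[OF ab]
  have \<theta>: "0 < ?\<theta> m" for m unfolding \<tau>(5) using v decay_rate_pos[OF a ab(1) \<tau>(3)] by simp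
  have D\<theta>: "?D m (?\<theta> m) = ?\<tau> m" for m
    unfolding \<tau>(5) by (rule demand_decay_rate[OF v a ab(1) \<tau>(3)])
  have mono: "?D m h' < ?D m h" if "0 < h" "h < h'" for m h h' by (rule demand_less[OF v a ab(1) that])
  have unique: "h = h'" if "0 < \<rho>" and h: "0 < h" "0 < h'" and x: "x \<in> g_selections v a b \<rho> h" and x': "x' \<in> g_selections v a b \<rho> h'" for h h' x x'
    by (rule clearing_price_unique[where D = ?D and \<theta> = ?\<theta> and \<tau> = ?\<tau> and x = x and x' = x', OF that(1) \<tau>(3) D\<theta> mono h])
       (use x x' g_alloc_props(2)[OF v ab h(1)] g_alloc_props(2)[OF v ab h(2)] in \<open>simp_all add: g_selections_def\<close>)
  show ex: "\<exists>h>0. g_selections v a b \<rho> h \<noteq> {}"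
  proof (cases "\<rho> = 0")
    case True
    \<comment> \<open>The added 1 puts the price strictly above every threshold, where each
      allocation is {0}.\<close>
    let ?h = "(\<Sum>m\<in>UNIV. ?\<theta> m) + 1"
    have le: "?\<theta> m \<le> (\<Sum>m\<in>UNIV. ?\<theta> m)" for m using \<theta> by (intro member_le_sum) (auto simp: less_imp_le)
    have "?\<theta> m < ?h" for m using le[of m] by linarith
    then have "(\<lambda>_. 0) \<in> g_selections v a b \<rho> ?h" using True by (simp add: g_selections_def g_alloc_def)
    moreover have "0 < ?h" using \<theta> by (intro add_nonneg_pos sum_nonneg) (auto simp: less_imp_le)
    ultimately show ?thesis by blast
  next
    case False
    then have \<rho>': "0 < \<rho>" using \<rho> by simp
    have "\<exists>h>0. \<exists>x. (\<forall>m. x m \<in> (if h > ?\<theta> m then {0} else if h = ?\<theta> m then {0..?\<tau> m} else {?D m h})) \<and>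
        (\<Sum>m\<in>UNIV. x m) = \<rho>"
      by (rule clearing_price[where D = ?D, OF \<rho>' \<theta> \<tau>(3) D\<theta> mono continuous_on_demand[OF v a ab(1)]])
         (use demand_reaches[OF v a ab(1) \<tau>(3)] in \<open>simp_all add: \<tau>(5)\<close>)
    then obtain h x where h: "0 < h" "(\<Sum>m\<in>UNIV. x m) = \<rho>"
      and x: "\<And>m. x m \<in> (if h > ?\<theta> m then {0} else if h = ?\<theta> m then {0..?\<tau> m} else {?D m h})" by blast
    then have "x \<in> g_selections v a b \<rho> h"
      using g_alloc_props(2)[OF v ab h(1)] by (simp add: g_selections_def)
    then show ?thesis using h(1) by blast
  qed
  show "\<exists>!h. 0 < h \<and> g_selections v a b \<rho> h \<noteq> {}" if "0 < \<rho>" using ex unique[OF that] by blast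
qed

text \<open>The range stops at the threshold because the allocation is constantly 0 from there
  on.\<close>

lemma f_alloc_strict_mono:
  assumes v: "0 < v" and ab: "0 < b" "b \<le> a"
  shows "strict_mono_on {0<..f_thr v a b} (f_alloc v a b)"
proof (rule strict_mono_onI)
  fix l l' assume "l \<in> {0<..f_thr v a b}" "l' \<in> {0<..f_thr v a b}" "l < l'"
  then show "f_alloc v a b l < f_alloc v a b l'"
    using demand_less[OF v ab(1), of a l l'] ab by (simp add: f_alloc_props(2)[OF v ab])
qed

lemma g_alloc_strict_antimono:
  assumes v: "0 < v" and ab: "0 < b" "b \<le> a" and h: "0 < h" "h < h'" "h' \<le> g_thr v a b"
    and x: "x \<in> g_alloc v a b h" "x' \<in> g_alloc v a b h'"
  shows "x' < x"
proof (rule correspondence_strict_antimono[OF _ _ tau_props(3)[OF ab] h])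
  have a: "0 < a" using ab by simp
  show "demand v a b y' < demand v a b y" if "0 < y" "y < y'" for y y'
    by (rule demand_less[OF v a ab(1) that])
  show "demand v a b (g_thr v a b) = tau a b"
    unfolding tau_props(5)[OF ab] by (rule demand_decay_rate[OF v a ab(1) tau_props(3)[OF ab]])
  show "x \<in> (if h > g_thr v a b then {0} else if h = g_thr v a b then {0..tau a b} else {demand v a b h})"
    using x(1) g_alloc_props(2)[OF v ab h(1)] by simp
  show "x' \<in> (if h' > g_thr v a b then {0} else if h' = g_thr v a b then {0..tau a b} else {demand v a b h'})"
    using x(2) g_alloc_props(2)[OF v ab, of h'] h by simp
qed

text \<open>Uniqueness of the price is claimed for a positive budget: with \<rho> = 0 every price
  above all thresholds clears. The equivalences are stated for each clearing price, so they cover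
  \<rho> = 0 as well. They constrain the marginals only; the dependence between battlefields is
  free.\<close>

theorem mainTheorem2:
  fixes v a b :: "'m::finite \<Rightarrow> real" and \<rho> wA wB :: real
  assumes "\<rho> \<ge> 0"
    and "\<And>m. v m > 0" and "(\<Sum>m\<in>UNIV. v m) = 1"
    and "\<And>m. b m > 0" and "\<And>m. a m \<ge> b m"
    and "wA \<ge> 0" and "wB \<ge> 0" and "wA + wB = 1"
  shows
    "(wA = wB \<longrightarrow>
        (\<forall>F. intervention_dist F \<and> (\<forall>m. marginal F m = dirac 0) \<longrightarrow>
           is_NSE v a b wA wB \<rho> F (SX_eq a b) (SY_eq a b)))
   \<and> (wA > wB \<longrightarrow>
        (\<forall>m l. 0 < l \<and> l < f_thr (v m) (a m) (b m) \<longrightarrow> (\<exists>!p. is_p (v m) (a m) (b m) l p)) \<and>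
        (\<forall>m. strict_mono_on {0<..f_thr (v m) (a m) (b m)} (f_alloc (v m) (a m) (b m))) \<and>
        (\<exists>l0>0. (\<Sum>m\<in>UNIV. - f_alloc (v m) (a m) (b m) l0) = \<rho>) \<and>
        (\<rho> > 0 \<longrightarrow> (\<exists>!l0. l0 > 0 \<and> (\<Sum>m\<in>UNIV. - f_alloc (v m) (a m) (b m) l0) = \<rho>)) \<and>
        (\<forall>l0>0. (\<Sum>m\<in>UNIV. - f_alloc (v m) (a m) (b m) l0) = \<rho> \<longrightarrow>
           (\<forall>F. is_NSE v a b wA wB \<rho> F (SX_eq a b) (SY_eq a b) \<longleftrightarrow>
              intervention_dist F \<and>
              (\<forall>m. marginal F m = dirac (f_alloc (v m) (a m) (b m) l0)))))
   \<and> (wA < wB \<longrightarrow>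
        (\<forall>m. \<exists>!t. is_tau (a m) (b m) t) \<and>
        (\<forall>m h. 0 < h \<and> h < g_thr (v m) (a m) (b m) \<longrightarrow> (\<exists>!q. is_q (v m) (a m) (b m) h q)) \<and>
        (\<forall>m h h' x x'. 0 < h \<and> h < h' \<and> h' \<le> g_thr (v m) (a m) (b m) \<and>
           x \<in> g_alloc (v m) (a m) (b m) h \<and> x' \<in> g_alloc (v m) (a m) (b m) h' \<longrightarrow> x' < x) \<and>
        (\<exists>h0>0. g_selections v a b \<rho> h0 \<noteq> {}) \<and>
        (\<rho> > 0 \<longrightarrow> (\<exists>!h0. h0 > 0 \<and> g_selections v a b \<rho> h0 \<noteq> {})) \<and>
        (\<forall>h0>0. g_selections v a b \<rho> h0 \<noteq> {} \<longrightarrow>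
           (\<forall>F. is_NSE v a b wA wB \<rho> F (SX_eq a b) (SY_eq a b) \<longleftrightarrow>
              intervention_dist F \<and>
              (\<exists>x\<in>g_selections v a b \<rho> h0. \<forall>m.
                 marginal F m =
                   (if x m < tau (a m) (b m)
                    then mixture (x m / tau (a m) (b m)) (dirac (tau (a m) (b m))) (dirac 0)
                    else dirac (x m))))))"
proof -
  note \<rho> = assms(1) and v = assms(2) and ab = assms(4,5)
  \<comment> \<open>Supplies the uniform bound on the battlefield payoffs that
    \<open>budget_duality\<close> uses for integrability.\<close>
  have v1: "v m \<le> 1" for m
    using member_le_sum[of m UNIV v] v assms(3) by (simp add: less_imp_le)
  have ge: "\<And>m. b m \<le> a m" using ab(2) by simp
  have pos: "0 < v m" "0 < b m" for m using v ab(1) by auto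
  show ?thesis
  proof (intro conjI impI)
    assume "wA = wB"
    then show "\<forall>F. intervention_dist F \<and> (\<forall>m. marginal F m = dirac 0) \<longrightarrow>
           is_NSE v a b wA wB \<rho> F (SX_eq a b) (SY_eq a b)"
      using NSE_equal_weights[of v b a] pos ge by blast
  next
    show "\<forall>m l. 0 < l \<and> l < f_thr (v m) (a m) (b m) \<longrightarrow> (\<exists>!p. is_p (v m) (a m) (b m) l p)"
      using f_alloc_props(1)[OF pos ge] by blast
    show "\<forall>m. strict_mono_on {0<..f_thr (v m) (a m) (b m)} (f_alloc (v m) (a m) (b m))"
      using f_alloc_strict_mono[OF pos ge] by blast
    show "\<exists>l0>0. (\<Sum>m\<in>UNIV. - f_alloc (v m) (a m) (b m) l0) = \<rho>"
      by (rule budget_price_A(1)[OF \<rho> pos ge])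
    show "\<exists>!l0. l0 > 0 \<and> (\<Sum>m\<in>UNIV. - f_alloc (v m) (a m) (b m) l0) = \<rho>" if "\<rho> > 0"
      by (rule budget_price_A(2)[OF \<rho> pos ge that])
    show "\<forall>l0>0. (\<Sum>m\<in>UNIV. - f_alloc (v m) (a m) (b m) l0) = \<rho> \<longrightarrow>
           (\<forall>F. is_NSE v a b wA wB \<rho> F (SX_eq a b) (SY_eq a b) \<longleftrightarrow>
              intervention_dist F \<and>
              (\<forall>m. marginal F m = dirac (f_alloc (v m) (a m) (b m) l0)))" if "wA > wB"
      using NSE_favouring_A[of \<rho> v 1 b a, OF \<rho> pos(1) v1 pos(2) ge that] by blast
  next
    show "\<forall>m. \<exists>!t. is_tau (a m) (b m) t"
      using ex1_tau[OF pos(2) ge] by blast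
    show "\<forall>m h. 0 < h \<and> h < g_thr (v m) (a m) (b m) \<longrightarrow> (\<exists>!q. is_q (v m) (a m) (b m) h q)"
      using g_alloc_props(1)[OF pos ge] by blast
    show "\<forall>m h h' x x'. 0 < h \<and> h < h' \<and> h' \<le> g_thr (v m) (a m) (b m) \<and>
           x \<in> g_alloc (v m) (a m) (b m) h \<and> x' \<in> g_alloc (v m) (a m) (b m) h' \<longrightarrow> x' < x"
      using g_alloc_strict_antimono[OF pos ge] by blast
    show "\<exists>h0>0. g_selections v a b \<rho> h0 \<noteq> {}"
      by (rule budget_price_B(1)[OF \<rho> pos ge])
    show "\<exists>!h0. h0 > 0 \<and> g_selections v a b \<rho> h0 \<noteq> {}" if "\<rho> > 0"
      by (rule budget_price_B(2)[OF \<rho> pos ge that])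
    show "\<forall>h0>0. g_selections v a b \<rho> h0 \<noteq> {} \<longrightarrow>
           (\<forall>F. is_NSE v a b wA wB \<rho> F (SX_eq a b) (SY_eq a b) \<longleftrightarrow>
              intervention_dist F \<and>
              (\<exists>x\<in>g_selections v a b \<rho> h0. \<forall>m.
                 marginal F m =
                   (if x m < tau (a m) (b m)
                    then mixture (x m / tau (a m) (b m)) (dirac (tau (a m) (b m))) (dirac 0)
                    else dirac (x m))))" if "wA < wB"
      using NSE_favouring_B[of \<rho> v 1 b a, OF \<rho> pos(1) v1 pos(2) ge that] unfolding two_point_def by blast
  qed
qed

end
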